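(* Let $\mu,\nu\ge 0$ and $\alpha>0$ be real and put $\vartheta=\alpha-\mu-\nu$. Suppose $\vartheta\neq 0,1,2,\ldots$. Then for $0<a\le\pi$ one has the convergent expansion $$S_{\mu,\nu}(a)=\hat F(1)+\sum_{m=0}^\infty A_m\left(\tfrac12 a\right)^{2m},$$ where $$\hat F(1)=\frac{(\frac12 a)^{\vartheta-1}\,\Gamma(\alpha)\,\Gamma(\frac12\mu+\frac12\nu+\frac12-\frac12\alpha)}{2\,\Gamma(\frac12\alpha+\frac12\mu-\frac12\nu+\frac12)\,\Gamma(\frac12\alpha+\frac12\mu+\frac12\nu+\frac12)\,\Gamma(\frac12\alpha+\frac12\nu-\frac12\mu+\frac12)}$$ and $$A_m=\frac{(-1)^m}{m!}\,\frac{\Gamma(1+\mu+\nu+2m)\,\zeta(\vartheta-2m)}{\Gamma(1+\mu+m)\,\Gamma(1+\nu+m)\,\Gamma(1+\mu+\nu+m)}.$$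
   Context: $J_\nu$ is the Bessel function of the first kind, $\zeta$ is the (analytically continued) Riemann zeta function, and $1/\Gamma$ is understood to be $0$ at the poles of $\Gamma$. For $a>0$, $$S_{\mu,\nu}(a)=\frac{2^{\mu+\nu}}{a^{\mu+\nu}}\sum_{n=1}^\infty\frac{J_\mu(na)\,J_\nu(na)}{n^{\alpha}},$$ which converges absolutely for $\alpha>0$. *)

theory Defs
  imports "HOL-Complex_Analysis.Complex_Analysis"
begin

(* The Bessel function of the first kind of real order nu, for real argument x > 0 only:
   at x = 0 the convention 0 powr 0 = 0 would give the wrong value for nu = 0. *)
definition bessel_J :: "real \<Rightarrow> real \<Rightarrow> real" where
  "bessel_J \<nu> x =
     (\<Sum>k. (-1) ^ k / fact k * rGamma (\<nu> + real k + 1) * (x / 2) powr (\<nu> + 2 * real k))"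

(* The Riemann zeta function, as the analytic continuation of its Dirichlet series to the
   complex plane without 1. The clause on the pole only pins down the value of the total
   function there, so that the continuation is unique. *)
definition riemann_zeta :: "complex \<Rightarrow> complex" where
  "riemann_zeta = (THE f.
     f holomorphic_on - {1} \<and>
     (\<forall>s. 1 < Re s \<longrightarrow> f s = (\<Sum>n. 1 / of_nat (Suc n) powr s)) \<and>
     f 1 = 0)"

definition schlomilch_S :: "real \<Rightarrow> real \<Rightarrow> real \<Rightarrow> real \<Rightarrow> real" where
  "schlomilch_S \<alpha> \<mu> \<nu> a =
     2 powr (\<mu> + \<nu>) / a powr (\<mu> + \<nu>) *
     (\<Sum>n. bessel_J \<mu> (real (Suc n) * a) * bessel_J \<nu> (real (Suc n) * a) / real (Suc n) powr \<alpha>)"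

(* rGamma is the entire function 1 / Gamma, which vanishes at the poles of Gamma. *)
definition Fhat1 :: "real \<Rightarrow> real \<Rightarrow> real \<Rightarrow> real \<Rightarrow> real" where
  "Fhat1 \<alpha> \<mu> \<nu> a =
     (a / 2) powr ((\<alpha> - \<mu> - \<nu>) - 1) * Gamma \<alpha> * Gamma (\<mu> / 2 + \<nu> / 2 + 1 / 2 - \<alpha> / 2) / 2 *
     rGamma (\<alpha> / 2 + \<mu> / 2 - \<nu> / 2 + 1 / 2) *
     rGamma (\<alpha> / 2 + \<mu> / 2 + \<nu> / 2 + 1 / 2) *
     rGamma (\<alpha> / 2 + \<nu> / 2 - \<mu> / 2 + 1 / 2)"

definition coeff_A :: "real \<Rightarrow> real \<Rightarrow> real \<Rightarrow> nat \<Rightarrow> complex" where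
  "coeff_A \<alpha> \<mu> \<nu> m =
     (-1) ^ m / fact m *
     (of_real (Gamma (1 + \<mu> + \<nu> + 2 * real m)) *
      riemann_zeta (of_real ((\<alpha> - \<mu> - \<nu>) - 2 * real m))) *
     of_real (rGamma (1 + \<mu> + real m) * rGamma (1 + \<nu> + real m) * rGamma (1 + \<mu> + \<nu> + real m))"

end

theory Submission
  imports Defs "HOL-Real_Asymp.Real_Asymp" "HOL-Probability.Giry_Monad"
begin

text \<open>
  Write \<open>s = \<mu> + \<nu>\<close> and \<open>\<theta> = \<alpha> - s\<close>. The product of the two Bessel functions is
  \<open>(x/2)\<^sup>s \<Sum>\<^sub>m c\<^sub>m (x/2)\<^sup>2\<^sup>m\<close> with \<open>c\<^sub>m = bessel_prod_coeff \<mu> \<nu> m\<close>, and the coefficient of the theorem is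
  \<open>A\<^sub>m = c\<^sub>m \<zeta>(\<theta> - 2 m)\<close>: the series in \<open>a\<close> is what one gets by expanding every term of the sum in
  powers of \<open>n\<close> and assigning to each divergent sum over \<open>n\<close> its zeta value. The term \<open>Fhat1\<close>, a
  constant multiple of \<open>a\<close> to the power \<open>\<theta> - 1\<close>, is what this formal exchange misses.

  The exchange is made rigorous first for \<open>\<theta> = p + 1\<close> with \<open>0 < p < 1/2\<close>. The numbers \<open>\<bar>c\<^sub>m\<bar>\<close> are, up
  to elementary factors, the even moments of a finite measure \<open>M\<close> on \<open>(0, 1)\<close>, because the quotient
  of Gamma values in them is a product of three Beta integrals (\<open>bessel_moment_measure\<close>). Hence
  \<open>(x/2)\<close> to the power \<open>-s\<close> times the product of Bessel functions is the integral of
  \<open>cos (2 x t)\<close> against \<open>M\<close> (\<open>bessel_entire_prod_integral\<close>), and the Schloemilch sum is the integral of the cosine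
  series with coefficients \<open>1 / n\<close> to the power \<open>\<theta>\<close> at the point \<open>2 a t\<close>. For \<open>a \<le> \<pi>\<close> this point
  lies in \<open>(0, 2 \<pi>)\<close>, where the cosine series is a multiple of \<open>x powr p\<close> plus an even power series
  whose coefficients past the constant term all have one sign (\<open>clausen_expansion\<close>). Integrating termwise turns \<open>x powr p\<close> into
  the \<open>p\<close>-th moment of \<open>M\<close>, which is the factor in \<open>Fhat1\<close>, and the even powers into the terms with
  \<open>A\<^sub>m\<close> (\<open>schlomilch_expansion_near_boundary\<close>).

  The expansion of the cosine series comes from the Mellin transform of the partial fractions of the
  Poisson kernel of the half-plane. Its coefficients involve \<open>\<zeta>(2 m - p)\<close>; the functional equation
  converts them to \<open>\<zeta>(\<theta> - 2 m)\<close>. That equation is a consequence of the same partial fractions: the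
  cosine series has mean zero over a period, and the mean of the other side is a limit of corrected
  partial sums of the divergent series for \<open>\<zeta>(- p)\<close> (\<open>zeta_corrected_sum_tendsto\<close>).

  Finally both sides are continued analytically in \<open>\<alpha>\<close> through the half-plane \<open>Re \<alpha> > 0\<close> with the
  points \<open>s + 1 + 2 k\<close> removed. There the sum converges locally uniformly because Bessel functions
  decay like the inverse square root of the argument (\<open>bessel_J_bound\<close>). The series in \<open>a\<close> does so up
  to \<open>a = \<pi>\<close> because, by the functional equation, its terms are dominated by a sequence to
  which Raabe's test applies (\<open>summable_coeff_majorant\<close>).
\<close>

section \<open>Identities and bounds for the Gamma function\<close>

lemma Gamma_duplication_real:
  assumes "w > (0::real)"
  shows "Gamma w = 2 powr (w - 1) / sqrt pi * (Gamma (w / 2) * Gamma ((w + 1) / 2))"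
proof -
  define z where "z = w / 2"
  have "complex_of_real z \<notin> \<int>\<^sub>\<le>\<^sub>0" "complex_of_real z + 1 / 2 \<notin> \<int>\<^sub>\<le>\<^sub>0"
    using assms by (auto elim!: nonpos_Ints_cases simp: complex_eq_iff z_def)
  from Gamma_legendre_duplication[OF this]
  have "complex_of_real (Gamma z * Gamma (z + 1 / 2)) =
      complex_of_real (exp ((1 - 2 * z) * ln 2) * sqrt pi * Gamma (2 * z))"
    by (simp add: Gamma_complex_of_real[symmetric] exp_of_real [symmetric] del: exp_of_real)
  hence "Gamma z * Gamma (z + 1 / 2) = exp ((1 - 2 * z) * ln 2) * sqrt pi * Gamma (2 * z)"
    by (simp only: of_real_eq_iff)
  moreover have "2 powr (2 * z - 1) * exp ((1 - 2 * z) * ln 2) = (1::real)"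
    by (simp add: powr_def flip: exp_add) (simp add: algebra_simps)
  moreover have "w = 2 * z" "w / 2 = z" "(w + 1) / 2 = z + 1 / 2" by (simp_all add: z_def field_simps)
  ultimately show ?thesis by (simp add: field_simps)
qed

lemma Gamma_reflection_real: "Gamma x * Gamma (1 - x) = pi / sin (pi * (x::real))"
proof -
  have "complex_of_real (Gamma x * Gamma (1 - x)) = complex_of_real (pi / sin (pi * x))"
    using Gamma_reflection_complex[of "complex_of_real x"]
    by (simp add: Gamma_complex_of_real[symmetric] sin_of_real[symmetric] del: sin_of_real)
  thus ?thesis by (simp only: of_real_eq_iff)
qed

lemma rGamma_real_pos: "x > 0 \<Longrightarrow> rGamma (x::real) > 0"
  by (simp add: rGamma_inverse_Gamma Gamma_real_pos)

text \<open>The modulus of the integrand of Euler's integral depends only on the real part of the argument.\<close>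
lemma norm_Gamma_le:
  assumes "Re z > 0"
  shows "norm (Gamma z) \<le> Gamma (Re z)"
proof -
  have I: "((\<lambda>t. complex_of_real t powr (z - 1) / of_real (exp t)) has_integral Gamma z) {0..}"
    by (rule Gamma_integral_complex[OF assms])
  have J: "((\<lambda>t. t powr (Re z - 1) / exp t) has_integral Gamma (Re z)) {0..}"
    by (rule Gamma_integral_real[OF assms])
  have "norm (integral {0..} (\<lambda>t. complex_of_real t powr (z - 1) / of_real (exp t))) \<le>
        integral {0..} (\<lambda>t. t powr (Re z - 1) / exp t)"
  proof (rule integral_norm_bound_integral)
    fix t :: real assume "t \<in> {0..}"
    thus "norm (complex_of_real t powr (z - 1) / of_real (exp t)) \<le> t powr (Re z - 1) / exp t"
      by (simp add: norm_divide norm_powr_real_powr)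
  qed (use I J in \<open>auto simp: integrable_on_def\<close>)
  thus ?thesis using I J by (simp add: integral_unique)
qed

section \<open>Bessel functions\<close>

definition exp_minus_coeff :: "nat \<Rightarrow> real" where
  "exp_minus_coeff k = (-1) ^ k / fact k"

definition bessel_coeff :: "real \<Rightarrow> nat \<Rightarrow> real" where
  "bessel_coeff \<nu> k = exp_minus_coeff k * rGamma (\<nu> + real k + 1)"

text \<open>Dividing the Bessel function by its branching factor \<open>(x / 2) powr \<nu>\<close> leaves an entire function of
  \<open>(x / 2)\<^sup>2\<close>; this is that function, in the variable \<open>(x / 2)\<^sup>2\<close>.\<close>
definition bessel_entire :: "real \<Rightarrow> real \<Rightarrow> real" where
  "bessel_entire \<nu> z = (\<Sum>k. bessel_coeff \<nu> k * z ^ k)"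

lemma bessel_coeff_neq_0: "\<nu> \<ge> 0 \<Longrightarrow> bessel_coeff \<nu> k \<noteq> 0"
  using rGamma_real_pos[of "\<nu> + real k + 1"] by (simp add: bessel_coeff_def exp_minus_coeff_def)

lemma exp_minus_coeff_Suc: "exp_minus_coeff k = - (real k + 1) * exp_minus_coeff (Suc k)"
proof -
  have "(fact k + fact k * real k :: real) > 0" by (intro add_pos_nonneg) auto
  thus ?thesis by (simp add: exp_minus_coeff_def field_simps)
qed

lemma bessel_coeff_Suc:
  assumes "\<nu> \<ge> 0"
  shows "bessel_coeff \<nu> k = - (real (Suc k) * (\<nu> + real k + 1)) * bessel_coeff \<nu> (Suc k)"
proof -
  have "rGamma (\<nu> + real k + 1) = (\<nu> + real k + 1) * rGamma (\<nu> + real k + 1 + 1)"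
    using assms by (subst rGamma_plus1) auto
  moreover have "\<nu> + real k + 1 + 1 = \<nu> + real (Suc k) + 1" by simp
  ultimately have "rGamma (\<nu> + real k + 1) = (\<nu> + real k + 1) * rGamma (\<nu> + real (Suc k) + 1)"
    by metis
  with exp_minus_coeff_Suc[of k] show ?thesis
    unfolding bessel_coeff_def of_nat_Suc by algebra
qed

lemma summable_bessel_coeff:
  assumes "\<nu> \<ge> 0"
  shows "summable (\<lambda>k. bessel_coeff \<nu> k * z ^ k)"
proof -
  have "(\<lambda>k. norm (bessel_coeff \<nu> k) / norm (bessel_coeff \<nu> (Suc k))) =
          (\<lambda>k. real (Suc k) * (\<nu> + real k + 1))"
  proof
    fix k
    have "norm (bessel_coeff \<nu> k) = real (Suc k) * (\<nu> + real k + 1) * norm (bessel_coeff \<nu> (Suc k))"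
      using assms by (subst bessel_coeff_Suc[OF assms]) (simp add: abs_mult)
    thus "norm (bessel_coeff \<nu> k) / norm (bessel_coeff \<nu> (Suc k)) = real (Suc k) * (\<nu> + real k + 1)"
      using bessel_coeff_neq_0[OF assms, of "Suc k"] by simp
  qed
  moreover have "filterlim (\<lambda>k. real (Suc k) * (\<nu> + real k + 1)) at_top sequentially"
    by real_asymp
  ultimately have "conv_radius (bessel_coeff \<nu>) = \<infinity>"
    using bessel_coeff_neq_0[OF assms]
    by (intro conv_radius_ratio_limit_ereal_nonzero[where c = \<infinity>])
       (auto simp: tendsto_PInfty_eq_at_top divide_inverse intro!: )
  thus ?thesis
    by (intro summable_in_conv_radius) auto
qed

lemma bessel_entire_deriv:
  assumes "\<nu> \<ge> 0"
  shows "(bessel_entire \<nu> has_real_derivative - bessel_entire (\<nu> + 1) z) (at z)"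
proof -
  have "(bessel_entire \<nu> has_real_derivative (\<Sum>n. diffs (bessel_coeff \<nu>) n * z ^ n)) (at z)"
    unfolding bessel_entire_def
    by (rule termdiffs_strong_converges_everywhere) (use summable_bessel_coeff assms in auto)
  also have "(\<lambda>n. diffs (bessel_coeff \<nu>) n) = (\<lambda>n. - bessel_coeff (\<nu> + 1) n)"
  proof
    fix n
    have "\<nu> + real (Suc n) + 1 = \<nu> + 1 + real n + 1" by simp
    hence "rGamma (\<nu> + real (Suc n) + 1) = rGamma (\<nu> + 1 + real n + 1)" by simp
    with exp_minus_coeff_Suc[of n] show "diffs (bessel_coeff \<nu>) n = - bessel_coeff (\<nu> + 1) n"
      unfolding diffs_def bessel_coeff_def of_nat_Suc by algebra
  qed
  finally show ?thesis
    using suminf_minus[OF summable_bessel_coeff[of "\<nu>+1" z]] assms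
    by (simp add: bessel_entire_def [abs_def])
qed

lemma bessel_entire_recurrence:
  assumes "\<nu> \<ge> 0"
  shows "bessel_entire \<nu> z = (\<nu> + 1) * bessel_entire (\<nu> + 1) z - z * bessel_entire (\<nu> + 2) z"
proof -
  let ?f = "\<lambda>k. bessel_coeff (\<nu>+2) k * z ^ k"
  have s2: "?f sums bessel_entire (\<nu> + 2) z"
    unfolding bessel_entire_def using summable_bessel_coeff[of "\<nu>+2" z] assms by (auto intro: summable_sums)
  have s1: "(\<lambda>k. bessel_coeff (\<nu>+1) k * z ^ k) sums bessel_entire (\<nu> + 1) z"
    unfolding bessel_entire_def using summable_bessel_coeff[of "\<nu>+1" z] assms by (auto intro: summable_sums)
  have s0: "(\<lambda>k. bessel_coeff \<nu> k * z ^ k) sums bessel_entire \<nu> z"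
    unfolding bessel_entire_def using summable_bessel_coeff[of "\<nu>" z] assms by (auto intro: summable_sums)
  define g where "g = (\<lambda>k. case k of 0 \<Rightarrow> 0 | Suc j \<Rightarrow> z * ?f j)"
  have "(\<lambda>k. g (Suc k)) sums (z * bessel_entire (\<nu>+2) z)"
    unfolding g_def using sums_mult[OF s2, of z] by simp
  hence "g sums (z * bessel_entire (\<nu>+2) z)"
    by (subst (asm) sums_Suc_iff) (simp add: g_def)
  from sums_diff[OF sums_mult[OF s1, of "\<nu>+1"] this]
  have "(\<lambda>k. (\<nu> + 1) * (bessel_coeff (\<nu>+1) k * z ^ k) - g k) sums
     ((\<nu> + 1) * bessel_entire (\<nu> + 1) z - z * bessel_entire (\<nu> + 2) z)" .
  moreover have "(\<nu> + 1) * (bessel_coeff (\<nu>+1) k * z ^ k) - g k = bessel_coeff \<nu> k * z ^ k" for k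
  proof (cases k)
    case 0
    have "rGamma (\<nu> + 1) = (\<nu> + 1) * rGamma (\<nu> + 1 + 1)"
      using assms by (subst rGamma_plus1) auto
    thus ?thesis using 0 by (simp add: g_def bessel_coeff_def exp_minus_coeff_def add_ac)
  next
    case (Suc j)
    have "rGamma (\<nu> + real j + 2) = (\<nu> + real j + 2) * rGamma (\<nu> + real j + 2 + 1)"
      using assms by (subst rGamma_plus1) auto
    moreover have "\<nu> + 1 + real (Suc j) + 1 = \<nu> + real j + 2 + 1" "\<nu> + 2 + real j + 1 = \<nu> + real j + 2 + 1"
      "\<nu> + real (Suc j) + 1 = \<nu> + real j + 2" by simp_all
    ultimately have *: "rGamma (\<nu> + real (Suc j) + 1) = (\<nu> + real j + 2) * rGamma (\<nu> + real j + 2 + 1)"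
      "rGamma (\<nu> + 1 + real (Suc j) + 1) = rGamma (\<nu> + real j + 2 + 1)"
      "rGamma (\<nu> + 2 + real j + 1) = rGamma (\<nu> + real j + 2 + 1)" by metis+
    show ?thesis
      unfolding Suc g_def bessel_coeff_def nat.case * exp_minus_coeff_Suc[of j]
      by (simp add: algebra_simps)
  qed
  ultimately show ?thesis using s0 sums_unique2 by fastforce
qed

lemma bessel_J_altdef:
  assumes "\<nu> \<ge> 0" "x > 0"
  shows "bessel_J \<nu> x = (x / 2) powr \<nu> * bessel_entire \<nu> ((x / 2)\<^sup>2)"
proof -
  have "(x / 2) powr (\<nu> + 2 * real k) = (x / 2) powr \<nu> * ((x / 2)\<^sup>2) ^ k" for k
    using assms powr_realpow[of "x/2" "2*k"] by (simp add: powr_add power_mult)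
  hence "bessel_J \<nu> x = (\<Sum>k. (x / 2) powr \<nu> * (bessel_coeff \<nu> k * ((x / 2)\<^sup>2) ^ k))"
    unfolding bessel_J_def bessel_coeff_def exp_minus_coeff_def by (simp add: mult_ac)
  also have "\<dots> = (x / 2) powr \<nu> * bessel_entire \<nu> ((x / 2)\<^sup>2)"
    unfolding bessel_entire_def using summable_bessel_coeff[OF assms(1)] by (subst suminf_mult) auto
  finally show ?thesis .
qed

lemma bessel_J_deriv:
  assumes "\<nu> \<ge> 0" "x > 0"
  shows "(bessel_J \<nu> has_real_derivative (\<nu> / x * bessel_J \<nu> x - bessel_J (\<nu> + 1) x)) (at x)"
proof -
  have "((\<lambda>x. (x / 2) powr \<nu> * bessel_entire \<nu> ((x / 2)\<^sup>2)) has_real_derivative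
      (\<nu> * (x / 2) powr (\<nu> - 1) * (1/2) * bessel_entire \<nu> ((x / 2)\<^sup>2)
        + (- bessel_entire (\<nu> + 1) ((x / 2)\<^sup>2) * (x / 2)) * (x / 2) powr \<nu>)) (at x)"
    using assms
    by (auto intro!: derivative_eq_intros DERIV_chain2[OF bessel_entire_deriv]
             simp: field_simps power2_eq_square)
  also have "(\<nu> * (x / 2) powr (\<nu> - 1) * (1/2) * bessel_entire \<nu> ((x / 2)\<^sup>2)
        + (- bessel_entire (\<nu> + 1) ((x / 2)\<^sup>2) * (x / 2)) * (x / 2) powr \<nu>) =
       \<nu> / x * bessel_J \<nu> x - bessel_J (\<nu> + 1) x"
  proof -
    have "(x/2) powr (\<nu> - 1) = (x/2) powr \<nu> / (x/2)" "(x/2) powr (\<nu> + 1) = (x/2) powr \<nu> * (x/2)"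
      using assms powr_diff[of "x/2" \<nu> 1] powr_add[of "x/2" \<nu> 1] by simp_all
    thus ?thesis using assms
      by (simp add: bessel_J_altdef) (simp add: field_simps)
  qed
  finally show ?thesis
  proof (rule DERIV_cong_ev[THEN iffD1, rotated -1])
    show "\<forall>\<^sub>F x in nhds x. (x / 2) powr \<nu> * bessel_entire \<nu> ((x / 2)\<^sup>2) = bessel_J \<nu> x"
      using eventually_nhds_in_open[of "{0<..}" x] assms
      by (auto elim!: eventually_mono simp: bessel_J_altdef)
  qed auto
qed

lemma bessel_J_recurrence:
  assumes "\<nu> \<ge> 0" "x > 0"
  shows "bessel_J \<nu> x + bessel_J (\<nu> + 2) x = 2 * (\<nu> + 1) / x * bessel_J (\<nu> + 1) x"
proof -
  have "(x/2) powr (\<nu> + 2) = (x/2) powr \<nu> * (x/2)^2" "(x/2) powr (\<nu> + 1) = (x/2) powr \<nu> * (x/2)"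
    using assms powr_add[of "x/2" \<nu> 2] powr_add[of "x/2" \<nu> 1] powr_realpow[of "x/2" 2] by simp_all
  moreover have "2 * (\<nu> + 1) / x * (A * (x / 2) * B) = (\<nu> + 1) * A * B" for A B
    using assms by simp
  ultimately show ?thesis using assms
    by (simp only: bessel_J_altdef bessel_entire_recurrence[of \<nu> "(x / 2)\<^sup>2"]
          add_nonneg_nonneg zero_le_one zero_le_numeral)
       (simp add: algebra_simps)
qed

lemma bessel_J_Suc_deriv:
  assumes "\<nu> \<ge> 0" "x > 0"
  shows "(bessel_J (\<nu> + 1) has_real_derivative (bessel_J \<nu> x - (\<nu> + 1) / x * bessel_J (\<nu> + 1) x)) (at x)"
proof -
  have "(\<nu> + 1) / x * bessel_J (\<nu> + 1) x - bessel_J (\<nu> + 1 + 1) x =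
    bessel_J \<nu> x - (\<nu> + 1) / x * bessel_J (\<nu> + 1) x"
    using bessel_J_recurrence[OF assms] by (simp add: add_divide_distrib algebra_simps)
  thus ?thesis
    using bessel_J_deriv[of "\<nu> + 1" x] assms add_nonneg_nonneg[OF assms(1) zero_le_one] by metis
qed

text \<open>The pair \<open>J\<^sub>\<nu>\<close>, \<open>J\<^sub>\<nu>\<^sub>+\<^sub>1\<close> solves a first-order system whose principal part is a rotation, so that
  \<open>x (J\<^sub>\<nu>\<^sup>2 + J\<^sub>\<nu>\<^sub>+\<^sub>1\<^sup>2)\<close> is almost conserved. Subtracting \<open>(2 \<nu> + 1) J\<^sub>\<nu> J\<^sub>\<nu>\<^sub>+\<^sub>1\<close> removes the part of
  its derivative that is not integrable at infinity; what is left is at most a multiple of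
  \<open>E / x\<^sup>2\<close>, and the integrating factor \<open>exp (b / x)\<close> turns this into monotonicity.\<close>
lemma bessel_J_bound:
  assumes "\<nu> \<ge> 0"
  shows "\<exists>C X. \<forall>x\<ge>X. \<bar>bessel_J \<nu> x\<bar> \<le> C / sqrt x"
proof -
  define b where "b = 2 * \<nu> + 1"
  define Q where "Q = (\<lambda>x. bessel_J \<nu> x ^ 2 + bessel_J (\<nu> + 1) x ^ 2)"
  define E where "E = (\<lambda>x. x * Q x - b * (bessel_J \<nu> x * bessel_J (\<nu> + 1) x))"
  \<comment> \<open>From here on the correction term is at most a quarter of the main term, so that \<open>E\<close> controls it.\<close>
  define X where "X = 2 * b"
  have b: "b > 0" using assms by (simp add: b_def)
  have X: "X > 0" using b by (simp add: X_def)
  have prod_le: "\<bar>bessel_J \<nu> x * bessel_J (\<nu> + 1) x\<bar> \<le> Q x / 2" for x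
  proof -
    have "0 \<le> (\<bar>bessel_J \<nu> x\<bar> - \<bar>bessel_J (\<nu> + 1) x\<bar>)\<^sup>2" by simp
    thus ?thesis by (simp add: Q_def power2_diff abs_mult)
  qed
  have Q0: "Q x \<ge> 0" for x by (simp add: Q_def)
  have E_ge: "x * Q x \<le> 2 * E x" if "x \<ge> X" for x
  proof -
    have "b * (bessel_J \<nu> x * bessel_J (\<nu> + 1) x) \<le> b * (Q x / 2)"
      using prod_le[of x] b by (intro mult_left_mono) auto
    moreover have "2 * b * Q x \<le> x * Q x"
      using that Q0[of x] by (intro mult_right_mono) (auto simp: X_def)
    ultimately have "b * (bessel_J \<nu> x * bessel_J (\<nu> + 1) x) \<le> x * Q x / 4" by simp
    hence "E x \<ge> x * Q x - x * Q x / 4" unfolding E_def by linarith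
    moreover have "x * Q x \<ge> 0" using that X Q0[of x] by simp
    ultimately show ?thesis by linarith
  qed
  have E_deriv: "(E has_real_derivative b * (bessel_J \<nu> x * bessel_J (\<nu> + 1) x) / x) (at x)"
    if x: "x > 0" for x
  proof -
    have "(E has_real_derivative
       ((1 * Q x + x * (2 * bessel_J \<nu> x * (\<nu> / x * bessel_J \<nu> x - bessel_J (\<nu> + 1) x)
        + 2 * bessel_J (\<nu> + 1) x * (bessel_J \<nu> x - (\<nu> + 1) / x * bessel_J (\<nu> + 1) x)))
        - b * ((\<nu> / x * bessel_J \<nu> x - bessel_J (\<nu> + 1) x) * bessel_J (\<nu> + 1) x +
            bessel_J \<nu> x * (bessel_J \<nu> x - (\<nu> + 1) / x * bessel_J (\<nu> + 1) x)))) (at x)"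
      unfolding E_def Q_def
      by (rule derivative_eq_intros refl bessel_J_deriv[OF assms x] bessel_J_Suc_deriv[OF assms x])+
         (simp add: algebra_simps)
    also have "((1 * Q x + x * (2 * bessel_J \<nu> x * (\<nu> / x * bessel_J \<nu> x - bessel_J (\<nu> + 1) x)
        + 2 * bessel_J (\<nu> + 1) x * (bessel_J \<nu> x - (\<nu> + 1) / x * bessel_J (\<nu> + 1) x)))
        - b * ((\<nu> / x * bessel_J \<nu> x - bessel_J (\<nu> + 1) x) * bessel_J (\<nu> + 1) x +
            bessel_J \<nu> x * (bessel_J \<nu> x - (\<nu> + 1) / x * bessel_J (\<nu> + 1) x))) =
         b * (bessel_J \<nu> x * bessel_J (\<nu> + 1) x) / x"
      using x unfolding Q_def b_def by (simp add: field_simps power2_eq_square)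
    finally show ?thesis .
  qed
  define F where "F = (\<lambda>x. E x * exp (b / x))"
  have F_deriv: "\<exists>y. (F has_real_derivative y) (at x) \<and> y \<le> 0" if x: "x \<ge> X" for x
  proof -
    from x X have x0: "x > 0" by simp
    have "(F has_real_derivative
        (b * (bessel_J \<nu> x * bessel_J (\<nu> + 1) x) / x - b * E x / x ^ 2) * exp (b / x)) (at x)"
      unfolding F_def
      using x0 by (auto intro!: derivative_eq_intros E_deriv simp: field_simps power2_eq_square)
    moreover have "b * (bessel_J \<nu> x * bessel_J (\<nu> + 1) x) / x \<le> b * E x / x ^ 2"
    proof -
      have "bessel_J \<nu> x * bessel_J (\<nu> + 1) x * x \<le> Q x / 2 * x"
        using prod_le[of x] x0 by (intro mult_right_mono) auto
      also have "\<dots> \<le> E x" using E_ge[OF x] by (simp add: mult.commute)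
      finally have "b * (bessel_J \<nu> x * bessel_J (\<nu> + 1) x * x) \<le> b * E x" using b by simp
      hence "b * (bessel_J \<nu> x * bessel_J (\<nu> + 1) x * x) / x ^ 2 \<le> b * E x / x ^ 2"
        by (intro divide_right_mono) auto
      thus ?thesis using x0 by (simp add: power2_eq_square)
    qed
    ultimately show ?thesis
      by (intro exI conjI) (auto intro!: mult_nonpos_nonneg)
  qed
  have F_le: "F x \<le> F X" if "x \<ge> X" for x
    using DERIV_nonpos_imp_nonincreasing[of X x F] that F_deriv by auto
  show ?thesis
  proof (intro exI allI impI)
    fix x assume x: "X \<le> x"
    with X have x0: "x > 0" by simp
    have "0 \<le> x * Q x" using x0 Q0 by simp
    hence E0: "E x \<ge> 0" using E_ge[OF x] by linarith
    have "x * bessel_J \<nu> x ^ 2 \<le> x * Q x" using x0 by (simp add: Q_def)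
    also have "\<dots> \<le> 2 * E x" by (rule E_ge[OF x])
    also have "\<dots> \<le> 2 * (E x * exp (b / x))"
      using E0 b x0 by (auto intro!: mult_right_mono simp: mult_le_cancel_left1)
    also have "\<dots> \<le> 2 * F X" using F_le[OF x] by (simp add: F_def)
    finally have "sqrt (x * bessel_J \<nu> x ^ 2) \<le> sqrt (2 * F X)" by simp
    thus "\<bar>bessel_J \<nu> x\<bar> \<le> sqrt (2 * F X) / sqrt x"
      using x0 by (simp add: real_sqrt_mult field_simps)
  qed
qed

definition bessel_prod_coeff :: "real \<Rightarrow> real \<Rightarrow> nat \<Rightarrow> real" where
  "bessel_prod_coeff \<mu> \<nu> m = (-1) ^ m / fact m * Gamma (1 + \<mu> + \<nu> + 2 * real m) *
     (rGamma (1 + \<mu> + real m) * rGamma (1 + \<nu> + real m) * rGamma (1 + \<mu> + \<nu> + real m))"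

text \<open>After the factors that do not depend on \<open>i\<close> are taken out, both coefficients are generalised
  binomial coefficients and the convolution is Vandermonde's identity.\<close>
lemma bessel_coeff_convolution:
  assumes "\<mu> \<ge> 0" "\<nu> \<ge> 0"
  shows "(\<Sum>i\<le>m. bessel_coeff \<mu> i * bessel_coeff \<nu> (m - i)) = bessel_prod_coeff \<mu> \<nu> m"
proof -
  have gb: "(x + real m) gchoose i = Gamma (x + real m + 1) / (fact i * Gamma (x + real (m - i) + 1))"
    if "x \<ge> 0" "i \<le> m" for x :: real and i
  proof -
    have "x + real m + 1 \<notin> \<int>\<^sub>\<le>\<^sub>0" using that by (auto elim!: nonpos_Ints_cases)
    thus ?thesis using gbinomial_Gamma[of "x + real m" i] that by (simp add: of_nat_diff algebra_simps)
  qed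
  have "(\<Sum>i\<le>m. bessel_coeff \<mu> i * bessel_coeff \<nu> (m - i)) =
     (\<Sum>i\<le>m. (-1) ^ m * rGamma (\<mu> + real m + 1) * rGamma (\<nu> + real m + 1) *
        (((\<nu> + real m) gchoose i) * ((\<mu> + real m) gchoose (m - i))))"
  proof (rule sum.cong, goal_cases)
    case (2 i)
    hence i: "i \<le> m" by simp
    have "Gamma (\<mu> + real m + 1) > 0" "Gamma (\<nu> + real m + 1) > 0"
      "Gamma (\<mu> + real i + 1) > 0" "Gamma (\<nu> + real (m - i) + 1) > 0"
      using assms by (auto intro!: Gamma_real_pos)
    moreover have "(-1::real) ^ i * (-1) ^ (m - i) = (-1) ^ m"
      using i by (simp flip: power_add)
    moreover have "m - (m - i) = i" using i by simp
    ultimately show ?case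
      unfolding gb[OF assms(2) i] gb[OF assms(1) diff_le_self] bessel_coeff_def exp_minus_coeff_def
        rGamma_inverse_Gamma
      by (simp add: field_simps del: of_nat_diff)
  qed simp
  also have "\<dots> = (-1) ^ m * rGamma (\<mu> + real m + 1) * rGamma (\<nu> + real m + 1) *
     (((\<nu> + real m) + (\<mu> + real m)) gchoose m)"
    unfolding gbinomial_Vandermonde[symmetric] sum_distrib_left atLeast0AtMost ..
  also have "((\<nu> + real m) + (\<mu> + real m)) gchoose m = ((\<mu> + \<nu> + real m) + real m) gchoose m"
    by (simp add: add_ac)
  also have "\<dots> = Gamma (\<mu> + \<nu> + real m + real m + 1) / (fact m * Gamma (\<mu> + \<nu> + real m + 1))"
    using gb[of "\<mu> + \<nu> + real m" m] assms by (simp add: gb)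
  finally show ?thesis
    by (simp add: bessel_prod_coeff_def rGamma_inverse_Gamma field_simps)
qed

lemma bessel_entire_prod_sums:
  assumes "\<mu> \<ge> 0" "\<nu> \<ge> 0"
  shows "(\<lambda>m. bessel_prod_coeff \<mu> \<nu> m * z ^ m) sums (bessel_entire \<mu> z * bessel_entire \<nu> z)"
proof -
  have abs: "summable (\<lambda>k. norm (bessel_coeff x k * z ^ k))" if "x \<ge> 0" for x z
    using powser_insidea[of "bessel_coeff x" "norm z + 1" z] summable_bessel_coeff[OF that] by auto
  have "(\<lambda>m. \<Sum>i\<le>m. (bessel_coeff \<mu> i * z ^ i) * (bessel_coeff \<nu> (m - i) * z ^ (m - i)))
      sums ((\<Sum>k. bessel_coeff \<mu> k * z ^ k) * (\<Sum>k. bessel_coeff \<nu> k * z ^ k))"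
    by (rule Cauchy_product_sums) (use abs assms in auto)
  also have "(\<lambda>m. \<Sum>i\<le>m. (bessel_coeff \<mu> i * z ^ i) * (bessel_coeff \<nu> (m - i) * z ^ (m - i))) =
     (\<lambda>m. bessel_prod_coeff \<mu> \<nu> m * z ^ m)"
  proof
    fix m
    have "(\<Sum>i\<le>m. (bessel_coeff \<mu> i * z ^ i) * (bessel_coeff \<nu> (m - i) * z ^ (m - i))) =
      (\<Sum>i\<le>m. (bessel_coeff \<mu> i * bessel_coeff \<nu> (m - i)) * z ^ m)"
      by (rule sum.cong) (auto simp: mult_ac simp flip: power_add)
    thus "(\<Sum>i\<le>m. (bessel_coeff \<mu> i * z ^ i) * (bessel_coeff \<nu> (m - i) * z ^ (m - i))) =
      bessel_prod_coeff \<mu> \<nu> m * z ^ m"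
      by (simp add: bessel_coeff_convolution[OF assms, symmetric] sum_distrib_right)
  qed
  finally show ?thesis by (simp add: bessel_entire_def)
qed

section \<open>A moment measure for the product of two Bessel functions\<close>

text \<open>Moments are recorded for all real exponents \<open>p \<ge> 0\<close>: the even ones give the coefficients of the
  product of Bessel functions, and the fractional one gives the factor in \<open>Fhat1\<close>. Stating
  them as nonnegative integrals spares all integrability side conditions under products of measures.\<close>
definition moment_measure :: "real measure \<Rightarrow> (real \<Rightarrow> real) \<Rightarrow> bool" where
  "moment_measure M f \<longleftrightarrow> finite_measure M \<and> sets M = sets borel \<and> (AE x in M. 0 < x \<and> x \<le> 1) \<and>
     (\<forall>p\<ge>0. (\<integral>\<^sup>+x. ennreal (x powr p) \<partial>M) = ennreal (f p))"

lemma moment_measure_one: "moment_measure (return borel 1) (\<lambda>_. 1)"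
proof -
  interpret prob_space "return borel (1::real)" by (rule prob_space_return) simp
  show ?thesis
    unfolding moment_measure_def
    by (auto simp: AE_return nn_integral_return finite_measure_axioms)
qed

lemma moment_measure_cmult:
  assumes "moment_measure M f" "c > 0"
  shows "moment_measure (density M (\<lambda>_. ennreal c)) (\<lambda>p. c * f p)"
proof -
  have s[measurable_cong]: "sets M = sets borel" using assms by (simp add: moment_measure_def)
  interpret finite_measure M using assms by (simp add: moment_measure_def)
  have "emeasure (density M (\<lambda>_. ennreal c)) (space (density M (\<lambda>_. ennreal c))) \<noteq> \<infinity>"
    by (simp add: emeasure_density_const ennreal_mult_eq_top_iff)
  hence "finite_measure (density M (\<lambda>_. ennreal c))" by (rule finite_measureI)
  moreover have "(\<integral>\<^sup>+x. ennreal (x powr p) \<partial>density M (\<lambda>_. ennreal c)) = ennreal (c * f p)"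
    if "p \<ge> 0" for p
  proof -
    have "(\<integral>\<^sup>+x. ennreal (x powr p) \<partial>density M (\<lambda>_. ennreal c)) = ennreal c * (\<integral>\<^sup>+x. ennreal (x powr p) \<partial>M)"
      by (subst nn_integral_density) (auto simp: nn_integral_cmult)
    also have "\<dots> = ennreal c * ennreal (f p)" using assms that by (simp add: moment_measure_def)
    also have "\<dots> = ennreal (c * f p)" using assms by (simp add: ennreal_mult')
    finally show ?thesis .
  qed
  ultimately show ?thesis
    using assms by (simp add: moment_measure_def AE_density)
qed

text \<open>If \<open>X\<close> and \<open>Y\<close> are independent, the moments of \<open>X \<surd>Y\<close> are the products of the moments of \<open>X\<close> and
  the half-order moments of \<open>Y\<close>; for a Beta variable \<open>Y\<close> the latter are Beta integrals. As \<open>Y < 1\<close>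
  almost surely, the new measure does not charge the point 1.\<close>
lemma moment_measure_Beta_convolution:
  assumes M: "moment_measure M f" and ab: "a > 0" "b > 0"
  shows "\<exists>N. moment_measure N (\<lambda>p. f p * Beta (a + p / 2) b) \<and> (AE x in N. x < 1)"
proof -
  define w where "w = (\<lambda>t::real. indicator {0<..<1} t * (t powr (a - 1) * (1 - t) powr (b - 1)))"
  have [measurable]: "w \<in> borel_measurable borel" unfolding w_def by measurable
  have w0: "w t \<ge> 0" for t by (simp add: w_def)
  define D where "D = density lborel (\<lambda>t. ennreal (w t))"
  have sM[measurable_cong]: "sets M = sets borel" using M by (simp add: moment_measure_def)
  have sD[measurable_cong]: "sets D = sets borel" by (simp add: D_def)
  have spM: "space M = UNIV" using sets_eq_imp_space_eq[OF sM] by simp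
  have spD: "space D = UNIV" by (simp add: D_def)
  interpret M: finite_measure M using M by (simp add: moment_measure_def)
  have beta: "(\<integral>\<^sup>+t. ennreal (t powr q) \<partial>D) = ennreal (Beta (a + q) b)" if "q \<ge> 0" for q
  proof -
    have "((\<lambda>t. t powr (a + q - 1) * (1 - t) powr (b - 1)) has_integral Beta (a + q) b) {0<..<1}"
      using has_integral_Beta_real[of "a + q" b] ab that by (simp add: has_integral_Icc_iff_Ioo)
    hence "(\<integral>\<^sup>+t. ennreal (t powr (a + q - 1) * (1 - t) powr (b - 1)) * indicator {0<..<1} t \<partial>lborel) =
         ennreal (Beta (a + q) b)"
      by (intro nn_integral_has_integral_lebesgue') auto
    also have "(\<lambda>t. ennreal (t powr (a + q - 1) * (1 - t) powr (b - 1)) * indicator {0<..<1} t) =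
         (\<lambda>t. ennreal (w t) * ennreal (t powr q))"
    proof
      fix t :: real
      show "ennreal (t powr (a + q - 1) * (1 - t) powr (b - 1)) * indicator {0<..<1} t = ennreal (w t) * ennreal (t powr q)"
      proof (cases "t \<in> {0<..<1}")
        case True
        have "t powr (a + q - 1) = t powr (a - 1) * t powr q"
          by (simp add: algebra_simps flip: powr_add)
        with True show ?thesis by (simp add: w_def mult_ac flip: ennreal_mult')
      qed (auto simp: w_def)
    qed
    finally show ?thesis
      unfolding D_def by (subst nn_integral_density) auto
  qed
  have AE_D: "AE t in D. 0 < t \<and> t < 1"
    unfolding D_def by (subst AE_density) (auto simp: w_def indicator_def)
  interpret D: finite_measure D
  proof
    have "emeasure D (space D) = (\<integral>\<^sup>+t. 1 \<partial>D)" by simp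
    also have "\<dots> = (\<integral>\<^sup>+t. ennreal (t powr 0) \<partial>D)"
      using AE_D by (intro nn_integral_cong_AE) (auto elim!: eventually_mono)
    also have "\<dots> = ennreal (Beta a b)" using beta[of 0] by simp
    finally show "emeasure D (space D) \<noteq> \<infinity>" by simp
  qed
  interpret P: pair_sigma_finite M D ..
  interpret PF: finite_measure "M \<Otimes>\<^sub>M D" by (rule finite_measure_pair_measure) unfold_locales
  define N where "N = distr (M \<Otimes>\<^sub>M D) borel (\<lambda>(x, t). x * sqrt t)"
  have [measurable]: "(\<lambda>(x, t). x * sqrt t) \<in> borel_measurable (M \<Otimes>\<^sub>M D)" by measurable
  have "finite_measure N" unfolding N_def by (rule PF.finite_measure_distr) measurable
  moreover have AE_N: "AE y in N. 0 < y \<and> y < 1"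
  proof -
    have "AE z in M \<Otimes>\<^sub>M D. (0 < fst z \<and> fst z \<le> 1) \<and> (0 < snd z \<and> snd z < 1)"
    proof (rule P.AE_pair_measure)
      show "{x \<in> space (M \<Otimes>\<^sub>M D). (0 < fst x \<and> fst x \<le> 1) \<and> 0 < snd x \<and> snd x < 1} \<in> sets (M \<Otimes>\<^sub>M D)"
        by measurable
      have "AE x in M. 0 < x \<and> x \<le> 1" using M by (simp add: moment_measure_def)
      thus "AE x in M. AE y in D. (0 < fst (x, y) \<and> fst (x, y) \<le> 1) \<and> 0 < snd (x, y) \<and> snd (x, y) < 1"
      proof eventually_elim
        case (elim x)
        show ?case using AE_D by eventually_elim (use elim in auto)
      qed
    qed
    hence "AE z in M \<Otimes>\<^sub>M D. 0 < (case z of (x, t) \<Rightarrow> x * sqrt t) \<and> (case z of (x, t) \<Rightarrow> x * sqrt t) < 1"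
    proof eventually_elim
      case (elim z)
      obtain x t where z: "z = (x, t)" by (cases z)
      have "x * sqrt t \<le> 1 * sqrt t" using elim z by (intro mult_right_mono) auto
      also have "\<dots> < 1" using elim z by simp
      finally show ?case using elim z by simp
    qed
    thus ?thesis unfolding N_def by (subst AE_distr_iff) auto
  qed
  moreover have "(\<integral>\<^sup>+y. ennreal (y powr p) \<partial>N) = ennreal (f p * Beta (a + p / 2) b)" if p: "p \<ge> 0" for p
  proof -
    have "(\<integral>\<^sup>+y. ennreal (y powr p) \<partial>N) = (\<integral>\<^sup>+z. ennreal ((case z of (x, t) \<Rightarrow> x * sqrt t) powr p) \<partial>(M \<Otimes>\<^sub>M D))"
      unfolding N_def by (subst nn_integral_distr) auto
    also have "\<dots> = (\<integral>\<^sup>+x. \<integral>\<^sup>+t. ennreal ((x * sqrt t) powr p) \<partial>D \<partial>M)"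
      by (subst D.nn_integral_fst[symmetric]) auto
    also have "\<dots> = (\<integral>\<^sup>+x. ennreal (x powr p) * ennreal (Beta (a + p / 2) b) \<partial>M)"
    proof (rule nn_integral_cong)
      fix x :: real
      have "(\<integral>\<^sup>+t. ennreal ((x * sqrt t) powr p) \<partial>D) = (\<integral>\<^sup>+t. ennreal (x powr p) * ennreal (t powr (p / 2)) \<partial>D)"
      proof (rule nn_integral_cong_AE)
        from AE_D show "AE t in D. ennreal ((x * sqrt t) powr p) = ennreal (x powr p) * ennreal (t powr (p / 2))"
        proof eventually_elim
          case (elim t)
          hence "(x * sqrt t) powr p = x powr p * t powr (p / 2)"
            by (simp add: powr_mult powr_half_sqrt[symmetric] powr_powr)
          thus ?case by (simp add: ennreal_mult')
        qed
      qed
      also have "\<dots> = ennreal (x powr p) * ennreal (Beta (a + p / 2) b)"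
        by (subst nn_integral_cmult) (use p in \<open>auto simp: beta\<close>)
      finally show "(\<integral>\<^sup>+t. ennreal ((x * sqrt t) powr p) \<partial>D) = ennreal (x powr p) * ennreal (Beta (a + p / 2) b)" .
    qed
    also have "\<dots> = ennreal (f p) * ennreal (Beta (a + p / 2) b)"
      using M p by (subst nn_integral_multc) (auto simp: moment_measure_def)
    also have "\<dots> = ennreal (f p * Beta (a + p / 2) b)"
    proof (rule ennreal_mult''[symmetric])
      show "0 \<le> Beta (a + p / 2) b"
        using ab p by (intro less_imp_le) (simp add: Beta_def Gamma_real_pos)
    qed
    finally show ?thesis .
  qed
  moreover have "sets N = sets borel" by (simp add: N_def)
  moreover have "AE y in N. 0 < y \<and> y \<le> 1" using AE_N by eventually_elim auto
  ultimately have "moment_measure N (\<lambda>p. f p * Beta (a + p / 2) b)" "AE x in N. x < 1"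
    by (auto simp: moment_measure_def)
  thus ?thesis by blast
qed

text \<open>For \<open>p = 2 m\<close> this is \<open>\<bar>bessel_prod_coeff \<mu> \<nu> m\<bar>\<close> multiplied by \<open>(2 m)! / 16\<^sup>m\<close>, written so that it
  makes sense for real \<open>p\<close>.\<close>
definition bessel_moment :: "real \<Rightarrow> real \<Rightarrow> real \<Rightarrow> real" where
  "bessel_moment \<mu> \<nu> p = Gamma (1 + p) * Gamma (1 + \<mu> + \<nu> + p) / 4 powr p *
     (rGamma (1 + p / 2) * rGamma (1 + \<mu> + p / 2) * rGamma (1 + \<nu> + p / 2) * rGamma (1 + \<mu> + \<nu> + p / 2))"

text \<open>The duplication formula applied to both Gamma values in the numerator exhibits \<open>bessel_moment\<close> as a
  quotient of three Gamma values by three others in the variable \<open>p / 2\<close>.\<close>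
lemma bessel_moment_Gamma:
  assumes "\<mu> \<ge> 0" "\<nu> \<ge> 0" "p \<ge> 0"
  shows "bessel_moment \<mu> \<nu> p = 2 powr (\<mu> + \<nu>) / pi *
     (Gamma ((1 + p) / 2) * Gamma ((1 + \<mu> + \<nu> + p) / 2) * Gamma (1 + (\<mu> + \<nu> + p) / 2)) *
     (rGamma (1 + \<mu> + p / 2) * rGamma (1 + \<nu> + p / 2) * rGamma (1 + \<mu> + \<nu> + p / 2))"
proof -
  have "Gamma (1 + p) = 2 powr p / sqrt pi * (Gamma ((1 + p) / 2) * Gamma (1 + p / 2))"
  proof -
    have "(1 + p + 1) / 2 = 1 + p / 2" by simp
    thus ?thesis using Gamma_duplication_real[of "1 + p"] assms by (metis add_diff_cancel_left' add_pos_nonneg zero_less_one)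
  qed
  moreover have "Gamma (1 + \<mu> + \<nu> + p) = 2 powr (\<mu> + \<nu> + p) / sqrt pi *
      (Gamma ((1 + \<mu> + \<nu> + p) / 2) * Gamma (1 + (\<mu> + \<nu> + p) / 2))"
  proof -
    have "(1 + \<mu> + \<nu> + p + 1) / 2 = 1 + (\<mu> + \<nu> + p) / 2" "1 + \<mu> + \<nu> + p - 1 = \<mu> + \<nu> + p" by simp_all
    thus ?thesis using Gamma_duplication_real[of "1 + \<mu> + \<nu> + p"] assms
      by (metis add_nonneg_nonneg add_pos_nonneg zero_less_one)
  qed
  moreover have "4 powr p = 2 powr p * 2 powr p" 
    using powr_mult[of 2 2 p] by simp
  moreover have "2 powr (\<mu> + \<nu> + p) = 2 powr (\<mu> + \<nu>) * 2 powr p" by (simp add: powr_add)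
  moreover have "Gamma (1 + p / 2) * rGamma (1 + p / 2) = 1"
  proof -
    have "Gamma (1 + p / 2) > 0" using assms by (intro Gamma_real_pos) simp
    hence "Gamma (1 + p / 2) \<noteq> 0" by (rule less_imp_neq[symmetric])
    thus ?thesis by (simp add: rGamma_inverse_Gamma)
  qed
  moreover have "(u / q * (A * B)) * ((v * u) / q * (C * D)) / (u * u) * (R * R1 * R2 * R3) =
      v / (q * q) * (A * C * D) * (R1 * R2 * R3)"
    if "u \<noteq> 0" "B * R = 1" for u q A B v C D R R1 R2 R3 :: real
  proof -
    have "(u / q * (A * B)) * ((v * u) / q * (C * D)) / (u * u) * (R * R1 * R2 * R3) =
      (B * R) * (v / (q * q) * (A * C * D) * (R1 * R2 * R3))" using that(1) by simp
    thus ?thesis using that(2) by simp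
  qed
  from this[of "2 powr p" "Gamma (1 + p / 2)" "rGamma (1 + p / 2)" "sqrt pi"]
  have "(2 powr p / sqrt pi * (A * Gamma (1 + p / 2))) * ((v * 2 powr p) / sqrt pi * (C * D)) /
        (2 powr p * 2 powr p) * (rGamma (1 + p / 2) * R1 * R2 * R3) =
      v / pi * (A * C * D) * (R1 * R2 * R3)"
    if "Gamma (1 + p / 2) * rGamma (1 + p / 2) = 1" for A v C D R1 R2 R3 :: real
    using that by simp
  ultimately show ?thesis
    unfolding bessel_moment_def by simp
qed

lemma bessel_moment_pos: "\<mu> \<ge> 0 \<Longrightarrow> \<nu> \<ge> 0 \<Longrightarrow> p \<ge> 0 \<Longrightarrow> bessel_moment \<mu> \<nu> p > 0"
  unfolding bessel_moment_def by (auto intro!: mult_pos_pos divide_pos_pos Gamma_real_pos rGamma_real_pos add_pos_nonneg)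

lemma bessel_moment_commute: "bessel_moment \<mu> \<nu> p = bessel_moment \<nu> \<mu> p"
  by (simp add: bessel_moment_def mult_ac add_ac)

text \<open>The three Gamma values in the numerator are matched with those in the denominator so that in every
  pair the argument does not decrease: \<open>(1 + p) / 2\<close> with \<open>1 + \<nu> + p / 2\<close>, \<open>(1 + s + p) / 2\<close> with \<open>1 + \<mu> + p / 2\<close>, and
  \<open>1 + (s + p) / 2\<close> with \<open>1 + s + p / 2\<close>. The second pair is the one that wants \<open>\<mu> \<ge> \<nu>\<close>. A
  pair with growing argument is a Beta integral.\<close>
lemma bessel_moment_measure_aux:
  assumes "\<mu> \<ge> \<nu>" "\<nu> \<ge> 0"
  shows "\<exists>M. moment_measure M (bessel_moment \<mu> \<nu>) \<and> (AE x in M. x < 1)"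
proof -
  define s where "s = \<mu> + \<nu>"
  have s: "s \<ge> 0" using assms by (simp add: s_def)
  have Gpos: "Gamma x > 0" if "x > 0" for x :: real using that by (rule Gamma_real_pos)
  from moment_measure_Beta_convolution[OF moment_measure_one, of "1/2" "\<nu> + 1/2"] assms
  obtain M1 where M1: "moment_measure M1 (\<lambda>p. 1 * Beta (1/2 + p / 2) (\<nu> + 1/2))" "AE x in M1. x < 1"
    by auto
  from moment_measure_Beta_convolution[OF M1(1), of "(1 + s) / 2" "(\<mu> - \<nu> + 1) / 2"] assms s
  obtain M2 where M2: "moment_measure M2 (\<lambda>p. 1 * Beta (1/2 + p / 2) (\<nu> + 1/2) *
       Beta ((1 + s) / 2 + p / 2) ((\<mu> - \<nu> + 1) / 2))" "AE x in M2. x < 1"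
    by auto
  have B1: "Beta (1/2 + p / 2) (\<nu> + 1/2) = Gamma ((1 + p) / 2) * Gamma (\<nu> + 1/2) * rGamma (1 + \<nu> + p / 2)" for p
    by (simp add: Beta_altdef add_divide_distrib add_ac)
  have B2: "Beta ((1 + s) / 2 + p / 2) ((\<mu> - \<nu> + 1) / 2) =
      Gamma ((1 + \<mu> + \<nu> + p) / 2) * Gamma ((\<mu> - \<nu> + 1) / 2) * rGamma (1 + \<mu> + p / 2)" for p
  proof -
    have "(1 + s) / 2 + p / 2 + (\<mu> - \<nu> + 1) / 2 = 1 + \<mu> + p / 2" by (simp add: s_def field_simps)
    moreover have "(1 + s) / 2 + p / 2 = (1 + \<mu> + \<nu> + p) / 2" by (simp add: s_def field_simps)
    ultimately show ?thesis by (simp only: Beta_altdef)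
  qed
  \<comment> \<open>The third factor degenerates to the constant 1 when \<open>\<mu> = \<nu> = 0\<close>.\<close>
  have "\<exists>M c. c > 0 \<and> moment_measure M (\<lambda>p. Beta (1/2 + p / 2) (\<nu> + 1/2) *
       Beta ((1 + s) / 2 + p / 2) ((\<mu> - \<nu> + 1) / 2) * (c * Gamma (1 + (s + p) / 2) * rGamma (1 + s + p / 2)))
       \<and> (AE x in M. x < 1)"
  proof (cases "s = 0")
    case False
    with s have "s > 0" by simp
    from moment_measure_Beta_convolution[OF M2(1), of "1 + s / 2" "s / 2"] this
    obtain M3 where M3: "moment_measure M3 (\<lambda>p. 1 * Beta (1/2 + p / 2) (\<nu> + 1/2) *
       Beta ((1 + s) / 2 + p / 2) ((\<mu> - \<nu> + 1) / 2) * Beta (1 + s / 2 + p / 2) (s / 2))"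
       "AE x in M3. x < 1"
      by auto
    have "Beta (1 + s / 2 + p / 2) (s / 2) = Gamma (s / 2) * Gamma (1 + (s + p) / 2) * rGamma (1 + s + p / 2)" for p
      by (simp add: Beta_altdef add_divide_distrib add_ac)
    with M3 \<open>s > 0\<close> show ?thesis
      by (intro exI[of _ M3] exI[of _ "Gamma (s / 2)"]) (auto simp: Gamma_real_pos)
  next
    case True
    have "Gamma (1 + (s + p) / 2) * rGamma (1 + s + p / 2) = 1" if "p \<ge> 0" for p
    proof -
      have "Gamma (1 + p / 2) > 0" using that by (intro Gpos) simp
      hence "Gamma (1 + p / 2) \<noteq> 0" by (rule less_imp_neq[symmetric])
      thus ?thesis using True by (simp add: rGamma_inverse_Gamma)
    qed
    with M2 show ?thesis
      by (intro exI[of _ M2] exI[of _ 1]) (auto simp: moment_measure_def)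
  qed
  then obtain M3 c where M3: "c > 0" "moment_measure M3 (\<lambda>p. Beta (1/2 + p / 2) (\<nu> + 1/2) *
       Beta ((1 + s) / 2 + p / 2) ((\<mu> - \<nu> + 1) / 2) * (c * Gamma (1 + (s + p) / 2) * rGamma (1 + s + p / 2)))"
     "AE x in M3. x < 1" by blast
  \<comment> \<open>The constant that the three Beta integrals carry relative to \<open>bessel_moment_Gamma\<close>.\<close>
  define \<kappa> where "\<kappa> = 2 powr s / pi / (Gamma (\<nu> + 1/2) * Gamma ((\<mu> - \<nu> + 1) / 2) * c)"
  have G: "Gamma (\<nu> + 1/2) > 0" "Gamma ((\<mu> - \<nu> + 1) / 2) > 0" using assms by (auto intro!: Gpos)
  have \<kappa>: "\<kappa> > 0" unfolding \<kappa>_def using G M3(1) by simp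
  have "moment_measure (density M3 (\<lambda>_. ennreal \<kappa>)) (bessel_moment \<mu> \<nu>)"
  proof -
    have "\<kappa> * (Beta (1/2 + p / 2) (\<nu> + 1/2) *
       Beta ((1 + s) / 2 + p / 2) ((\<mu> - \<nu> + 1) / 2) * (c * Gamma (1 + (s + p) / 2) * rGamma (1 + s + p / 2))) =
       bessel_moment \<mu> \<nu> p" if "p \<ge> 0" for p
    proof -
      define g where "g = Gamma (\<nu> + 1/2)"
      define h where "h = Gamma ((\<mu> - \<nu> + 1) / 2)"
      have "g \<noteq> 0" "h \<noteq> 0" "c \<noteq> 0" using G M3(1) by (auto simp: g_def h_def)
      moreover have "bessel_moment \<mu> \<nu> p = 2 powr s / pi *
         (Gamma ((1 + p) / 2) * Gamma ((1 + \<mu> + \<nu> + p) / 2) * Gamma (1 + (s + p) / 2)) *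
         (rGamma (1 + \<mu> + p / 2) * rGamma (1 + \<nu> + p / 2) * rGamma (1 + s + p / 2))"
        using bessel_moment_Gamma[of \<mu> \<nu> p] assms that by (simp add: s_def add_ac)
      ultimately show ?thesis
        unfolding B1 B2 \<kappa>_def g_def[symmetric] h_def[symmetric] by simp
    qed
    with moment_measure_cmult[OF M3(2) \<kappa>] show ?thesis by (auto simp: moment_measure_def)
  qed
  moreover have "AE x in density M3 (\<lambda>_. ennreal \<kappa>). x < 1"
    using M3(3) by (subst AE_density) auto
  ultimately show ?thesis by blast
qed

lemma bessel_moment_measure:
  assumes "\<mu> \<ge> 0" "\<nu> \<ge> 0"
  obtains M where "moment_measure M (bessel_moment \<mu> \<nu>)" "AE x in M. x < 1"
proof (cases "\<mu> \<ge> \<nu>")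
  case True
  thus ?thesis using bessel_moment_measure_aux[of \<nu> \<mu>] assms that by blast
next
  case False
  thus ?thesis using bessel_moment_measure_aux[of \<mu> \<nu>] assms that
    by (metis bessel_moment_commute ext le_cases)
qed

lemma
  assumes "moment_measure M f" "p \<ge> 0"
  shows moment_measure_integrable: "integrable M (\<lambda>x. x powr p)"
    and moment_measure_integral: "f p \<ge> 0 \<Longrightarrow> (\<integral>x. x powr p \<partial>M) = f p"
proof -
  have [measurable_cong]: "sets M = sets borel" using assms by (simp add: moment_measure_def)
  have *: "(\<integral>\<^sup>+x. ennreal (x powr p) \<partial>M) = ennreal (f p)" using assms by (simp add: moment_measure_def)
  show "integrable M (\<lambda>x. x powr p)"
    by (rule integrableI_nonneg) (use * in auto)
  show "(\<integral>x. x powr p \<partial>M) = f p" if "f p \<ge> 0"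
    using * that by (subst integral_eq_nn_integral) auto
qed

section \<open>Partial fractions of the Poisson kernel\<close>

text \<open>The logarithmic derivative of the reflection formula expresses the cotangent as a difference of two
  Digamma values, and these are limits of harmonic-type sums.\<close>
lemma cot_partial_fractions:
  assumes "z \<notin> (\<int> :: complex set)"
  shows "(\<lambda>m. \<Sum>n<m. inverse (z + of_nat n) - inverse (1 - z + of_nat n))
           \<longlonglongrightarrow> of_real pi * cot (of_real pi * z)"
proof -
  have nz: "z \<notin> \<int>\<^sub>\<le>\<^sub>0" "1 - z \<notin> \<int>\<^sub>\<le>\<^sub>0"
  proof -
    show "z \<notin> \<int>\<^sub>\<le>\<^sub>0" using assms nonpos_Ints_Int by blast
    show "1 - z \<notin> \<int>\<^sub>\<le>\<^sub>0"
    proof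
      assume "1 - z \<in> \<int>\<^sub>\<le>\<^sub>0"
      hence "1 - (1 - z) \<in> \<int>" by (intro Ints_diff Ints_1 nonpos_Ints_Int)
      thus False using assms by simp
    qed
  qed
  have "z \<noteq> 0" "1 - z \<noteq> 0" using assms by auto
  from tendsto_diff[OF Digamma_LIMSEQ[OF this(2)] Digamma_LIMSEQ[OF this(1)]]
  have "(\<lambda>m. \<Sum>n<m. inverse (z + of_nat n) - inverse (1 - z + of_nat n)) \<longlonglongrightarrow> Digamma (1 - z) - Digamma z"
    by (simp add: sum_subtractf)
  also have "Digamma (1 - z) - Digamma z = of_real pi * cot (of_real pi * z)"
  proof -
    have "((\<lambda>z. rGamma z * rGamma (1 - z)) has_field_derivative
        (rGamma z * rGamma (1 - z) * (Digamma (1 - z) - Digamma z))) (at z)"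
      using nz by (auto intro!: derivative_eq_intros simp: algebra_simps)
    moreover have "((\<lambda>z. sin (of_real pi * z) / of_real pi) has_field_derivative cos (of_real pi * z)) (at z)"
      by (auto intro!: derivative_eq_intros)
    ultimately have "rGamma z * rGamma (1 - z) * (Digamma (1 - z) - Digamma z) = cos (of_real pi * z)"
      unfolding rGamma_reflection_complex by (rule DERIV_unique)
    hence *: "sin (of_real pi * z) / of_real pi * (Digamma (1 - z) - Digamma z) = cos (of_real pi * z)"
      by (simp add: rGamma_reflection_complex)
    have "rGamma z * rGamma (1 - z) \<noteq> 0" using nz by (simp add: rGamma_eq_zero_iff)
    hence "sin (of_real pi * z) \<noteq> 0" by (simp add: rGamma_reflection_complex)
    with * show ?thesis by (simp add: cot_def field_simps)
  qed
  finally show ?thesis .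
qed

text \<open>The imaginary part of the partial fractions of the cotangent at the point \<open>(x + \<i> t) / (2 \<pi>)\<close>. The
  cotangent is a geometric series in \<open>q = exp (- t + \<i> x)\<close>, which gives the right-hand side.\<close>
lemma Poisson_kernel_partial_fractions:
  assumes "t > 0"
  shows "(\<lambda>m. \<Sum>n<m. t / ((2 * pi * real n + x)\<^sup>2 + t\<^sup>2) + t / ((2 * pi * (real n + 1) - x)\<^sup>2 + t\<^sup>2))
           \<longlonglongrightarrow> 1 / 2 + (\<Sum>n. exp (- (real n + 1) * t) * cos ((real n + 1) * x))"
proof -
  define z where "z = Complex (x / (2 * pi)) (t / (2 * pi))"
  define q where "q = exp (Complex (-t) x)"
  have "norm q < 1" using assms by (simp add: q_def)
  hence q1: "q \<noteq> 1" by auto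
  have "z \<notin> \<int>" using assms by (auto elim!: Ints_cases simp: z_def complex_eq_iff)
  from tendsto_Im[OF cot_partial_fractions[OF this]]
  have lim: "(\<lambda>m. - pi * (\<Sum>n<m. Im (inverse (z + of_nat n) - inverse (1 - z + of_nat n))) / pi / (2 * pi)) \<longlonglongrightarrow>
      - pi * Im (of_real pi * cot (of_real pi * z)) / pi / (2 * pi)"
    by (intro tendsto_intros) simp_all
  have summand: "- Im (inverse (z + of_nat n) - inverse (1 - z + of_nat n)) / (2 * pi) =
      t / ((2 * pi * real n + x)\<^sup>2 + t\<^sup>2) + t / ((2 * pi * (real n + 1) - x)\<^sup>2 + t\<^sup>2)" for n
  proof -
    have *: "- Im (inverse (Complex (a / (2 * pi)) (t / (2 * pi)))) = 2 * pi * (t / (a\<^sup>2 + t\<^sup>2))" for a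
    proof -
      have "(a / (2 * pi))\<^sup>2 + (t / (2 * pi))\<^sup>2 = (a\<^sup>2 + t\<^sup>2) / (2 * pi)\<^sup>2"
        by (simp add: power_divide add_divide_distrib)
      thus ?thesis using assms by (simp add: power2_eq_square)
    qed
    have "z + of_nat n = Complex ((2 * pi * real n + x) / (2 * pi)) (t / (2 * pi))"
      by (simp add: z_def complex_eq_iff field_simps)
    moreover have "inverse (1 - z + of_nat n) =
       cnj (inverse (Complex ((2 * pi * (real n + 1) - x) / (2 * pi)) (t / (2 * pi))))"
    proof -
      have "1 - z + of_nat n = cnj (Complex ((2 * pi * (real n + 1) - x) / (2 * pi)) (t / (2 * pi)))"
        by (simp add: z_def complex_eq_iff field_simps)
      thus ?thesis by (simp only: complex_cnj_inverse)
    qed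
    ultimately have "- Im (inverse (z + of_nat n) - inverse (1 - z + of_nat n)) =
       2 * pi * (t / ((2 * pi * real n + x)\<^sup>2 + t\<^sup>2)) + 2 * pi * (t / ((2 * pi * (real n + 1) - x)\<^sup>2 + t\<^sup>2))"
      using *[of "2 * pi * real n + x"] *[of "2 * pi * (real n + 1) - x"] by simp
    also have "\<dots> = (2 * pi) * (t / ((2 * pi * real n + x)\<^sup>2 + t\<^sup>2) + t / ((2 * pi * (real n + 1) - x)\<^sup>2 + t\<^sup>2))"
      by (simp only: distrib_left)
    finally show ?thesis by (simp only: ) simp
  qed
  have cot: "cot (of_real pi * z) = - \<i> * ((1 + q) / (1 - q))"
  proof -
    define e where "e = exp (\<i> * (of_real pi * z))"
    have e0: "e \<noteq> 0" by (simp add: e_def)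
    have "e * e = exp (2 * (\<i> * (of_real pi * z)))" by (simp only: e_def mult_2 exp_add)
    also have "2 * (\<i> * (of_real pi * z)) = Complex (-t) x" by (simp add: z_def complex_eq_iff)
    finally have ee: "q = e * e" by (simp add: q_def)
    have "exp (- (\<i> * (of_real pi * z))) = inverse e" by (simp add: e_def exp_minus)
    hence "cot (of_real pi * z) = ((e + inverse e) / 2) / ((e - inverse e) / (2 * \<i>))"
      by (simp only: cot_def cos_exp_eq sin_exp_eq e_def)
    also have "\<dots> = \<i> * (e + inverse e) / (e - inverse e)"
    proof -
      have "(a / 2) / (b / (2 * \<i>)) = \<i> * a / b" for a b :: complex
        by (cases "b = 0") (simp_all add: divide_simps)
      thus ?thesis .
    qed
    also have "\<dots> = \<i> * (q + 1) / (q - 1)" using e0 q1 unfolding ee by (simp add: divide_simps)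
    also have "\<dots> = - \<i> * ((1 + q) / (1 - q))" using q1 by (simp add: divide_simps) (simp add: algebra_simps)
    finally show ?thesis .
  qed
  have "(\<lambda>n. q ^ n) sums (1 / (1 - q))" by (rule geometric_sums) fact
  hence "(\<lambda>n. q * q ^ n) sums (q * (1 / (1 - q)))" by (rule sums_mult)
  hence "(\<lambda>n. Re (q * q ^ n)) sums Re (q / (1 - q))" by (intro sums_Re) simp
  moreover have "Re (q * q ^ n) = exp (- (real n + 1) * t) * cos ((real n + 1) * x)" for n
  proof -
    have "q * q ^ n = q ^ Suc n" by simp
    also have "\<dots> = exp (of_nat (Suc n) * Complex (-t) x)" unfolding q_def by (rule exp_of_nat_mult[symmetric])
    finally show ?thesis by (simp add: exp_eq_polar Re_exp algebra_simps)
  qed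
  ultimately have geo: "(\<Sum>n. exp (- (real n + 1) * t) * cos ((real n + 1) * x)) = Re (q / (1 - q))"
    by (simp add: sums_iff)
  have "(1 + q) / (1 - q) = 1 + 2 * (q / (1 - q))" using q1 by (simp add: field_simps)
  moreover have "Re (1 + 2 * w) = 1 + 2 * Re w" for w :: complex by simp
  ultimately have "Re ((1 + q) / (1 - q)) = 1 + 2 * Re (q / (1 - q))" by metis
  hence "Im (of_real pi * cot (of_real pi * z)) = - pi * (1 + 2 * Re (q / (1 - q)))"
  proof -
    have "Im (of_real pi * (- \<i> * w)) = - pi * Re w" for w by simp
    thus ?thesis unfolding cot using \<open>Re ((1 + q) / (1 - q)) = _\<close> by metis
  qed
  hence rhs: "- pi * Im (of_real pi * cot (of_real pi * z)) / pi / (2 * pi) =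
     1 / 2 + (\<Sum>n. exp (- (real n + 1) * t) * cos ((real n + 1) * x))"
  proof -
    have "- pi * (- pi * (1 + 2 * R)) / pi / (2 * pi) = 1 / 2 + R" for R by (simp add: field_simps)
    thus ?thesis unfolding geo \<open>Im (of_real pi * cot (of_real pi * z)) = _\<close> .
  qed
  have lhs: "- pi * (\<Sum>n<m. Im (inverse (z + of_nat n) - inverse (1 - z + of_nat n))) / pi / (2 * pi) =
     (\<Sum>n<m. t / ((2 * pi * real n + x)\<^sup>2 + t\<^sup>2) + t / ((2 * pi * (real n + 1) - x)\<^sup>2 + t\<^sup>2))" for m
    unfolding summand[symmetric] by (simp only: sum_negf sum_divide_distrib [symmetric]) simp
  show ?thesis using lim unfolding lhs rhs .
qed

lemma summable_exp_cos:
  assumes "t > 0"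
  shows "summable (\<lambda>n. exp (- (real n + 1) * t) * cos ((real n + 1) * x))"
proof (rule summable_comparison_test_ev)
  have "summable (\<lambda>n. exp (-t) * exp (-t) ^ n)"
    using assms by (intro summable_mult summable_geometric) auto
  moreover have "exp (-t) * exp (-t) ^ n = exp (- (real n + 1) * t)" for n
    by (simp add: exp_of_nat_mult[symmetric] algebra_simps flip: exp_add)
  ultimately show "summable (\<lambda>n. exp (- (real n + 1) * t))" by simp
  show "\<forall>\<^sub>F n in sequentially. norm (exp (- (real n + 1) * t) * cos ((real n + 1) * x)) \<le> exp (- (real n + 1) * t)"
    by (intro always_eventually allI) (auto simp: abs_mult intro!: mult_right_le_one_le)
qed

text \<open>Up to the factor \<open>\<pi>\<close>, the Poisson kernel of the upper half-plane at height \<open>t\<close>.\<close>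
definition poisson_kernel :: "real \<Rightarrow> real \<Rightarrow> real" where
  "poisson_kernel y t = t / (y\<^sup>2 + t\<^sup>2)"

text \<open>The difference between the partial fractions at \<open>0\<close> and at \<open>x\<close>. Grouping the four terms that belong to
  one period \<open>[2 \<pi> n, 2 \<pi> (n + 1)]\<close> makes this almost a second difference of the kernel, which is what
  makes the series over \<open>n\<close> converge fast enough.\<close>
definition poisson_diff :: "real \<Rightarrow> nat \<Rightarrow> real \<Rightarrow> real" where
  "poisson_diff x n t = poisson_kernel (2 * pi * real n) t + poisson_kernel (2 * pi * (real n + 1)) t
     - poisson_kernel (2 * pi * real n + x) t - poisson_kernel (2 * pi * (real n + 1) - x) t"

definition damped_cosine_gap :: "real \<Rightarrow> real \<Rightarrow> real" where
  "damped_cosine_gap x t = (\<Sum>n. exp (- (real n + 1) * t) * (1 - cos ((real n + 1) * x)))"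

lemma poisson_diff_sums:
  assumes "t > 0"
  shows "(\<lambda>n. poisson_diff x n t) sums damped_cosine_gap x t"
proof -
  from tendsto_diff[OF Poisson_kernel_partial_fractions[OF assms, of 0] Poisson_kernel_partial_fractions[OF assms, of x]]
  have "(\<lambda>m. \<Sum>n<m. poisson_diff x n t) \<longlonglongrightarrow>
     (\<Sum>n. exp (- (real n + 1) * t) * cos ((real n + 1) * 0)) - (\<Sum>n. exp (- (real n + 1) * t) * cos ((real n + 1) * x))"
    by (simp add: poisson_diff_def poisson_kernel_def sum_subtractf[symmetric] algebra_simps)
  also have "(\<Sum>n. exp (- (real n + 1) * t) * cos ((real n + 1) * 0)) - (\<Sum>n. exp (- (real n + 1) * t) * cos ((real n + 1) * x)) =
    damped_cosine_gap x t"
    unfolding damped_cosine_gap_def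
    by (subst suminf_diff[OF summable_exp_cos summable_exp_cos]) (use assms in \<open>auto simp: algebra_simps\<close>)
  finally show ?thesis by (simp add: sums_def)
qed

text \<open>The mean value theorem, applied twice, bounds the group by \<open>(2 \<pi>)\<^sup>2\<close> times the largest second
  derivative of the kernel in its first argument to the right of \<open>2 \<pi> n\<close>.\<close>
lemma poisson_diff_bound:
  assumes x: "0 \<le> x" "x \<le> 2 * pi" and t: "t > 0" and n: "n \<ge> 1"
  shows "\<bar>poisson_diff x n t\<bar> \<le> 24 * pi\<^sup>2 * (t / ((2 * pi * real n)\<^sup>2 + t\<^sup>2)\<^sup>2)"
proof -
  define c where "c = 2 * pi * real n"
  have c: "c > 0" using n by (simp add: c_def)
  define f1 where "f1 = (\<lambda>y. - 2 * y * t / (y\<^sup>2 + t\<^sup>2)\<^sup>2)"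
  define f2 where "f2 = (\<lambda>y. (6 * y\<^sup>2 - 2 * t\<^sup>2) * t / (y\<^sup>2 + t\<^sup>2) ^ 3)"
  have pos: "y\<^sup>2 + t\<^sup>2 > 0" for y using t by (simp add: add_nonneg_pos)
  have d1: "((\<lambda>y. poisson_kernel y t) has_real_derivative f1 y) (at y)" for y
    unfolding poisson_kernel_def f1_def using pos[of y]
    by (auto intro!: derivative_eq_intros simp: power2_eq_square)
  have d2: "(f1 has_real_derivative f2 y) (at y)" for y
  proof -
    have "(f1 has_real_derivative ((- 2 * t) * (y\<^sup>2 + t\<^sup>2)\<^sup>2 - (- 2 * y * t) * (2 * (y\<^sup>2 + t\<^sup>2) * (2 * y))) / ((y\<^sup>2 + t\<^sup>2)\<^sup>2 * (y\<^sup>2 + t\<^sup>2)\<^sup>2)) (at y)"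
      unfolding f1_def using pos[of y]
      by (auto intro!: derivative_eq_intros)
         (simp add: minus_divide_left power2_eq_square algebra_simps)
    also have "((- 2 * t) * (y\<^sup>2 + t\<^sup>2)\<^sup>2 - (- 2 * y * t) * (2 * (y\<^sup>2 + t\<^sup>2) * (2 * y))) =
        ((6 * y\<^sup>2 - 2 * t\<^sup>2) * t) * (y\<^sup>2 + t\<^sup>2)" by (simp add: power2_eq_square algebra_simps)
    also have "((6 * y\<^sup>2 - 2 * t\<^sup>2) * t) * (y\<^sup>2 + t\<^sup>2) / ((y\<^sup>2 + t\<^sup>2)\<^sup>2 * (y\<^sup>2 + t\<^sup>2)\<^sup>2) = f2 y"
      unfolding f2_def using pos[of y] by (simp add: power2_eq_square power3_eq_cube)
    finally show ?thesis .
  qed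
  have f2_bound: "\<bar>f2 y\<bar> \<le> 6 * t / (c\<^sup>2 + t\<^sup>2)\<^sup>2" if "y \<ge> c" for y
  proof -
    have "\<bar>f2 y\<bar> = \<bar>6 * y\<^sup>2 - 2 * t\<^sup>2\<bar> * t / (y\<^sup>2 + t\<^sup>2) ^ 3"
      using t pos[of y] by (simp add: f2_def abs_mult)
    also have "\<dots> \<le> (6 * (y\<^sup>2 + t\<^sup>2)) * t / (y\<^sup>2 + t\<^sup>2) ^ 3"
      using t pos[of y] by (intro divide_right_mono mult_right_mono) (auto simp: abs_le_iff)
    also have "\<dots> = 6 * t / (y\<^sup>2 + t\<^sup>2)\<^sup>2"
    proof -
      have "6 * Y * t / Y ^ 3 = 6 * t / Y\<^sup>2" if "Y > 0" for Y :: real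
        using that by (simp add: power2_eq_square power3_eq_cube)
      thus ?thesis using pos[of y] .
    qed
    also have "\<dots> \<le> 6 * t / (c\<^sup>2 + t\<^sup>2)\<^sup>2"
      using t pos[of c] that c by (intro divide_left_mono power_mono add_right_mono mult_pos_pos) auto
    finally show ?thesis .
  qed
  define g where "g = (\<lambda>h. poisson_kernel (c + 2 * pi - x + h) t - poisson_kernel (c + h) t)"
  have gd: "(g has_real_derivative f1 (c + 2 * pi - x + h) - f1 (c + h)) (at h)" for h
    unfolding g_def by (auto intro!: derivative_eq_intros DERIV_chain2[OF d1])
  have g': "\<bar>f1 (c + 2 * pi - x + h) - f1 (c + h)\<bar> \<le> 2 * pi * (6 * t / (c\<^sup>2 + t\<^sup>2)\<^sup>2)" if "h \<ge> 0" for h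
  proof -
    have "norm (f1 (c + 2 * pi - x + h) - f1 (c + h)) \<le> 6 * t / (c\<^sup>2 + t\<^sup>2)\<^sup>2 * norm ((c + 2 * pi - x + h) - (c + h))"
    proof (rule field_differentiable_bound[of "{c..}"])
      show "(f1 has_field_derivative f2 z) (at z within {c..})" for z
        using d2 by (rule DERIV_subset) auto
    qed (use f2_bound that x in auto)
    also have "\<dots> \<le> 6 * t / (c\<^sup>2 + t\<^sup>2)\<^sup>2 * (2 * pi)"
      using x t pos[of c] by (intro mult_left_mono) auto
    finally show ?thesis by (simp add: mult_ac)
  qed
  have "norm (g x - g 0) \<le> 2 * pi * (6 * t / (c\<^sup>2 + t\<^sup>2)\<^sup>2) * norm (x - 0)"
  proof (rule field_differentiable_bound[of "{0..}"])
    show "(g has_field_derivative f1 (c + 2 * pi - x + z) - f1 (c + z)) (at z within {0..})" for z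
      using gd by (rule DERIV_subset) auto
  qed (use g' x in auto)
  also have "\<dots> \<le> 2 * pi * (6 * t / (c\<^sup>2 + t\<^sup>2)\<^sup>2) * (2 * pi)"
    using x t pos[of c] by (intro mult_left_mono) auto
  also have "\<dots> = 24 * pi\<^sup>2 * (t / (c\<^sup>2 + t\<^sup>2)\<^sup>2)" by (simp add: power2_eq_square)
  also have "g x - g 0 = poisson_diff x n t"
    by (simp add: g_def poisson_diff_def c_def algebra_simps)
  finally show ?thesis by (simp add: c_def)
qed


section \<open>Mellin transforms\<close>

text \<open>The substitution \<open>t = c \<surd>((1 - u) / u)\<close>, for which \<open>c\<^sup>2 / (c\<^sup>2 + t\<^sup>2) = u\<close>, turns the integral into
  the Beta integral with parameters \<open>1 - p / 2\<close> and \<open>p / 2\<close>.\<close>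
lemma
  fixes c p :: real
  assumes c: "c > 0" and p: "0 < p" "p < 2"
  defines "f \<equiv> (\<lambda>t. t powr (p - 1) * (c\<^sup>2 / (c\<^sup>2 + t\<^sup>2)))"
  shows mellin_rational_absolutely_integrable: "f absolutely_integrable_on {0<..}"
    and mellin_rational_integral: "integral {0<..} f = c powr p * (pi / (2 * sin (pi * p / 2)))"
proof -
  define g where "g = (\<lambda>u. c * ((1 - u) / u) powr (1 / 2))"
  define g' where "g' = (\<lambda>u. - c / 2 * ((1 - u) / u) powr (- 1 / 2) / u\<^sup>2)"
  have der: "(g has_field_derivative g' u) (at u within {0<..<1})" if "u \<in> {0<..<1}" for u
  proof -
    have "(1 - u) / u > 0" using that by simp
    moreover have "((\<lambda>u. (1 - u) / u) has_real_derivative - 1 / u\<^sup>2) (at u within {0<..<1})"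
      using that by (auto intro!: derivative_eq_intros simp: power2_eq_square field_simps)
    ultimately have "((\<lambda>u. ((1 - u) / u) powr (1 / 2)) has_real_derivative
        1 / 2 * ((1 - u) / u) powr (1 / 2 - 1) * (- 1 / u\<^sup>2)) (at u within {0<..<1})"
      by (intro DERIV_chain2[OF has_real_derivative_powr])
    hence "(g has_field_derivative c * (1 / 2 * ((1 - u) / u) powr (1 / 2 - 1) * (- 1 / u\<^sup>2))) (at u within {0<..<1})"
      unfolding g_def by (rule DERIV_cmult)
    thus ?thesis unfolding g'_def by (rule DERIV_cong) simp
  qed
  have g_sq: "c\<^sup>2 + (g u)\<^sup>2 = c\<^sup>2 / u" if "u \<in> {0<..<1}" for u
    using that by (simp add: g_def power_mult_distrib powr_half_sqrt) (simp add: field_simps)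
  have inj: "inj_on g {0<..<1}"
  proof (rule inj_onI)
    fix u v assume uv: "u \<in> {0<..<1}" "v \<in> {0<..<1}" "g u = g v"
    hence "c\<^sup>2 / u = c\<^sup>2 / v" using g_sq by metis
    thus "u = v" using c uv by (simp add: field_simps)
  qed
  have img: "g ` {0<..<1} = {0<..}"
  proof (intro equalityI subsetI)
    fix t assume "t \<in> g ` {0<..<1}"
    thus "t \<in> {0<..}" using c by (auto simp: g_def)
  next
    fix t :: real assume "t \<in> {0<..}"
    hence t: "t > 0" by simp
    define u where "u = c\<^sup>2 / (c\<^sup>2 + t\<^sup>2)"
    have s: "c\<^sup>2 + t\<^sup>2 > 0" using c by (simp add: add_pos_nonneg)
    have "(1 - u) / u = (t / c)\<^sup>2" 
    proof -
      have "(1 - C / (C + T)) / (C / (C + T)) = T / C" if "C > 0" "T > 0" for C T :: real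
      proof -
        have "1 - C / (C + T) = T / (C + T)" using that by (simp add: field_simps)
        thus ?thesis using that by simp
      qed
      from this[of "c\<^sup>2" "t\<^sup>2"] show ?thesis using c t by (simp add: u_def power_divide)
    qed
    hence "g u = t" using c t by (simp add: g_def powr_half_sqrt)
    moreover have "u \<in> {0<..<1}" using s c t by (simp add: u_def)
    ultimately show "t \<in> g ` {0<..<1}" by blast
  qed
  have integrand: "\<bar>g' u\<bar> * f (g u) = c powr p / 2 * (u powr ((1 - p / 2) - 1) * (1 - u) powr (p / 2 - 1))"
    if "u \<in> {0<..<1}" for u
  proof -
    from that have u: "0 < u" "u < 1" by auto
    have "\<bar>g' u\<bar> * f (g u) = c / 2 * ((1 - u) / u) powr (- 1 / 2) / u\<^sup>2 *
        ((c * ((1 - u) / u) powr (1 / 2)) powr (p - 1) * u)"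
      using u c unfolding f_def g_sq[OF that] by (simp add: g'_def g_def abs_mult)
    also have "(c * ((1 - u) / u) powr (1 / 2)) powr (p - 1) = c powr (p - 1) * ((1 - u) / u) powr ((p - 1) / 2)"
      by (simp add: powr_mult powr_powr)
    also have "c / 2 * ((1 - u) / u) powr (- 1 / 2) / u\<^sup>2 * (c powr (p - 1) * ((1 - u) / u) powr ((p - 1) / 2) * u) =
       (c * c powr (p - 1)) / 2 * (((1 - u) / u) powr (- 1 / 2) * ((1 - u) / u) powr ((p - 1) / 2)) * (1 / u)"
      using u by (simp add: power2_eq_square)
    also have "c * c powr (p - 1) = c powr p" using c by (simp add: powr_diff)
    also have pow: "((1 - u) / u) powr (- 1 / 2) * ((1 - u) / u) powr ((p - 1) / 2) = ((1 - u) / u) powr (p / 2 - 1)"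
    proof -
      have "- 1 / 2 + (p - 1) / 2 = p / 2 - 1" by (simp add: field_simps)
      thus ?thesis by (metis powr_add)
    qed
    also have "c powr p / 2 * ((1 - u) / u) powr (p / 2 - 1) * (1 / u) =
        c powr p / 2 * ((1 - u) powr (p / 2 - 1) * (u powr - (p / 2 - 1) * u powr (- 1)))"
      unfolding powr_minus_divide[of u] using u by (simp add: powr_divide)
    also have "u powr - (p / 2 - 1) * u powr (- 1) = u powr ((1 - p / 2) - 1)"
    proof -
      have "- (p / 2 - 1) + (- 1) = (1 - p / 2) - 1" by simp
      thus ?thesis by (metis powr_add)
    qed
    finally show ?thesis by (simp add: mult_ac)
  qed
  have "((\<lambda>u. u powr ((1 - p / 2) - 1) * (1 - u) powr (p / 2 - 1)) has_integral Beta (1 - p / 2) (p / 2)) {0<..<1}"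
    using has_integral_Beta_real[of "1 - p / 2" "p / 2"] p by (simp add: has_integral_Icc_iff_Ioo)
  hence "((\<lambda>u. c powr p / 2 * (u powr ((1 - p / 2) - 1) * (1 - u) powr (p / 2 - 1))) has_integral
      c powr p / 2 * Beta (1 - p / 2) (p / 2)) {0<..<1}"
    by (rule has_integral_mult_right)
  hence I: "((\<lambda>u. \<bar>g' u\<bar> * f (g u)) has_integral c powr p / 2 * Beta (1 - p / 2) (p / 2)) {0<..<1}"
    by (rule has_integral_eq[rotated]) (simp add: integrand)
  have "(\<lambda>u. \<bar>g' u\<bar> * f (g u)) absolutely_integrable_on {0<..<1}"
    using I by (intro nonnegative_absolutely_integrable_1) (auto simp: f_def integrable_on_def)
  hence "f absolutely_integrable_on g ` {0<..<1} \<and> integral (g ` {0<..<1}) f = c powr p / 2 * Beta (1 - p / 2) (p / 2)"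
    using I by (subst has_absolute_integral_change_of_variables_1'[of _ g g', symmetric])
               (use der inj in \<open>auto simp: integral_unique\<close>)
  moreover have "Beta (1 - p / 2) (p / 2) = pi / sin (pi * p / 2)"
  proof -
    have "Gamma (p / 2) * Gamma (1 - p / 2) = pi / sin (pi * (p / 2))" by (rule Gamma_reflection_real)
    thus ?thesis by (simp add: Beta_def mult.commute)
  qed
  ultimately show "f absolutely_integrable_on {0<..}" "integral {0<..} f = c powr p * (pi / (2 * sin (pi * p / 2)))"
    unfolding img by simp_all
qed


abbreviation (input) half_line :: "real measure" where "half_line \<equiv> lebesgue_on {0<..}"

definition mellin_const :: "real \<Rightarrow> real" where
  "mellin_const p = pi / (2 * sin (pi * p / 2))"

lemma mellin_rational:
  assumes c: "c > (0::real)" and p: "0 < p" "p < 2"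
  shows "integrable half_line (\<lambda>t. t powr (p - 1) * (c\<^sup>2 / (c\<^sup>2 + t\<^sup>2)))"
    and "(\<integral>t. t powr (p - 1) * (c\<^sup>2 / (c\<^sup>2 + t\<^sup>2)) \<partial>half_line) = c powr p * mellin_const p"
proof -
  show *: "integrable half_line (\<lambda>t. t powr (p - 1) * (c\<^sup>2 / (c\<^sup>2 + t\<^sup>2)))"
    using mellin_rational_absolutely_integrable[OF assms] by (intro absolutely_integrable_imp_integrable) auto
  show "(\<integral>t. t powr (p - 1) * (c\<^sup>2 / (c\<^sup>2 + t\<^sup>2)) \<partial>half_line) = c powr p * mellin_const p"
    using mellin_rational_integral[OF assms] lebesgue_integral_eq_integral[OF *] by (simp add: mellin_const_def)
qed

text \<open>Subtracting the kernel at \<open>0\<close> makes the integral converge at infinity for the exponents \<open>p > 0\<close>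
  used here; the value is a pure power of \<open>c\<close> by homogeneity.\<close>
lemma mellin_poisson:
  assumes c: "c \<ge> (0::real)" and p: "0 < p" "p < 2"
  shows "integrable half_line (\<lambda>t. t powr p * (poisson_kernel 0 t - poisson_kernel c t))"
    and "(\<integral>t. t powr p * (poisson_kernel 0 t - poisson_kernel c t) \<partial>half_line) = mellin_const p * c powr p"
proof -
  have "integrable half_line (\<lambda>t. t powr p * (poisson_kernel 0 t - poisson_kernel c t)) \<and>
        (\<integral>t. t powr p * (poisson_kernel 0 t - poisson_kernel c t) \<partial>half_line) = mellin_const p * c powr p"
  proof (cases "c = 0")
    case False
    with c have c: "c > 0" by simp
    have eq: "t powr p * (poisson_kernel 0 t - poisson_kernel c t) = t powr (p - 1) * (c\<^sup>2 / (c\<^sup>2 + t\<^sup>2))" if "t \<in> space half_line" for t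
    proof -
      have t: "t > 0" using that by simp
      have s: "c\<^sup>2 + t\<^sup>2 > 0" using c by (simp add: add_pos_nonneg)
      have "poisson_kernel 0 t - poisson_kernel c t = 1 / t * (c\<^sup>2 / (c\<^sup>2 + t\<^sup>2))"
        using t s by (simp add: poisson_kernel_def field_simps power2_eq_square)
      thus ?thesis using t by (simp add: powr_diff)
    qed
    show ?thesis
      using mellin_rational[OF c p]
      by (simp only: eq cong: Bochner_Integration.integrable_cong Bochner_Integration.integral_cong) simp
  qed (auto simp: )
  thus "integrable half_line (\<lambda>t. t powr p * (poisson_kernel 0 t - poisson_kernel c t))"
       "(\<integral>t. t powr p * (poisson_kernel 0 t - poisson_kernel c t) \<partial>half_line) = mellin_const p * c powr p" by auto
qed

text \<open>The Mellin transform of \<open>poisson_diff x n\<close>, divided by \<open>mellin_const p\<close>.\<close>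
definition power_bracket :: "real \<Rightarrow> real \<Rightarrow> nat \<Rightarrow> real" where
  "power_bracket p x n = (2 * pi * real n + x) powr p + (2 * pi * (real n + 1) - x) powr p
     - (2 * pi * real n) powr p - (2 * pi * (real n + 1)) powr p"

lemma mellin_poisson_diff:
  assumes p: "0 < p" "p < 2" and x: "0 \<le> x" "x \<le> 2 * pi"
  shows "integrable half_line (\<lambda>t. t powr p * poisson_diff x n t)"
    and "(\<integral>t. t powr p * poisson_diff x n t \<partial>half_line) = mellin_const p * power_bracket p x n"
proof -
  have "0 \<le> 2 * pi * real n" by simp
  hence nn: "0 \<le> 2 * pi * real n + x" "0 \<le> 2 * pi * (real n + 1) - x" "0 \<le> 2 * pi * real n" "0 \<le> 2 * pi * (real n + 1)"
    using x by (simp_all add: distrib_left add_increasing)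
  have eq: "(\<lambda>t. t powr p * poisson_diff x n t) = (\<lambda>t.
     t powr p * (poisson_kernel 0 t - poisson_kernel (2 * pi * real n + x) t) + t powr p * (poisson_kernel 0 t - poisson_kernel (2 * pi * (real n + 1) - x) t)
     - t powr p * (poisson_kernel 0 t - poisson_kernel (2 * pi * real n) t) - t powr p * (poisson_kernel 0 t - poisson_kernel (2 * pi * (real n + 1)) t))"
    by (simp add: poisson_diff_def algebra_simps)
  have m: "has_bochner_integral half_line (\<lambda>t. t powr p * (poisson_kernel 0 t - poisson_kernel y t)) (mellin_const p * y powr p)"
    if "y \<ge> 0" for y
    using mellin_poisson[OF that p] by (simp add: has_bochner_integral_iff)
  have "has_bochner_integral half_line (\<lambda>t. t powr p * poisson_diff x n t) (mellin_const p * power_bracket p x n)"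
    unfolding eq power_bracket_def right_diff_distrib[of "mellin_const p"] distrib_left[of "mellin_const p"]
    by (intro has_bochner_integral_diff has_bochner_integral_add m nn)
  thus "integrable half_line (\<lambda>t. t powr p * poisson_diff x n t)"
    "(\<integral>t. t powr p * poisson_diff x n t \<partial>half_line) = mellin_const p * power_bracket p x n"
    by (simp_all add: has_bochner_integral_iff)
qed

lemma mellin_exp:
  assumes p: "p > -1" and a: "a > (0::real)"
  shows "integrable half_line (\<lambda>t. t powr p * exp (- a * t))"
    and "(\<integral>t. t powr p * exp (- a * t) \<partial>half_line) = Gamma (p + 1) / a powr (p + 1)"
proof -
  have img: "(\<lambda>t. a * t) ` {0<..} = {0<..}"
  proof (intro equalityI subsetI)
    fix t assume "t \<in> {0::real<..}"
    thus "t \<in> (\<lambda>t. a * t) ` {0<..}" using a by (intro image_eqI[of _ _ "t / a"]) auto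
  qed (use a in auto)
  have I: "((\<lambda>t. t powr (p + 1 - 1) / exp t) has_integral Gamma (p + 1)) {0<..}"
  proof -
    have "((\<lambda>t. t powr (p + 1 - 1) / exp t) has_integral Gamma (p + 1)) {0..}"
      using p by (intro Gamma_integral_real) simp
    hence "((\<lambda>t. if t \<in> {0<..} then t powr (p + 1 - 1) / exp t else 0) has_integral Gamma (p + 1)) {0..}"
      by (rule has_integral_spike [of "{0}", rotated 2]) auto
    thus ?thesis by (subst (asm) has_integral_restrict) auto
  qed
  have "(\<lambda>t. t powr (p + 1 - 1) / exp t) absolutely_integrable_on {0<..}"
    using I by (intro nonnegative_absolutely_integrable_1) (auto simp: integrable_on_def)
  with I have "(\<lambda>t. t powr (p + 1 - 1) / exp t) absolutely_integrable_on (\<lambda>t. a * t) ` {0<..} \<and>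
     integral ((\<lambda>t. a * t) ` {0<..}) (\<lambda>t. t powr (p + 1 - 1) / exp t) = Gamma (p + 1)"
    unfolding img by (simp add: integral_unique)
  hence *: "(\<lambda>t. \<bar>a\<bar> * ((a * t) powr (p + 1 - 1) / exp (a * t))) absolutely_integrable_on {0<..} \<and>
     integral {0<..} (\<lambda>t. \<bar>a\<bar> * ((a * t) powr (p + 1 - 1) / exp (a * t))) = Gamma (p + 1)"
    using a by (subst (asm) has_absolute_integral_change_of_variables_1'[of _ _ "\<lambda>_. a", symmetric])
       (auto intro!: derivative_eq_intros inj_onI)
  define f where "f = (\<lambda>t. \<bar>a\<bar> * ((a * t) powr (p + 1 - 1) / exp (a * t)))"
  have f1: "integrable half_line f"
    using * unfolding f_def by (intro absolutely_integrable_imp_integrable) auto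
  have f2: "integral\<^sup>L half_line f = Gamma (p + 1)"
    using * lebesgue_integral_eq_integral[OF f1] by (simp add: f_def)
  have eq: "(\<lambda>t. t powr p * exp (- a * t)) = (\<lambda>t. f t / a powr (p + 1))"
    using a by (simp add: f_def powr_mult powr_add exp_minus field_simps)
  show "integrable half_line (\<lambda>t. t powr p * exp (- a * t))"
    unfolding eq by (rule integrable_divide) (rule f1)
  show "(\<integral>t. t powr p * exp (- a * t) \<partial>half_line) = Gamma (p + 1) / a powr (p + 1)"
    unfolding eq by (simp add: f2)
qed

definition cosine_gap :: "real \<Rightarrow> real \<Rightarrow> real" where
  "cosine_gap p x = (\<Sum>n. (1 - cos ((real n + 1) * x)) / (real n + 1) powr (p + 1))"

lemma summable_cos_powr:
  assumes "p > 0"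
  shows "summable (\<lambda>n. (1 - cos ((real n + 1) * x)) / (real n + 1) powr (p + 1))"
    and "summable (\<lambda>n. 1 / (real n + 1) powr (p + 1))"
proof -
  have "summable (\<lambda>n. real n powr - (p + 1))" using assms by (simp add: summable_real_powr_iff)
  hence s: "summable (\<lambda>n. real (Suc n) powr - (p + 1))" by (subst summable_Suc_iff)
  thus s1: "summable (\<lambda>n. 1 / (real n + 1) powr (p + 1))"
    by (simp only: powr_minus_divide of_nat_Suc add.commute[of 1])
  show "summable (\<lambda>n. (1 - cos ((real n + 1) * x)) / (real n + 1) powr (p + 1))"
  proof (rule summable_comparison_test_ev)
    show "summable (\<lambda>n. 2 * (1 / (real n + 1) powr (p + 1)))" using s1 by (rule summable_mult)
    have "\<bar>1 - cos ((real n + 1) * x)\<bar> \<le> 2" for n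
      using cos_le_one[of "(real n + 1) * x"] cos_ge_minus_one[of "(real n + 1) * x"] by linarith
    thus "\<forall>\<^sub>F n in sequentially. norm ((1 - cos ((real n + 1) * x)) / (real n + 1) powr (p + 1))
        \<le> 2 * (1 / (real n + 1) powr (p + 1))"
      by (intro always_eventually allI) (auto intro!: divide_right_mono)
  qed
qed

lemma mellin_exp_cos_sums:
  assumes "p > 0"
  shows "(\<lambda>n. Gamma (p + 1) * ((1 - cos ((real n + 1) * x)) / (real n + 1) powr (p + 1))) sums
     (\<integral>t. t powr p * damped_cosine_gap x t \<partial>half_line)"
proof -
  define f where "f = (\<lambda>n t. t powr p * exp (- (real n + 1) * t) * (1 - cos ((real n + 1) * x)))"
  have int: "integrable half_line (f n)" for n
    unfolding f_def using assms by (intro integrable_mult_left mellin_exp(1)) auto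
  have val: "integral\<^sup>L half_line (f n) = Gamma (p + 1) * ((1 - cos ((real n + 1) * x)) / (real n + 1) powr (p + 1))" for n
    unfolding f_def using mellin_exp[of p "real n + 1"] assms by simp
  have nonneg: "f n t \<ge> 0" for n t by (simp add: f_def)
  have sm: "summable (\<lambda>n. exp (- (real n + 1) * t) * (1 - cos ((real n + 1) * x)))" if "t > 0" for t
    using summable_diff[OF summable_exp_cos[OF that, of 0] summable_exp_cos[OF that, of x]] by (simp add: algebra_simps)
  have "(\<lambda>n. integral\<^sup>L half_line (f n)) sums (\<integral>t. (\<Sum>n. f n t) \<partial>half_line)"
  proof (rule sums_integral)
    show "integrable half_line (f n)" for n by (rule int)
    show "AE t in half_line. summable (\<lambda>n. norm (f n t))"
    proof (rule AE_I2)
      fix t assume "t \<in> space half_line"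
      hence "t > 0" by simp
      from summable_mult[OF sm[OF this], of "t powr p"] show "summable (\<lambda>n. norm (f n t))"
        using nonneg by (simp add: f_def mult_ac)
    qed
    show "summable (\<lambda>n. \<integral>t. norm (f n t) \<partial>half_line)"
      using nonneg summable_mult[OF summable_cos_powr(1)[OF assms, of x], of "Gamma (p + 1)"] by (simp add: val)
  qed
  also have "(\<integral>t. (\<Sum>n. f n t) \<partial>half_line) =
     (\<integral>t. t powr p * damped_cosine_gap x t \<partial>half_line)"
  proof (rule Bochner_Integration.integral_cong)
    fix t assume "t \<in> space half_line"
    hence "t > 0" by simp
    from suminf_mult[OF sm[OF this], of "t powr p"]
    show "(\<Sum>n. f n t) = t powr p * damped_cosine_gap x t"
      by (simp add: f_def damped_cosine_gap_def mult_ac)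
  qed simp
  finally show ?thesis by (simp add: val)
qed

text \<open>The termwise integration is where \<open>p < 1/2\<close> enters: a bound for the integrals of the absolute
  values that is of order \<open>n powr (- 5/4)\<close> follows from \<open>poisson_diff_bound\<close> if \<open>t powr (p + 1/4) / (1 + t\<^sup>2)\<close>
  is integrable.\<close>
lemma mellin_poisson_diff_sums:
  assumes p: "0 < p" "p < 1 / 2" and x: "0 \<le> x" "x \<le> 2 * pi"
  shows "(\<lambda>n. mellin_const p * power_bracket p x n) sums
     (\<integral>t. t powr p * damped_cosine_gap x t \<partial>half_line)"
proof -
  define f where "f = (\<lambda>n t. t powr p * poisson_diff x n t)"
  define h where "h = (\<lambda>t::real. t powr (p + 5 / 4 - 1) * (1\<^sup>2 / (1\<^sup>2 + t\<^sup>2)))"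
  have p2: "p < 2" using p by simp
  have int: "integrable half_line (f n)" for n unfolding f_def by (rule mellin_poisson_diff) (use p p2 x in auto)
  have inth: "integrable half_line h" unfolding h_def by (rule mellin_rational) (use p in auto)
  have bound: "norm (f n t) \<le> 24 * pi\<^sup>2 * real n powr (- (5 / 4)) * h t" if t: "t > 0" and n: "n \<ge> 1" for n t
  proof -
    define c where "c = 2 * pi * real n"
    have cn: "c \<ge> real n" unfolding c_def using pi_ge_two by (auto simp: mult_le_cancel_right1)
    have n1: "real n \<ge> 1" using n by simp
    have s: "c\<^sup>2 + t\<^sup>2 > 0" using t by (simp add: add_nonneg_pos)
    have "(real n)\<^sup>2 \<le> c\<^sup>2" using cn by (intro power_mono) auto
    hence s1: "1 + t\<^sup>2 \<le> c\<^sup>2 + t\<^sup>2" "(real n)\<^sup>2 \<le> c\<^sup>2 + t\<^sup>2" "t\<^sup>2 \<le> c\<^sup>2 + t\<^sup>2"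
      using one_le_power[OF n1, of 2] by (auto simp: add_increasing2)
    \<comment> \<open>One factor of the square controls the decay in \<open>t\<close>; the other is shared between \<open>t\<close> and \<open>n\<close>.\<close>
    have "t powr (3 / 4) * real n powr (5 / 4) = (t\<^sup>2) powr (3 / 8) * ((real n)\<^sup>2) powr (5 / 8)"
      using t n1 by (simp add: powr_powr flip: powr_numeral)
    also have "\<dots> \<le> (c\<^sup>2 + t\<^sup>2) powr (3 / 8) * (c\<^sup>2 + t\<^sup>2) powr (5 / 8)"
      using s1 t n1 by (intro mult_mono powr_mono2) auto
    also have "\<dots> = c\<^sup>2 + t\<^sup>2" using s by (simp flip: powr_add)
    finally have "(1 + t\<^sup>2) * (t powr (3 / 4) * real n powr (5 / 4)) \<le> (c\<^sup>2 + t\<^sup>2) * (c\<^sup>2 + t\<^sup>2)"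
      using s1 t by (intro mult_mono) auto
    hence "1 / (c\<^sup>2 + t\<^sup>2)\<^sup>2 \<le> 1 / ((1 + t\<^sup>2) * (t powr (3 / 4) * real n powr (5 / 4)))"
      unfolding power2_eq_square[of "c\<^sup>2 + t\<^sup>2"] using s t n1
      by (intro divide_left_mono) (auto intro!: mult_pos_pos add_pos_nonneg)
    hence "t powr p * (24 * pi\<^sup>2 * (t * (1 / (c\<^sup>2 + t\<^sup>2)\<^sup>2))) \<le>
        t powr p * (24 * pi\<^sup>2 * (t * (1 / ((1 + t\<^sup>2) * (t powr (3 / 4) * real n powr (5 / 4))))))"
      using t by (intro mult_left_mono) auto
    moreover have "norm (f n t) \<le> t powr p * (24 * pi\<^sup>2 * (t * (1 / (c\<^sup>2 + t\<^sup>2)\<^sup>2)))"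
      unfolding f_def c_def real_norm_def abs_mult using poisson_diff_bound[OF x t n] by (intro mult_mono) auto
    moreover have "t powr p * (24 * pi\<^sup>2 * (t * (1 / ((1 + t\<^sup>2) * (t powr (3 / 4) * real n powr (5 / 4)))))) =
      24 * pi\<^sup>2 * real n powr (- (5 / 4)) * h t"
    proof -
      have "t powr p * t / t powr (3 / 4) = t powr (p + 1 - 3 / 4)"
        using t by (simp only: powr_add powr_diff) simp
      also have "p + 1 - 3 / 4 = p + 5 / 4 - 1" by simp
      finally have e: "t powr (p + 5 / 4 - 1) = t powr p * t / t powr (3 / 4)" ..
      show ?thesis unfolding h_def e powr_minus_divide by (simp add: mult_ac)
    qed
    ultimately show ?thesis by linarith
  qed
  have smn: "summable (\<lambda>n. real n powr (- (5 / 4)))" by (simp add: summable_real_powr_iff)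
  have "(\<lambda>n. integral\<^sup>L half_line (f n)) sums (\<integral>t. (\<Sum>n. f n t) \<partial>half_line)"
  proof (rule sums_integral)
    show "integrable half_line (f n)" for n by (rule int)
    show "AE t in half_line. summable (\<lambda>n. norm (f n t))"
    proof (rule AE_I2)
      fix t assume "t \<in> space half_line"
      hence t: "t > 0" by simp
      show "summable (\<lambda>n. norm (f n t))"
      proof (rule summable_comparison_test_ev)
        show "summable (\<lambda>n. 24 * pi\<^sup>2 * real n powr (- (5 / 4)) * h t)"
          using smn by (intro summable_mult summable_mult2)
        show "\<forall>\<^sub>F n in sequentially. norm (norm (f n t)) \<le> 24 * pi\<^sup>2 * real n powr (- (5 / 4)) * h t"
          using eventually_ge_at_top[of 1] by eventually_elim (use bound[OF t] in auto)
      qed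
    qed
    show "summable (\<lambda>n. \<integral>t. norm (f n t) \<partial>half_line)"
    proof (rule summable_comparison_test_ev)
      show "summable (\<lambda>n. 24 * pi\<^sup>2 * real n powr (- (5 / 4)) * integral\<^sup>L half_line h)"
        using smn by (intro summable_mult summable_mult2)
      show "\<forall>\<^sub>F n in sequentially. norm (\<integral>t. norm (f n t) \<partial>half_line) \<le> 24 * pi\<^sup>2 * real n powr (- (5 / 4)) * integral\<^sup>L half_line h"
        using eventually_ge_at_top[of 1]
      proof eventually_elim
        case (elim n)
        have "(\<integral>t. norm (f n t) \<partial>half_line) \<le> (\<integral>t. 24 * pi\<^sup>2 * real n powr (- (5 / 4)) * h t \<partial>half_line)"
          using bound elim by (intro integral_mono integrable_norm int integrable_mult_right inth) auto
        thus ?case by (simp add: integral_nonneg_AE)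
      qed
    qed
  qed
  also have "(\<integral>t. (\<Sum>n. f n t) \<partial>half_line) =
     (\<integral>t. t powr p * damped_cosine_gap x t \<partial>half_line)"
  proof (rule Bochner_Integration.integral_cong)
    fix t assume "t \<in> space half_line"
    hence "t > 0" by simp
    from sums_mult[OF poisson_diff_sums[OF this], of "t powr p"]
    show "(\<Sum>n. f n t) = t powr p * damped_cosine_gap x t"
      by (simp add: f_def sums_iff)
  qed simp
  finally show ?thesis using mellin_poisson_diff(2)[OF p(1) p2 x] by (simp add: f_def)
qed

text \<open>The two evaluations of the Mellin transform of \<open>damped_cosine_gap\<close>, through its exponential series
  and through partial fractions.\<close>
lemma clausen_power_bracket_sums:
  assumes p: "0 < p" "p < 1 / 2" and x: "0 \<le> x" "x \<le> 2 * pi"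
  shows "(\<lambda>n. mellin_const p * power_bracket p x n) sums
     (Gamma (p + 1) * cosine_gap p x)"
proof -
  have "(\<Sum>n. Gamma (p + 1) * ((1 - cos ((real n + 1) * x)) / (real n + 1) powr (p + 1))) =
    Gamma (p + 1) * cosine_gap p x"
    unfolding cosine_gap_def using p by (intro suminf_mult summable_cos_powr) auto
  thus ?thesis using mellin_poisson_diff_sums[OF assms] mellin_exp_cos_sums[OF p(1), of x] by (simp add: sums_iff)
qed

section \<open>Expansion of the cosine series in powers\<close>

lemma mellin_const_pos: "0 < p \<Longrightarrow> p < 2 \<Longrightarrow> mellin_const p > 0"
  unfolding mellin_const_def by (intro divide_pos_pos mult_pos_pos sin_gt_zero) (auto simp: field_simps)

text \<open>The same powers as in \<open>power_bracket\<close>, now grouped symmetrically around \<open>2 \<pi> (n + 1)\<close>. In this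
  grouping each term is even in \<open>x\<close> and has one sign.\<close>
definition second_diff :: "real \<Rightarrow> real \<Rightarrow> nat \<Rightarrow> real" where
  "second_diff p x n = (2 * pi * (real n + 1) + x) powr p + (2 * pi * (real n + 1) - x) powr p
     - 2 * (2 * pi * (real n + 1)) powr p"

lemma power_bracket_sum_eq_second_diff:
  shows "(\<Sum>n<N. power_bracket p x n) = x powr p + (\<Sum>n<N. second_diff p x n)
    - ((2 * pi * real N + x) powr p - (2 * pi * real N) powr p)"
  by (induction N) (simp_all add: power_bracket_def second_diff_def algebra_simps)

lemma powr_shift_diff_tendsto_0:
  assumes "0 < p" "p < 1" "x \<ge> (0::real)"
  shows "((\<lambda>c. (c + x) powr p - c powr p) \<longlongrightarrow> 0) at_top"
proof (rule tendsto_sandwich[where f = "\<lambda>_. 0" and h = "\<lambda>c. p * x * c powr (p - 1)"])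
  show "((\<lambda>c. p * x * c powr (p - 1)) \<longlongrightarrow> 0) at_top"
    using assms by (intro tendsto_mult_right_zero tendsto_neg_powr filterlim_ident) auto
  show "\<forall>\<^sub>F c in at_top. (c + x) powr p - c powr p \<le> p * x * c powr (p - 1)"
    using eventually_gt_at_top[of 0]
  proof eventually_elim
    case (elim c)
    show ?case
    proof (cases "x = 0")
      case False
      with assms have "c < c + x" by simp
      from MVT2[OF this, of "\<lambda>c. c powr p" "\<lambda>c. p * c powr (p - 1)"] elim
      obtain z where z: "c < z" "(c + x) powr p - c powr p = x * (p * z powr (p - 1))"
        using has_real_derivative_powr[of _ p] by auto
      have "z powr (p - 1) \<le> c powr (p - 1)" using z elim assms by (intro powr_mono2') auto
      hence "x * (p * z powr (p - 1)) \<le> x * (p * c powr (p - 1))" using assms by (intro mult_left_mono) auto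
      thus ?thesis using z by (simp add: mult_ac)
    qed auto
  qed
  show "\<forall>\<^sub>F c in at_top. 0 \<le> (c + x) powr p - c powr p"
    using eventually_gt_at_top[of 0]
    by eventually_elim (use assms in \<open>auto intro!: powr_mono2\<close>)
qed simp

lemma clausen_second_diff_sums:
  assumes p: "0 < p" "p < 1 / 2" and x: "0 \<le> x" "x \<le> 2 * pi"
  shows "(\<lambda>n. second_diff p x n) sums
     (Gamma (p + 1) / mellin_const p * cosine_gap p x - x powr p)"
proof -
  have K: "mellin_const p > 0" using p by (intro mellin_const_pos) auto
  have "(\<lambda>n. power_bracket p x n) sums
     (Gamma (p + 1) / mellin_const p * cosine_gap p x)"
    using sums_divide[OF clausen_power_bracket_sums[OF assms], of "mellin_const p"] K by simp
  hence "(\<lambda>N. x powr p + (\<Sum>n<N. second_diff p x n) - ((2 * pi * real N + x) powr p - (2 * pi * real N) powr p))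
     \<longlonglongrightarrow> (Gamma (p + 1) / mellin_const p * cosine_gap p x)"
    unfolding sums_def power_bracket_sum_eq_second_diff .
  moreover have "(\<lambda>N. (2 * pi * real N + x) powr p - (2 * pi * real N) powr p) \<longlonglongrightarrow> 0"
    using p x by (intro filterlim_compose[OF powr_shift_diff_tendsto_0]) (auto, real_asymp)
  ultimately have "(\<lambda>N. (x powr p + (\<Sum>n<N. second_diff p x n) - ((2 * pi * real N + x) powr p - (2 * pi * real N) powr p))
       + ((2 * pi * real N + x) powr p - (2 * pi * real N) powr p) - x powr p) \<longlonglongrightarrow>
     (Gamma (p + 1) / mellin_const p * cosine_gap p x) + 0 - x powr p"
    by (intro tendsto_intros)
  thus ?thesis by (simp add: sums_def)
qed

text \<open>For \<open>0 < p < 1\<close> the falling factorial has one positive factor and an odd number of negative ones.\<close>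
lemma gbinomial_even_neg:
  assumes "0 < p" "p < (1::real)"
  shows "(p gchoose (2 * m + 2)) < 0"
proof -
  have pr: "(\<Prod>i<k. p - real (Suc i)) * (-1) ^ k > 0" for k
  proof (induction k)
    case (Suc k)
    have "(\<Prod>i<Suc k. p - real (Suc i)) * (-1) ^ Suc k = ((\<Prod>i<k. p - real (Suc i)) * (-1) ^ k) * (real (Suc k) - p)"
      by (simp add: algebra_simps)
    moreover have "real (Suc k) - p > 0" using assms by auto
    ultimately show ?case using mult_pos_pos[OF Suc] by presburger
  qed simp
  have "(\<Prod>i<2 * m + 2. p - real i) = p * (\<Prod>i<2 * m + 1. p - real (Suc i))"
    using prod.lessThan_Suc_shift[of "\<lambda>i. p - real i" "2 * m + 1"] by simp
  moreover have "(\<Prod>i<2 * m + 1. p - real (Suc i)) < 0" using pr[of "2 * m + 1"] by simp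
  ultimately have "(\<Prod>i<2 * m + 2. p - real i) < 0" using assms by (simp only: mult_pos_neg)
  thus ?thesis unfolding gbinomial_prod_rev
    by (simp add: divide_neg_pos atLeast0LessThan)
qed

lemma second_diff_binomial_sums:
  assumes x: "0 \<le> x" "x < 2 * pi"
  shows "(\<lambda>m. 2 * (p gchoose (2 * m + 2)) * (2 * pi * (real n + 1)) powr (p - real (2 * m + 2)) * x ^ (2 * m + 2))
    sums second_diff p x n"
proof -
  define c where "c = 2 * pi * (real n + 1)"
  have "2 * pi * 1 \<le> c" unfolding c_def by (intro mult_left_mono) auto
  with x have xc: "\<bar>x\<bar> < c" "\<bar>-x\<bar> < c" by auto
  define f where "f = (\<lambda>k. (p gchoose k) * c powr (p - real k) * (x ^ k + (-x) ^ k))"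
  have "f sums ((c + x) powr p + (c - x) powr p)"
    using sums_add[OF gen_binomial_real''[OF xc(1), of p] gen_binomial_real''[OF xc(2), of p]]
    by (simp add: f_def distrib_left)
  moreover have "f k = 0" if "k \<notin> range (\<lambda>m. 2 * m)" for k
  proof -
    have "odd k" using that by (auto elim!: evenE)
    thus ?thesis by (simp add: f_def)
  qed
  ultimately have "(\<lambda>m. f (2 * m)) sums ((c + x) powr p + (c - x) powr p)"
    by (subst sums_mono_reindex) (auto simp: strict_mono_def)
  hence "(\<lambda>m. f (2 * Suc m)) sums ((c + x) powr p + (c - x) powr p - f (2 * 0))"
    by (subst sums_Suc_iff) simp
  moreover have "f (2 * Suc m) = 2 * (p gchoose (2 * m + 2)) * c powr (p - real (2 * m + 2)) * x ^ (2 * m + 2)" for m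
    by (simp add: f_def)
  moreover have "f (2 * 0) = 2 * c powr p" by (simp add: f_def)
  ultimately show ?thesis unfolding second_diff_def c_def[symmetric] by simp
qed

text \<open>Tonelli's theorem for double series.\<close>
lemma sums_swap_nonneg:
  fixes f :: "nat \<Rightarrow> nat \<Rightarrow> real"
  assumes nonneg: "\<And>n m. f n m \<ge> 0"
    and g: "\<And>n. f n sums g n" and s: "g sums s"
    and h: "\<And>m. (\<lambda>n. f n m) sums h m"
  shows "h sums s"
proof -
  have g_has: "((\<lambda>m. f n m) has_sum g n) UNIV" for n
    using g nonneg by (intro sums_nonneg_imp_has_sum) auto
  have g0: "g n \<ge> 0" for n using g nonneg by (metis sums_le sums_zero)
  have s_has: "(g has_sum s) UNIV" using s g0 by (intro sums_nonneg_imp_has_sum) auto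
  have h_has: "((\<lambda>n. f n m) has_sum h m) UNIV" for m
    using h nonneg by (intro sums_nonneg_imp_has_sum) auto
  have "(\<lambda>(n, m). f n m) summable_on UNIV \<times> UNIV"
  proof (rule summable_on_SigmaI)
    show "((\<lambda>m. case (n, m) of (n, m) \<Rightarrow> f n m) has_sum g n) UNIV" for n using g_has by simp
    show "g summable_on UNIV" using s_has by (rule has_sum_imp_summable)
  qed (use nonneg in auto)
  hence "((\<lambda>(n, m). f n m) has_sum s) (UNIV \<times> UNIV)"
    using g_has s_has by (intro has_sum_SigmaI[where g = g]) auto
  hence "((\<lambda>(m, n). f n m) has_sum s) (UNIV \<times> UNIV)"
    by (subst (asm) has_sum_swap) simp
  hence "(h has_sum s) UNIV"
    by (rule has_sum_SigmaD) (use h_has in auto)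
  thus ?thesis by (rule has_sum_imp_sums)
qed

definition dirichlet_zeta :: "real \<Rightarrow> real" where
  "dirichlet_zeta s = (\<Sum>n. (real n + 1) powr (- s))"

lemma dirichlet_zeta_sums:
  assumes "s > 1"
  shows "(\<lambda>n. (real n + 1) powr (- s)) sums dirichlet_zeta s"
proof -
  have "summable (\<lambda>n. 1 / (real n + 1) powr (s - 1 + 1))"
    using assms by (intro summable_cos_powr) auto
  hence "summable (\<lambda>n. (real n + 1) powr (- s))"
    by (simp only: powr_minus_divide diff_add_cancel)
  thus ?thesis unfolding dirichlet_zeta_def by (rule summable_sums)
qed

text \<open>The coefficient of \<open>x\<close> to the power \<open>2 m + 2\<close> in the sum over \<open>n\<close> of the binomial expansions of
  \<open>second_diff p x n\<close>.\<close>
definition clausen_coeff :: "real \<Rightarrow> nat \<Rightarrow> real" where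
  "clausen_coeff p m = 2 * (p gchoose (2 * m + 2)) * (2 * pi) powr (p - real (2 * m + 2)) * dirichlet_zeta (real (2 * m + 2) - p)"

lemma dirichlet_zeta_nonneg:
  assumes "s > 1"
  shows "dirichlet_zeta s \<ge> 0"
  by (rule sums_le[OF _ sums_zero dirichlet_zeta_sums[OF assms]]) simp

lemma clausen_coeff_nonpos:
  assumes "0 < p" "p < 1"
  shows "clausen_coeff p m \<le> 0"
proof -
  have "dirichlet_zeta (real (2 * m + 2) - p) \<ge> 0" using assms by (intro dirichlet_zeta_nonneg) auto
  moreover have "2 * (p gchoose (2 * m + 2)) * (2 * pi) powr (p - real (2 * m + 2)) \<le> 0"
    
    using gbinomial_even_neg[OF assms, of m] by (rule_tac mult_nonpos_nonneg) auto
  ultimately show ?thesis unfolding clausen_coeff_def by (rule mult_nonpos_nonneg[rotated])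
qed

text \<open>Each second difference is expanded by the binomial series, and the two summations are exchanged.
  The exchange is free of estimates because all terms are nonpositive.\<close>
lemma clausen_expansion:
  assumes p: "0 < p" "p < 1 / 2" and x: "0 \<le> x" "x < 2 * pi"
  shows "(\<lambda>m. clausen_coeff p m * x ^ (2 * m + 2)) sums
     (Gamma (p + 1) / mellin_const p * cosine_gap p x - x powr p)"
proof -
  define f where "f = (\<lambda>n m. - (2 * (p gchoose (2 * m + 2)) * (2 * pi * (real n + 1)) powr (p - real (2 * m + 2)) * x ^ (2 * m + 2)))"
  define s where "s = Gamma (p + 1) / mellin_const p * cosine_gap p x - x powr p"
  have "(\<lambda>m. - (clausen_coeff p m * x ^ (2 * m + 2))) sums (- s)"
  proof (rule sums_swap_nonneg)
    show "f n m \<ge> 0" for n m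
    proof -
      have "(p gchoose (2 * m + 2)) < 0" using p by (intro gbinomial_even_neg) auto
      hence "2 * (p gchoose (2 * m + 2)) * (2 * pi * (real n + 1)) powr (p - real (2 * m + 2)) * x ^ (2 * m + 2) \<le> 0"
        using x by (simp add: mult_le_0_iff)
      thus ?thesis by (simp add: f_def)
    qed
    show "f n sums (- second_diff p x n)" for n
      unfolding f_def by (intro sums_minus second_diff_binomial_sums x)
    show "(\<lambda>n. - second_diff p x n) sums (- s)"
      unfolding s_def by (intro sums_minus clausen_second_diff_sums p) (use x in auto)
    show "(\<lambda>n. f n m) sums (- (clausen_coeff p m * x ^ (2 * m + 2)))" for m
    proof -
      have "(\<lambda>n. (real n + 1) powr (- (real (2 * m + 2) - p))) sums dirichlet_zeta (real (2 * m + 2) - p)"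
        using p by (intro dirichlet_zeta_sums) auto
      note * = sums_mult[OF this, of "- (2 * (p gchoose (2 * m + 2)) * (2 * pi) powr (p - real (2 * m + 2)) * x ^ (2 * m + 2))"]
      have pow: "(2 * pi * (real n + 1)) powr e = (2 * pi) powr e * (real n + 1) powr e" for n e
        by (rule powr_mult)
      have "f n m = - (2 * (p gchoose (2 * m + 2)) * (2 * pi) powr (p - real (2 * m + 2)) * x ^ (2 * m + 2)) *
          (real n + 1) powr (- (real (2 * m + 2) - p))" for n
        unfolding f_def pow minus_diff_eq by (simp only: mult_ac minus_mult_left)
      moreover have "- (2 * (p gchoose (2 * m + 2)) * (2 * pi) powr (p - real (2 * m + 2)) * x ^ (2 * m + 2)) *
          dirichlet_zeta (real (2 * m + 2) - p) = - (clausen_coeff p m * x ^ (2 * m + 2))"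
        unfolding clausen_coeff_def by (simp only: mult_ac minus_mult_left)
      ultimately show ?thesis using * by (simp only:)
    qed
  qed
  from sums_minus[OF this] show ?thesis by (simp add: s_def)
qed

section \<open>The zeta function to the left of the critical strip\<close>

text \<open>All terms of the binomial expansion are nonpositive; this is the concavity of \<open>x powr p\<close>.\<close>
lemma second_diff_nonpos:
  assumes p: "0 < p" "p < 1" and x: "0 \<le> x" "x < 2 * pi"
  shows "second_diff p x n \<le> 0"
proof -
  have "2 * (p gchoose (2 * m + 2)) * (2 * pi * (real n + 1)) powr (p - real (2 * m + 2)) * x ^ (2 * m + 2) \<le> 0" for m
  proof -
    have "2 * (p gchoose (2 * m + 2)) * (2 * pi * (real n + 1)) powr (p - real (2 * m + 2)) \<le> 0"
      using gbinomial_even_neg[OF p, of m] by (rule_tac mult_nonpos_nonneg) auto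
    thus ?thesis by (rule mult_nonpos_nonneg) (use x in auto)
  qed
  thus ?thesis by (intro sums_le[OF _ second_diff_binomial_sums[OF x] sums_zero]) auto
qed

text \<open>The subtracted terms are the mean of the integrals of \<open>x powr p\<close> over \<open>[0, N]\<close> and \<open>[0, N + 1]\<close>.
  With them removed, the partial sums of the divergent series for \<open>\<zeta>(- p)\<close> converge.\<close>
definition zeta_corrected_sum :: "real \<Rightarrow> nat \<Rightarrow> real" where
  "zeta_corrected_sum p N = (\<Sum>n<N. (real n + 1) powr p) -
     ((real N + 1) powr (p + 1) + real N powr (p + 1)) / (2 * (p + 1))"

lemma has_integral_powr_affine:
  fixes a b c :: real
  assumes p: "p > 0" and "a \<le> b" and c: "c = 1 \<or> c = -1" and nn: "\<And>x. x \<in> {a..b} \<Longrightarrow> d + c * x \<ge> 0"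
  shows "((\<lambda>x. (d + c * x) powr p) has_integral c * ((d + c * b) powr (p + 1) - (d + c * a) powr (p + 1)) / (p + 1)) {a..b}"
proof -
  have "((\<lambda>x. (d + c * x) powr p) has_integral
     c * (d + c * b) powr (p + 1) / (p + 1) - c * (d + c * a) powr (p + 1) / (p + 1)) {a..b}"
  proof (rule fundamental_theorem_of_calculus_interior)
    show "continuous_on {a..b} (\<lambda>x. c * (d + c * x) powr (p + 1) / (p + 1))"
      using p nn by (intro continuous_intros continuous_on_powr') auto
    fix x assume x: "x \<in> {a<..<b}"
    have pos: "d + c * x > 0"
    proof -
      from c show ?thesis
      proof
        assume "c = 1" thus ?thesis using nn[of a] x by auto
      next
        assume "c = -1" thus ?thesis using nn[of b] x by auto
      qed
    qed
    have "((\<lambda>x. c * (d + c * x) powr (p + 1) / (p + 1)) has_real_derivative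
        c * ((p + 1) * (d + c * x) powr (p + 1 - 1) * c) / (p + 1)) (at x)"
      using pos by (auto intro!: derivative_eq_intros DERIV_chain2[OF has_real_derivative_powr])
    also have "c * ((p + 1) * (d + c * x) powr (p + 1 - 1) * c) / (p + 1) = (c * c) * (d + c * x) powr p"
      using p by simp
    also have "\<dots> = (d + c * x) powr p" using c by auto
    finally show "((\<lambda>x. c * (d + c * x) powr (p + 1) / (p + 1)) has_vector_derivative (d + c * x) powr p) (at x)"
      by (simp add: has_real_derivative_iff_has_vector_derivative)
  qed (use assms in auto)
  thus ?thesis by (simp add: right_diff_distrib diff_divide_distrib)
qed

text \<open>The integrals over one period telescope, except for the sum of the powers \<open>(n + 1) powr p\<close>.\<close>
lemma integral_second_diff:
  assumes p: "0 < p"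
  shows "((\<lambda>x. x powr p + (\<Sum>n<N. second_diff p x n)) has_integral
           (- 2) * (2 * pi) powr (p + 1) * zeta_corrected_sum p N) {0..2 * pi}"
proof -
  have one: "((\<lambda>x. second_diff p x n) has_integral
      (2 * pi) powr (p + 1) * (((real n + 2) powr (p + 1) - real n powr (p + 1)) / (p + 1) - 2 * (real n + 1) powr p)) {0..2 * pi}" for n
  proof -
    define c where "c = 2 * pi * (real n + 1)"
    have c0: "c \<ge> 2 * pi" by (simp add: c_def)
    have "((\<lambda>x. (c + 1 * x) powr p + (c + (-1) * x) powr p - 2 * c powr p) has_integral
       1 * ((c + 1 * (2 * pi)) powr (p + 1) - (c + 1 * 0) powr (p + 1)) / (p + 1) +
       (-1) * ((c + (-1) * (2 * pi)) powr (p + 1) - (c + (-1) * 0) powr (p + 1)) / (p + 1) -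
       (2 * pi - 0) *\<^sub>R (2 * c powr p)) {0..2 * pi}"
    proof (intro has_integral_diff has_integral_add has_integral_powr_affine has_integral_const_real p)
      have "measure lborel {0..2 * pi} *\<^sub>R (2 * c powr p) = (2 * pi - 0) *\<^sub>R (2 * c powr p)" by simp
      thus "((\<lambda>x. 2 * c powr p) has_integral (2 * pi - 0) *\<^sub>R (2 * c powr p)) {0..2 * pi}"
        using has_integral_const_real[of "2 * c powr p" 0 "2 * pi"] by simp
    qed (use c0 pi_ge_zero in auto)
    also have "1 * ((c + 1 * (2 * pi)) powr (p + 1) - (c + 1 * 0) powr (p + 1)) / (p + 1) +
       (-1) * ((c + (-1) * (2 * pi)) powr (p + 1) - (c + (-1) * 0) powr (p + 1)) / (p + 1) -
       (2 * pi - 0) *\<^sub>R (2 * c powr p) =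
       ((c + 2 * pi) powr (p + 1) - (c - 2 * pi) powr (p + 1)) / (p + 1) - 4 * pi * c powr p"
      by (simp add: diff_divide_distrib add_divide_distrib)
    also have "c + 2 * pi = 2 * pi * (real n + 2)" by (simp add: c_def algebra_simps)
    also have "c - 2 * pi = 2 * pi * real n" by (simp add: c_def algebra_simps)
    also have "((2 * pi * (real n + 2)) powr (p + 1) - (2 * pi * real n) powr (p + 1)) / (p + 1) - 4 * pi * c powr p
      = (2 * pi) powr (p + 1) * (((real n + 2) powr (p + 1) - real n powr (p + 1)) / (p + 1) - 2 * (real n + 1) powr p)"
    proof -
      have "(2 * pi) powr (p + 1) = 2 * pi * (2 * pi) powr p" by (simp add: powr_add)
      moreover have "(2 * pi * (real n + 2)) powr (p + 1) = (2 * pi) powr (p + 1) * (real n + 2) powr (p + 1)"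
        "(2 * pi * real n) powr (p + 1) = (2 * pi) powr (p + 1) * real n powr (p + 1)"
        "c powr p = (2 * pi) powr p * (real n + 1) powr p" unfolding c_def by (rule powr_mult)+
      ultimately show ?thesis by (simp add: right_diff_distrib)
    qed
    finally show ?thesis by (simp add: second_diff_def c_def)
  qed
  have x: "((\<lambda>x. x powr p) has_integral (2 * pi) powr (p + 1) / (p + 1)) {0..2 * pi}"
    using has_integral_powr_affine[of p 0 "2 * pi" 1 0] p by simp
  have "((\<lambda>x. x powr p + (\<Sum>n<N. second_diff p x n)) has_integral
     (2 * pi) powr (p + 1) / (p + 1) + (\<Sum>n<N. (2 * pi) powr (p + 1) *
       (((real n + 2) powr (p + 1) - real n powr (p + 1)) / (p + 1) - 2 * (real n + 1) powr p))) {0..2 * pi}"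
    by (intro has_integral_add x has_integral_sum one) auto
  also have "(2 * pi) powr (p + 1) / (p + 1) + (\<Sum>n<N. (2 * pi) powr (p + 1) *
       (((real n + 2) powr (p + 1) - real n powr (p + 1)) / (p + 1) - 2 * (real n + 1) powr p)) =
       (- 2) * (2 * pi) powr (p + 1) * zeta_corrected_sum p N"
  proof -
    have "1 / (p + 1) + (\<Sum>n<N. ((real n + 2) powr (p + 1) - real n powr (p + 1)) / (p + 1) - 2 * (real n + 1) powr p)
        = (- 2) * zeta_corrected_sum p N"
    proof (induction N)
      case 0
      have "1 / (p + 1) = 2 / (2 * (p + 1))" by (subst mult_divide_mult_cancel_left[of 2 1, symmetric]) simp_all
      thus ?case by (simp add: zeta_corrected_sum_def)
    next
      case (Suc N)
      have "(- 2) * zeta_corrected_sum p (Suc N) = (- 2) * zeta_corrected_sum p N +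
        (((real N + 2) powr (p + 1) - real N powr (p + 1)) / (p + 1) - 2 * (real N + 1) powr p)"
      proof -
        have "(- 2) * ((S + b) - (C + B) / (2 * q)) = (- 2) * (S - (B + A) / (2 * q)) + ((C - A) / q - 2 * b)"
          if "q > 0" for S b A B C q :: real using that by (simp add: field_simps)
        from this[of "p + 1"] p have "(- 2) * ((S + b) - (C + B) / (2 * (p + 1))) =
           (- 2) * (S - (B + A) / (2 * (p + 1))) + ((C - A) / (p + 1) - 2 * b)" for S b A B C by simp
        moreover have "real (Suc N) + 1 = real N + 2" "real (Suc N) = real N + 1" by simp_all
        ultimately show ?thesis unfolding zeta_corrected_sum_def sum.lessThan_Suc by (simp only:)
      qed
      thus ?case using Suc by simp
    qed
    hence "(2 * pi) powr (p + 1) * (1 / (p + 1) + (\<Sum>n<N. ((real n + 2) powr (p + 1) - real n powr (p + 1)) / (p + 1) - 2 * (real n + 1) powr p))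
       = (2 * pi) powr (p + 1) * ((- 2) * zeta_corrected_sum p N)" by simp
    thus ?thesis by (simp add: distrib_left sum_distrib_left mult_ac)
  qed
  finally show ?thesis .
qed

text \<open>The expansion of the cosine series is integrated over one period. The cosines integrate to zero, so
  that one side becomes a multiple of \<open>\<zeta>(p + 1)\<close>, and the other becomes a multiple of the limit of the corrected partial sums.
  Dominated convergence applies since the partial sums decrease from \<open>x powr p\<close> to a nonnegative limit.\<close>
lemma zeta_corrected_sum_tendsto:
  assumes p: "0 < p" "p < 1 / 2"
  shows "zeta_corrected_sum p \<longlonglongrightarrow>
     - (Gamma (p + 1) * dirichlet_zeta (p + 1) * (2 * pi) powr (- p) / (2 * mellin_const p))"
proof -
  define c where "c = Gamma (p + 1) / mellin_const p"
  define W where "W = cosine_gap p"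
  define S where "S = {0<..<2 * pi}"
  define P where "P = (\<lambda>N x. x powr p + (\<Sum>n<N. second_diff p x n))"
  have K: "mellin_const p > 0" using p by (intro mellin_const_pos) auto
  have c0: "c > 0" using K p by (simp add: c_def Gamma_real_pos)
  have Pint: "(P N has_integral (- 2) * (2 * pi) powr (p + 1) * zeta_corrected_sum p N) S" for N
    using integral_second_diff[OF p(1), of N] by (simp add: P_def S_def has_integral_Icc_iff_Ioo)
  have Plim: "(\<lambda>N. P N x) \<longlonglongrightarrow> c * W x" if "x \<in> S" for x
    using tendsto_add[OF tendsto_const[of "x powr p"] clausen_second_diff_sums[OF p, of x, unfolded sums_def]] that
    by (simp add: P_def S_def c_def W_def)
  have W0: "W x \<ge> 0" for x
    unfolding W_def cosine_gap_def using p by (intro suminf_nonneg summable_cos_powr) auto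
  have Pdec: "P M x \<le> P N x" if "M \<ge> N" "x \<in> S" for M N x
  proof -
    have "(\<Sum>n<M. second_diff p x n) \<le> (\<Sum>n<N. second_diff p x n)"
    proof (rule decseqD[OF decseq_SucI that(1)])
      have "second_diff p x n \<le> 0" for n using that p by (intro second_diff_nonpos) (auto simp: S_def)
      thus "(\<Sum>n<Suc N. second_diff p x n) \<le> (\<Sum>n<N. second_diff p x n)" for N by simp
    qed
    thus ?thesis by (simp add: P_def)
  qed
  have Pge: "P N x \<ge> 0" if "x \<in> S" for N x
  proof -
    have "c * W x \<le> P N x"
      using Plim[OF that] Pdec[OF _ that] by (intro LIMSEQ_le_const2[of "\<lambda>N. P N x"]) auto
    moreover have "c * W x \<ge> 0" using c0 W0 by simp
    ultimately show ?thesis by simp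
  qed
  have Ple: "P N x \<le> x powr p" if "x \<in> S" for N x
    using Pdec[of 0 N x] that by (simp add: P_def)
  have lim1: "(\<lambda>N. integral S (P N)) \<longlonglongrightarrow> integral S (\<lambda>x. c * W x)"
  proof (rule dominated_convergence)
    show "P N integrable_on S" for N using Pint by (auto simp: integrable_on_def)
    show "(P 0) integrable_on S" using Pint by (auto simp: integrable_on_def)
    show "norm (P N x) \<le> P 0 x" if "x \<in> S" for N x using Pge[OF that] Ple[OF that] by (simp add: P_def)
  qed (use Plim in auto)
  define V where "V = (\<lambda>N x. \<Sum>n<N. (1 - cos ((real n + 1) * x)) / (real n + 1) powr (p + 1))"
  have Vint: "(V N has_integral (\<Sum>n<N. 2 * pi * (real n + 1) powr (- (p + 1)))) S" for N
  proof -
    have "((\<lambda>x. (1 - cos ((real n + 1) * x)) / (real n + 1) powr (p + 1)) has_integral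
       2 * pi * (real n + 1) powr (- (p + 1))) {0..2 * pi}" for n
    proof -
      have "((\<lambda>x. 1 - cos ((real n + 1) * x)) has_integral
         (2 * pi - sin ((real n + 1) * (2 * pi)) / (real n + 1)) - (0 - sin ((real n + 1) * 0) / (real n + 1))) {0..2 * pi}"
        by (intro fundamental_theorem_of_calculus)
           (auto intro!: derivative_eq_intros simp: has_real_derivative_iff_has_vector_derivative[symmetric])
      also have "sin ((real n + 1) * (2 * pi)) = 0"
        using sin_npi[of "2 * (n + 1)"] by (simp add: algebra_simps)
      finally have "((\<lambda>x. 1 - cos ((real n + 1) * x)) has_integral 2 * pi) {0..2 * pi}" by simp
      from has_integral_divide[OF this, of "(real n + 1) powr (p + 1)"] show ?thesis
        unfolding powr_minus_divide by simp
    qed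
    thus ?thesis unfolding V_def S_def by (intro has_integral_sum) (auto simp: has_integral_Icc_iff_Ioo)
  qed
  have lim2: "(\<lambda>N. integral S (V N)) \<longlonglongrightarrow> integral S W"
  proof (rule dominated_convergence)
    show "V N integrable_on S" for N using Vint by (auto simp: integrable_on_def)
    show "(\<lambda>_. 2 * dirichlet_zeta (p + 1)) integrable_on S"
      unfolding S_def by (simp add: integrable_on_Icc_iff_Ioo[symmetric] integrable_const_ivl)
    show "(\<lambda>N. V N x) \<longlonglongrightarrow> W x" for x
      unfolding V_def W_def cosine_gap_def using summable_sums[OF summable_cos_powr(1)[OF p(1)], of x] by (simp add: sums_def)
    show "norm (V N x) \<le> 2 * dirichlet_zeta (p + 1)" for N x
    proof -
      have "V N x \<ge> 0" unfolding V_def by (intro sum_nonneg) auto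
      moreover have "V N x \<le> (\<Sum>n<N. 2 * (real n + 1) powr (- (p + 1)))"
        unfolding V_def
      proof (rule sum_mono)
        fix n
        have "1 - cos ((real n + 1) * x) \<le> 2" using cos_ge_minus_one[of "(real n + 1) * x"] by linarith
        hence "(1 - cos ((real n + 1) * x)) * (real n + 1) powr (- (p + 1)) \<le> 2 * (real n + 1) powr (- (p + 1))"
          by (intro mult_right_mono) auto
        thus "(1 - cos ((real n + 1) * x)) / (real n + 1) powr (p + 1) \<le> 2 * (real n + 1) powr (- (p + 1))"
          unfolding powr_minus_divide by simp
      qed
      moreover have "(\<Sum>n<N. 2 * (real n + 1) powr (- (p + 1))) \<le> 2 * dirichlet_zeta (p + 1)"
      proof -
        have s: "(\<lambda>n. 2 * (real n + 1) powr (- (p + 1))) sums (2 * dirichlet_zeta (p + 1))"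
          using p by (intro sums_mult dirichlet_zeta_sums) auto
        show ?thesis
          unfolding sums_unique[OF s] by (rule sum_le_suminf[OF sums_summable[OF s]]) auto
      qed
      ultimately show ?thesis by simp
    qed
  qed
  have "(\<lambda>N. 2 * pi * (\<Sum>n<N. (real n + 1) powr (- (p + 1)))) \<longlonglongrightarrow> 2 * pi * dirichlet_zeta (p + 1)"
    using dirichlet_zeta_sums[of "p + 1"] p unfolding sums_def by (intro tendsto_intros) auto
  moreover have "integral S (V N) = 2 * pi * (\<Sum>n<N. (real n + 1) powr (- (p + 1)))" for N
    using Vint[of N] by (simp add: integral_unique sum_distrib_left)
  ultimately have IW: "integral S W = 2 * pi * dirichlet_zeta (p + 1)"
    using lim2 by (simp add: LIMSEQ_unique)
  have lim3: "(\<lambda>N. (- 2) * (2 * pi) powr (p + 1) * zeta_corrected_sum p N) \<longlonglongrightarrow> c * (2 * pi * dirichlet_zeta (p + 1))"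
    using lim1 unfolding integral_unique[OF Pint] by (simp add: IW)
  hence "(\<lambda>N. (- 2) * (2 * pi) powr (p + 1) * zeta_corrected_sum p N / ((- 2) * (2 * pi) powr (p + 1))) \<longlonglongrightarrow>
      c * (2 * pi * dirichlet_zeta (p + 1)) / ((- 2) * (2 * pi) powr (p + 1))"
    by (intro tendsto_divide lim3 tendsto_const) simp
  also have "c * (2 * pi * dirichlet_zeta (p + 1)) / ((- 2) * (2 * pi) powr (p + 1)) =
     - (Gamma (p + 1) * dirichlet_zeta (p + 1) * (2 * pi) powr (- p) / (2 * mellin_const p))"
    using K by (simp add: c_def powr_minus_divide powr_add)
  finally show ?thesis by simp
qed

section \<open>Analytic continuation and functional equation of the zeta function\<close>

text \<open>Weierstrass' theorem with local majorants; all three series that are continued below are of this kind.\<close>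
lemma holomorphic_on_suminf:
  fixes f :: "nat \<Rightarrow> complex \<Rightarrow> complex"
  assumes S: "open S" and hol: "\<And>n. f n holomorphic_on S"
    and bound: "\<And>z. z \<in> S \<Longrightarrow> \<exists>d>0. \<exists>M. summable M \<and> cball z d \<subseteq> S \<and>
                  (\<forall>\<^sub>F n in sequentially. \<forall>w\<in>cball z d. norm (f n w) \<le> M n)"
  shows "(\<lambda>z. \<Sum>n. f n z) holomorphic_on S" and "z \<in> S \<Longrightarrow> summable (\<lambda>n. f n z)"
proof -
  show "(\<lambda>z. \<Sum>n. f n z) holomorphic_on S"
  proof (rule holomorphic_uniform_sequence[OF S])
    show "(\<lambda>z. \<Sum>i<n. f i z) holomorphic_on S" for n by (intro holomorphic_intros hol)
    fix z assume "z \<in> S"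
    from bound[OF this] obtain d M where d: "d > 0" "summable M" "cball z d \<subseteq> S"
      "\<forall>\<^sub>F n in sequentially. \<forall>w\<in>cball z d. norm (f n w) \<le> M n" by blast
    have "uniform_limit (cball z d) (\<lambda>n z. \<Sum>i<n. f i z) (\<lambda>z. \<Sum>n. f n z) sequentially"
      by (rule Weierstrass_m_test_ev[OF d(4,2)])
    with d show "\<exists>d>0. cball z d \<subseteq> S \<and> uniform_limit (cball z d) (\<lambda>n z. \<Sum>i<n. f i z) (\<lambda>z. \<Sum>n. f n z) sequentially"
      by blast
  qed
  show "summable (\<lambda>n. f n z)" if "z \<in> S"
  proof -
    from bound[OF that] obtain d M where d: "d > 0" "summable M"
      and ev: "\<forall>\<^sub>F n in sequentially. \<forall>w\<in>cball z d. norm (f n w) \<le> M n" by blast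
    have "z \<in> cball z d" using d by simp
    hence "\<forall>\<^sub>F n in sequentially. norm (f n z) \<le> M n" by (intro eventually_mono[OF ev]) blast
    thus ?thesis using d(2) by (rule summable_comparison_test_ev)
  qed
qed

lemma norm_Suc_powr: "norm (of_nat (Suc n) powr (s :: complex)) = (real n + 1) powr Re s"
  using norm_powr_real_powr[of "of_nat (Suc n)" s] by (simp add: add.commute)

definition zeta_series :: "complex \<Rightarrow> complex" where
  "zeta_series s = (\<Sum>n. of_nat (Suc n) powr (- s))"

lemma summable_real_powr: "e < -1 \<Longrightarrow> summable (\<lambda>n. (real n + 1) powr e)"
  using sums_summable[OF dirichlet_zeta_sums[of "-e"]] by simp

lemma
  shows holomorphic_zeta_series: "zeta_series holomorphic_on {s. 1 < Re s}"
    and summable_zeta_series: "1 < Re s \<Longrightarrow> summable (\<lambda>n. of_nat (Suc n) powr (- s) :: complex)"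
proof -
  have op: "open {s. 1 < Re s}" by (simp add: open_halfspace_Re_gt)
  have hol: "(\<lambda>s. of_nat (Suc n) powr (- s) :: complex) holomorphic_on {s. 1 < Re s}" for n
    by (intro holomorphic_intros)
  have bnd: "\<exists>d>0. \<exists>M. summable M \<and> cball z d \<subseteq> {s. 1 < Re s} \<and>
       (\<forall>\<^sub>F n in sequentially. \<forall>w\<in>cball z d. norm (of_nat (Suc n) powr (- w) :: complex) \<le> M n)" if "z \<in> {s. 1 < Re s}" for z
  proof -
    define d where "d = (Re z - 1) / 2"
    have d: "d > 0" using that by (simp add: d_def)
    have Re: "Re w \<ge> 1 + d" if "w \<in> cball z d" for w
      using abs_Re_le_cmod[of "z - w"] that by (simp add: d_def dist_norm field_simps)
    show ?thesis
    proof (intro exI[of _ d] exI[of _ "\<lambda>n. (real n + 1) powr (- (1 + d))"] conjI always_eventually allI ballI)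
      show "summable (\<lambda>n. (real n + 1) powr - (1 + d))" using d by (intro summable_real_powr) auto
      show "cball z d \<subseteq> {s. 1 < Re s}" 
      proof
        fix w assume "w \<in> cball z d"
        from Re[OF this] d show "w \<in> {s. 1 < Re s}" by simp
      qed
      fix n w assume "w \<in> cball z d"
      from Re[OF this] show "norm (of_nat (Suc n) powr (- w) :: complex) \<le> (real n + 1) powr (- (1 + d))"
        unfolding norm_Suc_powr by (intro powr_mono) auto
    qed (use d in auto)
  qed
  show "zeta_series holomorphic_on {s. 1 < Re s}"
    unfolding zeta_series_def[abs_def] by (rule holomorphic_on_suminf(1)[OF op hol bnd])
  show "1 < Re s \<Longrightarrow> summable (\<lambda>n. of_nat (Suc n) powr (- s) :: complex)"
    using holomorphic_on_suminf(2)[OF op hol bnd, of s] by simp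
qed

lemma norm_zeta_series_le:
  assumes "1 < \<sigma>" "\<sigma> \<le> Re s"
  shows "norm (zeta_series s) \<le> dirichlet_zeta \<sigma>"
proof -
  have "norm (zeta_series s) \<le> (\<Sum>n. norm (of_nat (Suc n) powr (- s) :: complex))"
    unfolding zeta_series_def
    by (rule summable_norm) (unfold norm_Suc_powr, use assms in \<open>auto intro!: summable_real_powr\<close>)
  also have "\<dots> \<le> (\<Sum>n. (real n + 1) powr (- \<sigma>))"
    unfolding norm_Suc_powr using assms by (intro suminf_le) (auto intro!: powr_mono summable_real_powr)
  finally show ?thesis by (simp add: dirichlet_zeta_def)
qed

lemma zeta_series_of_real:
  assumes "s > 1"
  shows "zeta_series (of_real s) = of_real (dirichlet_zeta s)"
proof -
  have "(\<lambda>n. complex_of_real ((real n + 1) powr (- s))) sums of_real (dirichlet_zeta s)"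
    using dirichlet_zeta_sums[OF assms] by (simp only: sums_of_real_iff)
  moreover have "complex_of_real ((real n + 1) powr (- s)) = of_nat (Suc n) powr (- of_real s)" for n
    using powr_of_real[of "real n + 1" "- s"] by (simp add: add_ac)
  ultimately show ?thesis unfolding zeta_series_def by (simp add: sums_iff)
qed

text \<open>The difference between a term of the Dirichlet series and half the integral of \<open>x powr (- w)\<close>
  over the interval of length 2 around it. At \<open>n = 0\<close> the convention \<open>0 powr (1 - w) = 0\<close> discards the
  lower end point. The boundary term at the lower end of the telescoping sum is then
  \<open>1 / (2 (1 - w))\<close>, which \<open>zeta_midpoint\<close> subtracts.\<close>
definition zeta_midpoint_term :: "nat \<Rightarrow> complex \<Rightarrow> complex" where
  "zeta_midpoint_term n w = of_nat (n + 1) powr (- w) - (of_nat (n + 2) powr (1 - w) - of_nat n powr (1 - w)) / (2 * (1 - w))"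

definition zeta_midpoint :: "complex \<Rightarrow> complex" where
  "zeta_midpoint w = (\<Sum>n. zeta_midpoint_term n w) - 1 / (2 * (1 - w))"

text \<open>A central difference of \<open>x powr q\<close> with \<open>q = 1 - w\<close> agrees with twice its derivative up to the third derivative.
  The resulting order \<open>n powr (- Re w - 2)\<close> is what continues the series to \<open>Re w > -1\<close>.\<close>
lemma zeta_midpoint_term_bound:
  assumes n: "n \<ge> 1" and w: "Re w > -2" "w \<noteq> 1"
  shows "norm (zeta_midpoint_term n w) \<le> norm w * norm (1 + w) / 2 * real n powr (- Re w - 2)"
proof -
  define q where "q = 1 - w"
  have q0: "q \<noteq> 0" using w by (simp add: q_def)
  define S where "S = closed_segment (of_nat n) (of_nat (n + 2) :: complex)"
  define f where "f = (\<lambda>i z. (\<Prod>j<i. q - of_nat j) * z powr (q - of_nat i))"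
  define B where "B = norm (q * (q - 1) * (q - 2)) * real n powr (Re q - 3)"
  have S: "z \<in> \<real>" "Re z \<ge> real n" if "z \<in> S" for z
  proof -
    have "z \<in> closed_segment (of_real (real n)) (of_real (real (n + 2)))" using that by (simp add: S_def)
    then obtain x where "z = of_real x" "x \<in> closed_segment (real n) (real (n + 2))"
      by (auto simp only: closed_segment_of_real)
    thus "z \<in> \<real>" "Re z \<ge> real n" by (auto simp: closed_segment_eq_real_ivl)
  qed
  have cvx: "convex S" by (simp add: S_def)
  have der: "(f i has_field_derivative f (Suc i) z) (at z within S)" if "z \<in> S" for i z
  proof -
    have "z \<notin> \<real>\<^sub>\<le>\<^sub>0" using S[OF that] n by (auto simp: complex_nonpos_Reals_iff)
    hence "(f i has_field_derivative (\<Prod>j<i. q - of_nat j) * ((q - of_nat i) * z powr (q - of_nat i - 1))) (at z within S)"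
      unfolding f_def by (rule has_field_derivative_at_within[OF DERIV_cmult[OF has_field_derivative_powr]])
    also have "(\<Prod>j<i. q - of_nat j) * ((q - of_nat i) * z powr (q - of_nat i - 1)) = f (Suc i) z"
    proof -
      have "q - of_nat i - 1 = q - of_nat (Suc i)" by simp
      thus ?thesis unfolding f_def prod.lessThan_Suc by (simp only: mult.assoc)
    qed
    finally show ?thesis .
  qed
  have f3: "norm (f (Suc 2) z) \<le> B" if "z \<in> S" for z
  proof -
    have "f (Suc 2) z = (q * (q - 1) * (q - 2)) * z powr (q - 3)"
      by (simp add: f_def numeral_2_eq_2)
    moreover have "norm (z powr (q - 3)) = Re z powr (Re q - 3)"
      using S[OF that] n by (subst norm_powr_real_powr) auto
    ultimately have "norm (f (Suc 2) z) = norm (q * (q - 1) * (q - 2)) * Re z powr (Re q - 3)"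
      by (simp only: norm_mult)
    also have "\<dots> \<le> B" unfolding B_def
      using S[OF that] n w by (intro mult_left_mono powr_mono2') (auto simp: q_def)
    finally show ?thesis .
  qed
  have mid: "of_nat (n + 1) \<in> S"
    unfolding S_def closed_segment_def by (auto intro!: exI[of _ "1/2"] simp: complex_eq_iff field_simps)
  have ends: "of_nat (n + 2) \<in> S" "of_nat n \<in> S" by (auto simp: S_def)
  define m where "m = (of_nat (n + 1) :: complex)"
  have T: "norm (f 0 (m + h) - (f 0 m + f 1 m * h + f 2 m * h\<^sup>2 / 2)) \<le> B / 2"
    if "m + h \<in> S" "norm h = 1" for h
  proof -
    have "norm (f 0 (m + h) - (\<Sum>i\<le>2. f i m * ((m + h) - m) ^ i / fact i)) \<le> B * norm ((m + h) - m) ^ Suc 2 / fact 2"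
      by (rule complex_Taylor[OF cvx]) (use der f3 mid that in \<open>auto simp: m_def\<close>)
    thus ?thesis using that by (simp add: numeral_2_eq_2)
  qed
  have h: "m + 1 = of_nat (n + 2)" "m + (-1) = of_nat n" by (simp_all add: m_def)
  have "norm ((f 0 (m + 1) - (f 0 m + f 1 m * 1 + f 2 m * 1\<^sup>2 / 2)) -
        (f 0 (m + (-1)) - (f 0 m + f 1 m * (-1) + f 2 m * (-1)\<^sup>2 / 2))) \<le> B / 2 + B / 2"
    by (rule order.trans[OF norm_triangle_ineq4 add_mono]; rule T) (use h ends in auto)
  also have "(f 0 (m + 1) - (f 0 m + f 1 m * 1 + f 2 m * 1\<^sup>2 / 2)) -
        (f 0 (m + (-1)) - (f 0 m + f 1 m * (-1) + f 2 m * (-1)\<^sup>2 / 2)) = f 0 (m + 1) - f 0 (m + (-1)) - 2 * f 1 m"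
    by simp
  also have "\<dots> = - (2 * q) * zeta_midpoint_term n w"
    using q0 unfolding h by (simp add: f_def zeta_midpoint_term_def m_def q_def field_simps)
  finally have "2 * norm q * norm (zeta_midpoint_term n w) \<le> B" by (simp add: norm_mult)
  also have "B = 2 * norm q * (norm w * norm (1 + w) / 2 * real n powr (- Re w - 2))"
  proof -
    have "q - 1 = - w" "q - 2 = - (1 + w)" "Re q - 3 = - Re w - 2" by (simp_all add: q_def)
    thus ?thesis unfolding B_def norm_mult by (simp only: norm_minus_cancel) simp
  qed
  finally show ?thesis using q0 by simp
qed

lemma
  defines "S \<equiv> {w. -1 < Re w} - {1}"
  shows holomorphic_zeta_midpoint: "zeta_midpoint holomorphic_on S"
    and summable_zeta_midpoint: "w \<in> S \<Longrightarrow> summable (\<lambda>n. zeta_midpoint_term n w)"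
proof -
  have opS: "open S" unfolding S_def by (intro open_Diff open_halfspace_Re_gt) auto
  have hol: "zeta_midpoint_term n holomorphic_on S" for n
  proof (cases "n = 0")
    case True
    have "(\<lambda>w. 1 powr (- w) - 2 powr (1 - w) / (2 * (1 - w))) holomorphic_on S"
      by (intro holomorphic_intros) (auto simp: S_def)
    thus ?thesis using True by (simp add: zeta_midpoint_term_def[abs_def])
  next
    case False
    have "of_nat k \<noteq> (0::complex)" if "k > 0" for k using that by simp
    thus ?thesis unfolding zeta_midpoint_term_def using False
      by (intro holomorphic_intros) (auto simp: S_def simp del: of_nat_Suc of_nat_add)
  qed
  have bnd: "\<exists>d>0. \<exists>M. summable M \<and> cball z d \<subseteq> S \<and>
       (\<forall>\<^sub>F n in sequentially. \<forall>w\<in>cball z d. norm (zeta_midpoint_term n w) \<le> M n)" if "z \<in> S" for z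
  proof -
    from opS that obtain e where e: "e > 0" "cball z e \<subseteq> S" by (auto simp: open_contains_cball)
    define d where "d = min e ((Re z + 1) / 2)"
    have d: "d > 0" "d \<le> e" using e that unfolding d_def by (auto simp: S_def)
    have d': "d \<le> (Re z + 1) / 2" unfolding d_def by (rule min.cobounded2)
    have sub: "cball z d \<subseteq> S" using d e by (meson order_trans subset_cball)
    define c where "c = (Re z + 1) / 2"
    have Re: "Re w \<ge> c - 1" if "w \<in> cball z d" for w
      using abs_Re_le_cmod[of "z - w"] that d' by (simp add: c_def dist_norm field_simps)
    define R where "R = norm z + d"
    have R: "norm w \<le> R" if "w \<in> cball z d" for w
      using that norm_triangle_ineq2[of w z] by (simp add: R_def dist_norm norm_minus_commute)
    have c0: "c > 0" using that by (simp add: c_def S_def)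
    show ?thesis
    proof (intro exI[of _ d] exI[of _ "\<lambda>n. R * (1 + R) / 2 * real n powr (- 1 - c)"] conjI)
      show "summable (\<lambda>n. R * (1 + R) / 2 * real n powr (- 1 - c))"
        using c0 by (intro summable_mult) (simp add: summable_real_powr_iff)
      show "\<forall>\<^sub>F n in sequentially. \<forall>w\<in>cball z d. norm (zeta_midpoint_term n w) \<le> R * (1 + R) / 2 * real n powr (- 1 - c)"
        using eventually_ge_at_top[of 1]
      proof (eventually_elim, intro ballI)
        fix n w assume n: "1 \<le> (n::nat)" and w: "w \<in> cball z d"
        have "norm (1 + w) \<le> 1 + R" using norm_triangle_ineq[of 1 w] R[OF w] by simp
        moreover have "norm (zeta_midpoint_term n w) \<le> norm w * norm (1 + w) / 2 * real n powr (- Re w - 2)"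
          using w sub n Re[OF w] c0 by (intro zeta_midpoint_term_bound) (auto simp: S_def)
        moreover have "real n powr (- Re w - 2) \<le> real n powr (- 1 - c)"
          using Re[OF w] n by (intro powr_mono) auto
        moreover have "R \<ge> 0" using R[OF w] norm_ge_zero order_trans by blast
        ultimately show "norm (zeta_midpoint_term n w) \<le> R * (1 + R) / 2 * real n powr (- 1 - c)"
          using R[OF w] by (elim order_trans) (intro mult_mono divide_right_mono, auto)
      qed
    qed (use d sub in auto)
  qed
  from holomorphic_on_suminf[OF opS hol bnd] 
  have 1: "(\<lambda>z. \<Sum>n. zeta_midpoint_term n z) holomorphic_on S" "w \<in> S \<Longrightarrow> summable (\<lambda>n. zeta_midpoint_term n w)" by blast+
  thus "w \<in> S \<Longrightarrow> summable (\<lambda>n. zeta_midpoint_term n w)" by simp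
  have "(\<lambda>w. 1 / (2 * (1 - w))) holomorphic_on S" by (intro holomorphic_intros) (auto simp: S_def)
  with 1(1) show "zeta_midpoint holomorphic_on S" unfolding zeta_midpoint_def[abs_def] by (intro holomorphic_on_diff)
qed

lemma zeta_midpoint_partial_sum:
  assumes "w \<noteq> 1"
  shows "(\<Sum>n<N. zeta_midpoint_term n w) - 1 / (2 * (1 - w)) =
     (\<Sum>n<N. of_nat (Suc n) powr (- w)) - (of_nat (N + 1) powr (1 - w) + of_nat N powr (1 - w)) / (2 * (1 - w))"
proof (induction N)
  case (Suc N)
  have "of_nat (Suc N + 1) = (of_nat (N + 2) :: complex)" "of_nat (Suc N) = (of_nat (N + 1) :: complex)" by simp_all
  thus ?case using Suc by (simp add: zeta_midpoint_term_def algebra_simps add_divide_distrib diff_divide_distrib)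
qed simp

lemma zeta_midpoint_tendsto:
  assumes "Re w > -1" "w \<noteq> 1"
  shows "(\<lambda>N. (\<Sum>n<N. of_nat (Suc n) powr (- w)) -
     (of_nat (N + 1) powr (1 - w) + of_nat N powr (1 - w)) / (2 * (1 - w))) \<longlonglongrightarrow> zeta_midpoint w"
proof -
  have "summable (\<lambda>n. zeta_midpoint_term n w)" using assms by (intro summable_zeta_midpoint) auto
  hence "(\<lambda>N. \<Sum>n<N. zeta_midpoint_term n w) \<longlonglongrightarrow> (\<Sum>n. zeta_midpoint_term n w)" by (rule summable_LIMSEQ)
  hence "(\<lambda>N. (\<Sum>n<N. zeta_midpoint_term n w) - 1 / (2 * (1 - w))) \<longlonglongrightarrow> zeta_midpoint w"
    unfolding zeta_midpoint_def by (intro tendsto_intros)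
  thus ?thesis unfolding zeta_midpoint_partial_sum[OF assms(2)] .
qed

lemma zeta_midpoint_eq_zeta_series:
  assumes "Re s > 1"
  shows "zeta_midpoint s = zeta_series s"
proof -
  have s: "s \<noteq> 1" "Re s > -1" using assms by auto
  have lim0: "(\<lambda>N. of_nat N powr (1 - s) :: complex) \<longlonglongrightarrow> 0"
  proof (rule tendsto_norm_zero_cancel)
    have "(\<lambda>N. real N powr Re (1 - s)) \<longlonglongrightarrow> 0"
      using assms by (intro tendsto_neg_powr filterlim_real_sequentially) auto
    thus "(\<lambda>N. norm (of_nat N powr (1 - s) :: complex)) \<longlonglongrightarrow> 0"
      by (simp add: norm_powr_real_powr)
  qed
  have "(\<lambda>N. (\<Sum>n<N. of_nat (Suc n) powr (- s)) -
     (of_nat (N + 1) powr (1 - s) + of_nat N powr (1 - s)) / (2 * (1 - s))) \<longlonglongrightarrow> zeta_series s - (0 + 0) / (2 * (1 - s))"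
    using summable_LIMSEQ[OF summable_zeta_series[OF assms]] lim0 LIMSEQ_ignore_initial_segment[OF lim0, of 1] s
    unfolding zeta_series_def by (intro tendsto_intros) auto
  with zeta_midpoint_tendsto[OF s(2,1)] show ?thesis using LIMSEQ_unique by fastforce
qed

text \<open>The right-hand side of the functional equation, which makes sense for \<open>Re w < 0\<close>.\<close>
definition zeta_reflected :: "complex \<Rightarrow> complex" where
  "zeta_reflected w = 2 * of_real (2 * pi) powr (w - 1) * sin (of_real pi * w / 2) * Gamma (1 - w) * zeta_series (1 - w)"

lemma holomorphic_zeta_reflected: "zeta_reflected holomorphic_on {w. Re w < 0}"
proof -
  have "(\<lambda>w. zeta_series (1 - w)) holomorphic_on {w. Re w < 0}"
  proof (rule holomorphic_on_compose_gen[of "\<lambda>w. 1 - w" _ zeta_series "{s. 1 < Re s}", unfolded o_def])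
    show "(\<lambda>w. 1 - w) holomorphic_on {w. Re w < 0}" by (intro holomorphic_intros)
  qed (use holomorphic_zeta_series in auto)
  moreover have "1 - w \<notin> \<int>\<^sub>\<le>\<^sub>0" if "Re w < 0" for w
    using that by (auto elim!: nonpos_Ints_cases simp: complex_eq_iff)
  ultimately show ?thesis unfolding zeta_reflected_def by (intro holomorphic_intros) auto
qed

text \<open>At \<open>w = - p\<close> the partial sums of the series for \<open>zeta_midpoint\<close> are the corrected sums whose
  limit is known.\<close>
lemma zeta_midpoint_eq_zeta_reflected_real:
  assumes p: "0 < p" "p < 1 / 2"
  shows "zeta_midpoint (of_real (- p)) = zeta_reflected (of_real (- p))"
proof -
  define L where "L = - (Gamma (p + 1) * dirichlet_zeta (p + 1) * (2 * pi) powr (- p) / (2 * mellin_const p))"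
  have "complex_of_real (zeta_corrected_sum p N) = (\<Sum>n<N. of_nat (Suc n) powr (- of_real (- p))) -
     (of_nat (N + 1) powr (1 - of_real (- p)) + of_nat N powr (1 - of_real (- p))) / (2 * (1 - of_real (- p)))" for N
  proof -
    have "of_nat k powr (complex_of_real x) = of_real (real k powr x)" for k x
      using powr_of_real[of "real k" x] by simp
    note pw = this this[of "Suc _", unfolded of_nat_Suc add.commute[of 1 "real _"]]
    have e: "- complex_of_real (- p) = of_real p" "1 - complex_of_real (- p) = of_real (p + 1)" by simp_all
    have "(\<Sum>n<N. of_nat (Suc n) powr (of_real p)) -
     (of_nat (N + 1) powr (of_real (p + 1)) + of_nat N powr (of_real (p + 1))) / (2 * of_real (p + 1)) =
      complex_of_real ((\<Sum>n<N. real (Suc n) powr p) - (real (N + 1) powr (p + 1) + real N powr (p + 1)) / (2 * (p + 1)))"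
      unfolding pw(1) by simp
    thus ?thesis unfolding e zeta_corrected_sum_def by (simp add: add_ac)
  qed
  moreover have "(\<lambda>N. complex_of_real (zeta_corrected_sum p N)) \<longlonglongrightarrow> of_real L"
    unfolding L_def by (intro tendsto_of_real zeta_corrected_sum_tendsto p)
  moreover have "Re (of_real (- p)) > -1" "complex_of_real (- p) \<noteq> 1" using p by (auto simp: complex_eq_iff)
  ultimately have "zeta_midpoint (of_real (- p)) = of_real L"
    by (intro LIMSEQ_unique[OF zeta_midpoint_tendsto[of "of_real (- p)"]]) (simp_all only: not_False_eq_True)
  also have "L = 2 * (2 * pi) powr (- p - 1) * sin (pi * (- p) / 2) * Gamma (1 + p) * dirichlet_zeta (1 + p)"
  proof -
    have "sin (pi * p / 2) > 0" using p by (intro sin_gt_zero) (auto simp: field_simps)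
    thus ?thesis by (simp add: L_def mellin_const_def powr_diff add.commute field_simps)
  qed
  also have "complex_of_real (2 * (2 * pi) powr (- p - 1) * sin (pi * (- p) / 2) * Gamma (1 + p) * dirichlet_zeta (1 + p)) =
     zeta_reflected (of_real (- p))"
  proof -
    have e: "complex_of_real (- p) - 1 = of_real (- p - 1)" "1 - complex_of_real (- p) = of_real (1 + p)"
      "complex_of_real pi * of_real (- p) / 2 = of_real (pi * (- p) / 2)" by simp_all
    have "complex_of_real (2 * pi) powr of_real (- p - 1) = of_real ((2 * pi) powr (- p - 1))"
      by (rule powr_of_real) simp_all
    thus ?thesis unfolding zeta_reflected_def e using p
      by (simp only: zeta_series_of_real Gamma_complex_of_real sin_of_real of_real_mult of_real_numeral)

  qed
  finally show ?thesis .
qed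

lemma zeta_midpoint_eq_zeta_reflected:
  assumes "-1 < Re w" "Re w < 0"
  shows "zeta_midpoint w = zeta_reflected w"
proof -
  define S where "S = {w. -1 < Re w} \<inter> {w. Re w < 0}"
  define U where "U = (\<lambda>p. complex_of_real (- p)) ` {0<..<1/2}"
  have "zeta_midpoint w - zeta_reflected w = 0"
  proof (rule analytic_continuation[of "\<lambda>w. zeta_midpoint w - zeta_reflected w" S U "of_real (- (1 / 4))"])
    show "(\<lambda>w. zeta_midpoint w - zeta_reflected w) holomorphic_on S"
      by (intro holomorphic_on_diff holomorphic_on_subset[OF holomorphic_zeta_midpoint] holomorphic_on_subset[OF holomorphic_zeta_reflected])
         (auto simp: S_def)
    show "open S" unfolding S_def by (intro open_Int open_halfspace_Re_gt open_halfspace_Re_lt)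
    show "connected S" unfolding S_def
      by (intro convex_connected convex_Int convex_halfspace_Re_gt convex_halfspace_Re_lt)
    show "U \<subseteq> S" by (auto simp: U_def S_def)
    show "complex_of_real (- (1 / 4)) \<in> S" by (simp add: S_def)
    show "complex_of_real (- (1 / 4)) islimpt U"
      unfolding islimpt_sequential
    proof (intro exI[of _ "\<lambda>n. complex_of_real (- (1 / 4 + 1 / (real n + 8)))"] conjI allI)
      show "complex_of_real (- (1 / 4 + 1 / (real n + 8))) \<in> U - {complex_of_real (- (1 / 4))}" for n
      proof -
        have "1 / (real n + 8) > 0" "1 / (real n + 8) < 1 / 4" by (simp_all add: field_simps)
        hence "1 / 4 + 1 / (real n + 8) \<in> {0<..<1/2}" "- (1 / 4 + 1 / (real n + 8)) \<noteq> - (1 / 4)"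
          unfolding greaterThanLessThan_iff by linarith+
        thus ?thesis unfolding U_def by (simp only: Diff_iff singleton_iff of_real_eq_iff) blast
      qed
      have "(\<lambda>n. - (1 / 4 + 1 / (real n + 8))) \<longlonglongrightarrow> - (1 / 4)" by real_asymp
      thus "(\<lambda>n. complex_of_real (- (1 / 4 + 1 / (real n + 8)))) \<longlonglongrightarrow> complex_of_real (- (1 / 4))"
        by (rule tendsto_of_real)
    qed
    show "zeta_midpoint z - zeta_reflected z = 0" if "z \<in> U" for z
      using that zeta_midpoint_eq_zeta_reflected_real by (auto simp: U_def)
    show "w \<in> S" using assms by (simp add: S_def)
  qed
  thus ?thesis by simp
qed

lemma one_over_Suc_powr: "1 / of_nat (Suc n) powr s = (of_nat (Suc n) powr (- s) :: complex)"
  by (rule powr_minus_divide[symmetric])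

text \<open>The function \<open>zeta_midpoint\<close> on \<open>Re w > -1\<close> and the function \<open>zeta_reflected\<close> on \<open>Re w < 0\<close> agree on
  the common strip and are glued together. Uniqueness of the continuation identifies the result with
  \<open>riemann_zeta\<close>.\<close>
lemma
  shows holomorphic_riemann_zeta: "riemann_zeta holomorphic_on - {1}"
    and riemann_zeta_eq_zeta_series: "\<And>s. Re s > 1 \<Longrightarrow> riemann_zeta s = zeta_series s"
    and riemann_zeta_functional_eq: "\<And>s. Re s < 0 \<Longrightarrow> riemann_zeta s = zeta_reflected s"
proof -
  define A where "A = {w. -1 < Re w} - {1 :: complex}"
  define B where "B = {w. Re w < 0}"
  define g where "g = (\<lambda>w. if w \<in> A then zeta_midpoint w else zeta_reflected w)"
  define f where "f = (\<lambda>w. if w = 1 then 0 else g w)"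
  have AB: "A \<union> B = - {1}" by (auto simp: A_def B_def)
  have "open A" "open B" unfolding A_def B_def by (intro open_Diff open_halfspace_Re_gt open_halfspace_Re_lt; auto)+
  hence "g holomorphic_on (A \<union> B)"
    unfolding g_def using holomorphic_zeta_midpoint holomorphic_zeta_reflected zeta_midpoint_eq_zeta_reflected
    by (intro holomorphic_on_If_Un) (auto simp: A_def B_def)
  hence hol: "f holomorphic_on - {1}"
    unfolding AB by (rule holomorphic_transform) (auto simp: f_def)
  have fD: "f s = zeta_series s" if "1 < Re s" for s
    using that zeta_midpoint_eq_zeta_series[OF that] by (auto simp: f_def g_def A_def)
  have fL: "f s = zeta_reflected s" if "Re s < 0" for s
    using that zeta_midpoint_eq_zeta_reflected[of s] by (auto simp: f_def g_def A_def)
  have "riemann_zeta = f"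
    unfolding riemann_zeta_def
  proof (rule the_equality)
    show "f holomorphic_on - {1} \<and> (\<forall>s. 1 < Re s \<longrightarrow> f s = (\<Sum>n. 1 / of_nat (Suc n) powr s)) \<and> f 1 = 0"
      using hol fD unfolding one_over_Suc_powr zeta_series_def by (auto simp: f_def)
    fix h assume h: "h holomorphic_on - {1} \<and> (\<forall>s. 1 < Re s \<longrightarrow> h s = (\<Sum>n. 1 / of_nat (Suc n) powr s)) \<and> h 1 = 0"
    show "h = f"
    proof
      fix w
      show "h w = f w"
      proof (cases "w = 1")
        case False
        show ?thesis
        proof (rule analytic_continuation_open[of "{s. 1 < Re s}" "- {1}" h f])
          show "connected (- {1 :: complex})" by (rule connected_punctured_universe) simp
          show "{s. 1 < Re s} \<noteq> {}" by (auto intro: exI[of _ 2])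
          show "h z = f z" if "z \<in> {s. 1 < Re s}" for z
            using h fD[of z] that unfolding one_over_Suc_powr zeta_series_def by auto
        qed (use h hol False in \<open>auto simp: open_halfspace_Re_gt\<close>)
      qed (use h in \<open>auto simp: f_def\<close>)
    qed
  qed
  with hol fD fL show "riemann_zeta holomorphic_on - {1}" "\<And>s. Re s > 1 \<Longrightarrow> riemann_zeta s = zeta_series s"
    "\<And>s. Re s < 0 \<Longrightarrow> riemann_zeta s = zeta_reflected s" by auto
qed

section \<open>The expansion for exponents slightly above \<open>\<mu> + \<nu> + 1\<close>\<close>

lemma bessel_prod_coeff_eq_moment:
  "bessel_prod_coeff \<mu> \<nu> m = (-1) ^ m * 16 ^ m / fact (2 * m) * bessel_moment \<mu> \<nu> (real (2 * m))"
proof -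
  have e: "1 + \<mu> + \<nu> + 2 * real m = 1 + \<mu> + \<nu> + real (2 * m)" "real (2 * m) / 2 = real m" by simp_all
  have "Gamma (1 + real (2 * m)) = fact (2 * m)" by (rule Gamma_fact)
  moreover have "rGamma (1 + real m) = 1 / fact m"
    by (simp add: rGamma_inverse_Gamma Gamma_fact divide_inverse)
  moreover have "4 powr real (2 * m) = (16::real) ^ m"
    by (subst powr_realpow) (simp_all add: power_mult)
  ultimately show ?thesis
    unfolding bessel_prod_coeff_def bessel_moment_def e by simp
qed

lemma sixteen_power_half: "(16::real) ^ m * (x / 2) ^ (2 * m) = (2 * x) ^ (2 * m)"
proof -
  have "16 * (x / 2)\<^sup>2 = (2 * x)\<^sup>2" by (simp add: power2_eq_square)
  thus ?thesis by (metis power_mult power_mult_distrib)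
qed

lemma has_bochner_integral_cmult:
  fixes f :: "'a \<Rightarrow> real"
  shows "has_bochner_integral M f x \<Longrightarrow> has_bochner_integral M (\<lambda>t. c * f t) (c * x)"
  by (rule has_bochner_integral_mult_right)

locale bessel_product_measure =
  fixes \<mu> \<nu> :: real and M :: "real measure"
  assumes mu: "\<mu> \<ge> 0" and nu: "\<nu> \<ge> 0"
    and moments: "moment_measure M (bessel_moment \<mu> \<nu>)" and less_one: "AE x in M. x < 1"
begin

lemma sets_M [measurable_cong]: "sets M = sets borel"
  using moments by (simp add: moment_measure_def)

lemma AE_M: "AE t in M. 0 < t \<and> t < 1"
  using moments less_one by (auto simp: moment_measure_def)

lemma moment_integral:
  assumes "p \<ge> 0"
  shows "has_bochner_integral M (\<lambda>t. t powr p) (bessel_moment \<mu> \<nu> p)"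
  using moment_measure_integrable[OF moments assms] moment_measure_integral[OF moments assms]
    bessel_moment_pos[OF mu nu assms] by (simp add: has_bochner_integral_iff)

lemma moment_integral_nat: "has_bochner_integral M (\<lambda>t. t ^ k) (bessel_moment \<mu> \<nu> (real k))"
proof -
  have AE: "AE t in M. t powr real k = t ^ k"
    using AE_M by eventually_elim (simp add: powr_realpow)
  have int: "has_bochner_integral M (\<lambda>t. t powr real k) (bessel_moment \<mu> \<nu> (real k))"
    by (rule moment_integral) simp
  have meas: "(\<lambda>t. t ^ k) \<in> borel_measurable M" "(\<lambda>t. t powr real k) \<in> borel_measurable M" by measurable
  have "integrable M (\<lambda>t. t ^ k)"
    using int by (intro integrable_cong_AE_imp[OF _ meas(1) AE]) (simp add: has_bochner_integral_iff)
  moreover have "(\<integral>t. t powr real k \<partial>M) = (\<integral>t. t ^ k \<partial>M)"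
    by (rule integral_cong_AE[OF meas(2,1) AE])
  ultimately show ?thesis using int by (simp add: has_bochner_integral_iff)
qed

lemma integrable_power_M: "integrable M (\<lambda>t. t ^ k)"
  and integral_power_M: "(\<integral>t. t ^ k \<partial>M) = bessel_moment \<mu> \<nu> (real k)"
  using moment_integral_nat[of k] by (auto simp: has_bochner_integral_iff)

lemma bessel_moment_le_mass: "bessel_moment \<mu> \<nu> (real k) \<le> bessel_moment \<mu> \<nu> 0"
proof -
  have "(\<integral>t. t ^ k \<partial>M) \<le> (\<integral>t. t ^ 0 \<partial>M)"
  proof (rule integral_mono_AE[OF integrable_power_M integrable_power_M])
    show "AE t in M. t ^ k \<le> t ^ 0" using AE_M by eventually_elim (simp add: power_le_one)
  qed
  thus ?thesis unfolding integral_power_M by simp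
qed

text \<open>Integrating the cosine series termwise produces the even moments, and hence the coefficients of the
  product.\<close>
lemma bessel_entire_prod_integral:
  "bessel_entire \<mu> ((x / 2)\<^sup>2) * bessel_entire \<nu> ((x / 2)\<^sup>2) = (\<integral>t. cos (2 * x * t) \<partial>M)"
proof -
  define f where "f = (\<lambda>m t. (-1) ^ m / fact (2 * m) * (2 * x * t) ^ (2 * m))"
  define c where "c = (\<lambda>m. (-1) ^ m / fact (2 * m) * (2 * x) ^ (2 * m) :: real)"
  have f: "has_bochner_integral M (f m) (c m * bessel_moment \<mu> \<nu> (real (2 * m)))" for m
  proof -
    have "f m = (\<lambda>t. c m * t ^ (2 * m))"
      by (rule ext) (simp only: f_def c_def power_mult_distrib mult.assoc)
    thus ?thesis using has_bochner_integral_cmult[OF moment_integral_nat[of "2 * m"], of "c m"] by (simp only:)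
  qed
  have "(\<lambda>m. integral\<^sup>L M (f m)) sums (\<integral>t. (\<Sum>m. f m t) \<partial>M)"
  proof (rule sums_integral)
    show "integrable M (f m)" for m using f by (auto simp: has_bochner_integral_iff)
    have expo: "summable (\<lambda>m. \<bar>y\<bar> ^ (2 * m) / fact (2 * m))" for y :: real
    proof -
      have "summable (\<lambda>k. \<bar>y\<bar> ^ k / fact k)"
        using summable_exp[of "\<bar>y\<bar>"] by (simp add: divide_inverse mult.commute)
      hence "summable ((\<lambda>k. \<bar>y\<bar> ^ k / fact k) \<circ> (\<lambda>m. 2 * m))"
        by (intro summable_reindex) (auto simp: inj_def)
      thus ?thesis by (simp add: o_def)
    qed
    show "AE t in M. summable (\<lambda>m. norm (f m t))"
    proof (intro always_eventually allI)
      fix t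
      have "norm (f m t) = \<bar>2 * x * t\<bar> ^ (2 * m) / fact (2 * m)" for m
        unfolding f_def by (simp only: real_norm_def abs_mult abs_divide power_abs) simp
      thus "summable (\<lambda>m. norm (f m t))" using expo[of "2 * x * t"] by (simp only:)
    qed
    show "summable (\<lambda>m. \<integral>t. norm (f m t) \<partial>M)"
    proof (rule summable_comparison_test_ev)
      show "summable (\<lambda>m. \<bar>2 * x\<bar> ^ (2 * m) / fact (2 * m) * bessel_moment \<mu> \<nu> 0)"
        using expo[of "2 * x"] by (rule summable_mult2)
      show "\<forall>\<^sub>F m in sequentially. norm (\<integral>t. norm (f m t) \<partial>M) \<le> \<bar>2 * x\<bar> ^ (2 * m) / fact (2 * m) * bessel_moment \<mu> \<nu> 0"
      proof (intro always_eventually allI)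
        fix m
        have "(\<lambda>t. norm (f m t)) = (\<lambda>t. \<bar>2 * x\<bar> ^ (2 * m) / fact (2 * m) * t ^ (2 * m))"
          unfolding f_def by (simp add: abs_mult power_abs power_mult_distrib) (simp add: power_mult)
        hence "(\<integral>t. norm (f m t) \<partial>M) = \<bar>2 * x\<bar> ^ (2 * m) / fact (2 * m) * bessel_moment \<mu> \<nu> (real (2 * m))"
          using moment_integral_nat[of "2 * m"] by (simp add: has_bochner_integral_iff)
        also have "\<dots> \<le> \<bar>2 * x\<bar> ^ (2 * m) / fact (2 * m) * bessel_moment \<mu> \<nu> 0"
          by (intro mult_left_mono bessel_moment_le_mass) auto
        finally show "norm (\<integral>t. norm (f m t) \<partial>M) \<le> \<bar>2 * x\<bar> ^ (2 * m) / fact (2 * m) * bessel_moment \<mu> \<nu> 0"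
          by (simp add: integral_nonneg_AE)
      qed
    qed
  qed
  also have "(\<integral>t. (\<Sum>m. f m t) \<partial>M) = (\<integral>t. cos (2 * x * t) \<partial>M)"
    unfolding f_def sums_unique[OF cos_paired, symmetric] ..
  also have "(\<lambda>m. integral\<^sup>L M (f m)) = (\<lambda>m. bessel_prod_coeff \<mu> \<nu> m * ((x / 2)\<^sup>2) ^ m)"
  proof
    fix m
    have "(16::real) ^ m * ((x / 2)\<^sup>2) ^ m = (2 * x) ^ (2 * m)"
      unfolding power_mult[symmetric] by (rule sixteen_power_half)
    moreover have "integral\<^sup>L M (f m) = c m * bessel_moment \<mu> \<nu> (real (2 * m))"
      using f[of m] by (simp add: has_bochner_integral_iff)
    ultimately show "integral\<^sup>L M (f m) = bessel_prod_coeff \<mu> \<nu> m * ((x / 2)\<^sup>2) ^ m"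
      unfolding bessel_prod_coeff_eq_moment c_def by simp
  qed
  finally show ?thesis
    using bessel_entire_prod_sums[OF mu nu, of "(x / 2)\<^sup>2"] sums_unique2 by blast
qed

end

definition schlomilch_term :: "real \<Rightarrow> real \<Rightarrow> real \<Rightarrow> nat \<Rightarrow> real" where
  "schlomilch_term \<mu> \<nu> a n = 2 powr (\<mu> + \<nu>) / a powr (\<mu> + \<nu>) *
     (bessel_J \<mu> (real (Suc n) * a) * bessel_J \<nu> (real (Suc n) * a))"

lemma schlomilch_term_eq:
  assumes "\<mu> \<ge> 0" "\<nu> \<ge> 0" "a > 0"
  shows "schlomilch_term \<mu> \<nu> a n = (real n + 1) powr (\<mu> + \<nu>) *
     (bessel_entire \<mu> ((((real n + 1) * a) / 2)\<^sup>2) * bessel_entire \<nu> ((((real n + 1) * a) / 2)\<^sup>2))"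
proof -
  define x where "x = (real n + 1) * a"
  have x: "x > 0" using assms by (simp add: x_def)
  have "bessel_J \<mu> x * bessel_J \<nu> x = (x / 2) powr (\<mu> + \<nu>) * (bessel_entire \<mu> ((x / 2)\<^sup>2) * bessel_entire \<nu> ((x / 2)\<^sup>2))"
    using assms x by (simp add: bessel_J_altdef powr_add)
  moreover have "2 powr (\<mu> + \<nu>) / a powr (\<mu> + \<nu>) * (x / 2) powr (\<mu> + \<nu>) = (real n + 1) powr (\<mu> + \<nu>)"
    using assms by (simp add: x_def powr_mult powr_divide)
  moreover have "real (Suc n) * a = x" by (simp add: x_def)
  ultimately show ?thesis unfolding schlomilch_term_def x_def[symmetric]
    by (metis (no_types, opaque_lifting) mult.assoc)
qed

context bessel_product_measure
begin

text \<open>The cosine series, and then its expansion in powers, are integrated against the measure. The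
  constant term of the power series appears separately, with the factor \<open>\<zeta>(p + 1)\<close>, so that the powers
  start at \<open>2\<close>.\<close>
lemma schlomilch_expansion_base:
  assumes p: "0 < p" "p < 1 / 2" and a: "0 < a" "a \<le> pi"
  shows "(\<lambda>n. schlomilch_term \<mu> \<nu> a n * (real n + 1) powr (- (\<mu> + \<nu> + p + 1))) sums
           (dirichlet_zeta (p + 1) * bessel_moment \<mu> \<nu> 0 - mellin_const p / Gamma (p + 1) *
             ((2 * a) powr p * bessel_moment \<mu> \<nu> p +
              (\<Sum>m. clausen_coeff p m * (2 * a) ^ (2 * m + 2) * bessel_moment \<mu> \<nu> (real (2 * m + 2)))))"
    and "summable (\<lambda>m. clausen_coeff p m * (2 * a) ^ (2 * m + 2) * bessel_moment \<mu> \<nu> (real (2 * m + 2)))"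
proof -
  interpret finite_measure M using moments by (simp add: moment_measure_def)
  define k where "k = mellin_const p / Gamma (p + 1)"
  have G: "Gamma (p + 1) > 0" using p by (simp add: Gamma_real_pos)
  have K: "mellin_const p > 0" using p by (intro mellin_const_pos) auto
  have k: "k > 0" using G K by (simp add: k_def)
  define W where "W = cosine_gap p"
  have W0: "W x \<ge> 0" for x
    unfolding W_def cosine_gap_def using p by (intro suminf_nonneg summable_cos_powr) auto
  have x: "0 \<le> 2 * a * t" "2 * a * t < 2 * pi" if "0 < t \<and> t < 1" for t
  proof -
    show "0 \<le> 2 * a * t" using that a by simp
    have "2 * a * t < 2 * a * 1" using that a by (intro mult_strict_left_mono) auto
    with a show "2 * a * t < 2 * pi" by linarith
  qed
  have m0: "has_bochner_integral M (\<lambda>t. 1) (bessel_moment \<mu> \<nu> 0)"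
    using moment_integral_nat[of 0] unfolding power_0 of_nat_0 .
  \<comment> \<open>The power series in the Clausen-type expansion may be integrated termwise because all its terms have the same sign.\<close>
  define h where "h = (\<lambda>m t. - (clausen_coeff p m * (2 * a * t) ^ (2 * m + 2)))"
  have hint: "has_bochner_integral M (h m) (- (clausen_coeff p m * (2 * a) ^ (2 * m + 2) * bessel_moment \<mu> \<nu> (real (2 * m + 2))))" for m
    using has_bochner_integral_cmult[OF moment_integral_nat[of "2 * m + 2"], of "- (clausen_coeff p m * (2 * a) ^ (2 * m + 2))"]
    by (simp add: h_def power_mult_distrib mult_ac)
  have hnn: "h m t \<ge> 0" for m t
  proof -
    have "clausen_coeff p m * (2 * a * t) ^ (2 * m + 2) \<le> 0"
      using p by (intro mult_nonpos_nonneg clausen_coeff_nonpos zero_le_even_power) auto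
    thus ?thesis by (simp add: h_def)
  qed
  have hsums: "AE t in M. (\<lambda>m. h m t) sums ((2 * a * t) powr p - W (2 * a * t) / k)"
    using AE_M
  proof eventually_elim
    case (elim t)
    have "Gamma (p + 1) / mellin_const p * W (2 * a * t) = W (2 * a * t) / k" by (simp add: k_def)
    moreover note sums_minus[OF clausen_expansion[OF p x[OF elim]]]
    ultimately show ?case by (simp add: h_def W_def)
  qed
  have hle: "AE t in M. (\<Sum>m<N. h m t) \<le> (2 * a) powr p * t powr p" for N
    using hsums
  proof eventually_elim
    case (elim t)
    have "(\<Sum>m<N. h m t) \<le> (2 * a * t) powr p - W (2 * a * t) / k"
      using sum_le_suminf[OF sums_summable[OF elim], of "{..<N}"] hnn sums_unique[OF elim] by simp
    also have "\<dots> \<le> (2 * a * t) powr p" using W0 k by simp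
    finally show ?case by (simp add: powr_mult)
  qed
  have hsummable: "summable (\<lambda>m. integral\<^sup>L M (h m))"
  proof (rule bounded_imp_summable)
    show "integral\<^sup>L M (h m) \<ge> 0" for m using hnn by (intro integral_nonneg_AE) auto
    fix N
    have "(\<Sum>m\<le>N. integral\<^sup>L M (h m)) = (\<integral>t. (\<Sum>m<Suc N. h m t) \<partial>M)"
      using hint by (subst Bochner_Integration.integral_sum) (auto simp: has_bochner_integral_iff lessThan_Suc_atMost)
    also have "\<dots> \<le> (\<integral>t. (2 * a) powr p * t powr p \<partial>M)"
      using hle[of "Suc N"] hint moment_integral[of p] p
      by (intro integral_mono_AE integrable_mult_right Bochner_Integration.integrable_sum) (auto simp: has_bochner_integral_iff)
    finally show "(\<Sum>m\<le>N. integral\<^sup>L M (h m)) \<le> (\<integral>t. (2 * a) powr p * t powr p \<partial>M)" .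
  qed
  define X where "X = (\<Sum>m. clausen_coeff p m * (2 * a) ^ (2 * m + 2) * bessel_moment \<mu> \<nu> (real (2 * m + 2)))"
  have hI: "integral\<^sup>L M (h m) = - (clausen_coeff p m * (2 * a) ^ (2 * m + 2) * bessel_moment \<mu> \<nu> (real (2 * m + 2)))" for m
    using hint[of m] by (simp add: has_bochner_integral_iff)
  show sumX: "summable (\<lambda>m. clausen_coeff p m * (2 * a) ^ (2 * m + 2) * bessel_moment \<mu> \<nu> (real (2 * m + 2)))"
    using summable_minus[OF hsummable] by (simp add: hI)
  have hassm: "integrable M (h m)" "AE t in M. summable (\<lambda>m. norm (h m t))" "summable (\<lambda>m. \<integral>t. norm (h m t) \<partial>M)" for m
  proof -
    show "integrable M (h m)" using hint by (auto simp: has_bochner_integral_iff)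
    show "AE t in M. summable (\<lambda>m. norm (h m t))"
      using hsums by eventually_elim (use hnn in \<open>auto simp: sums_iff\<close>)
    show "summable (\<lambda>m. \<integral>t. norm (h m t) \<partial>M)" using hsummable hnn by simp
  qed
  have H: "has_bochner_integral M (\<lambda>t. \<Sum>m. h m t) (- X)"
  proof -
    have "(\<integral>t. (\<Sum>m. h m t) \<partial>M) = - X"
      using integral_suminf[OF hassm] suminf_minus[OF sumX] by (simp add: hI X_def)
    thus ?thesis using integrable_suminf[OF hassm] by (simp add: has_bochner_integral_iff)
  qed
  have WI: "has_bochner_integral M (\<lambda>t. k * ((2 * a) powr p * t powr p - (\<Sum>m. h m t)))
      (k * ((2 * a) powr p * bessel_moment \<mu> \<nu> p - (- X)))"
    using H moment_integral[of p] p by (intro has_bochner_integral_cmult has_bochner_integral_diff) auto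
  define f where "f = (\<lambda>n t. cos ((real n + 1) * (2 * a * t)) * (real n + 1) powr (- (p + 1)))"
  have fint: "integrable M (f n)" for n
    unfolding f_def by (rule integrable_const_bound[of _ "(real n + 1) powr (- (p + 1))"])
      (auto simp: abs_mult intro!: mult_left_le_one_le)
  have sm: "summable (\<lambda>n. (real n + 1) powr (- (p + 1)))" using p by (intro summable_real_powr) auto
  have fle: "norm (f n t) \<le> (real n + 1) powr (- (p + 1))" for n t
    by (auto simp: f_def abs_mult intro!: mult_left_le_one_le)
  have "(\<lambda>n. integral\<^sup>L M (f n)) sums (\<integral>t. (\<Sum>n. f n t) \<partial>M)"
  proof (rule sums_integral[OF fint])
    show "AE t in M. summable (\<lambda>n. norm (f n t))"
      using fle sm by (intro always_eventually allI summable_comparison_test_ev[OF _ sm]) auto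
    show "summable (\<lambda>n. \<integral>t. norm (f n t) \<partial>M)"
    proof (rule summable_comparison_test_ev)
      show "summable (\<lambda>n. (real n + 1) powr (- (p + 1)) * bessel_moment \<mu> \<nu> 0)" using sm by (rule summable_mult2)
      show "\<forall>\<^sub>F n in sequentially. norm (\<integral>t. norm (f n t) \<partial>M) \<le> (real n + 1) powr (- (p + 1)) * bessel_moment \<mu> \<nu> 0"
      proof (intro always_eventually allI)
        fix n
        have "(\<integral>t. norm (f n t) \<partial>M) \<le> (\<integral>t. (real n + 1) powr (- (p + 1)) * 1 \<partial>M)"
          using fle fint m0 by (intro integral_mono integrable_norm integrable_mult_right) (auto simp: has_bochner_integral_iff)
        also have "\<dots> = (real n + 1) powr (- (p + 1)) * bessel_moment \<mu> \<nu> 0"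
          using has_bochner_integral_cmult[OF m0, of "(real n + 1) powr (- (p + 1))"] by (simp only: has_bochner_integral_iff)
        finally show "norm (\<integral>t. norm (f n t) \<partial>M) \<le> (real n + 1) powr (- (p + 1)) * bessel_moment \<mu> \<nu> 0"
          by (simp add: integral_nonneg_AE)
      qed
    qed
  qed
  also have "(\<integral>t. (\<Sum>n. f n t) \<partial>M) = (\<integral>t. dirichlet_zeta (p + 1) - k * ((2 * a) powr p * t powr p - (\<Sum>m. h m t)) \<partial>M)"
  proof (rule integral_cong_AE)
    show "AE t in M. (\<Sum>n. f n t) = dirichlet_zeta (p + 1) - k * ((2 * a) powr p * t powr p - (\<Sum>m. h m t))"
      using hsums
    proof eventually_elim
      case (elim t)
      have "(\<lambda>n. (real n + 1) powr (- (p + 1)) - (1 - cos ((real n + 1) * (2 * a * t))) / (real n + 1) powr (p + 1))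
          sums (dirichlet_zeta (p + 1) - W (2 * a * t))"
        unfolding W_def cosine_gap_def using p by (intro sums_diff dirichlet_zeta_sums summable_sums summable_cos_powr) auto
      moreover have "(real n + 1) powr (- (p + 1)) - (1 - cos ((real n + 1) * (2 * a * t))) / (real n + 1) powr (p + 1) = f n t" for n
        unfolding f_def powr_minus_divide by (simp add: diff_divide_distrib)
      ultimately have "(\<lambda>n. f n t) sums (dirichlet_zeta (p + 1) - W (2 * a * t))" by (simp only:)
      hence "(\<Sum>n. f n t) = dirichlet_zeta (p + 1) - W (2 * a * t)" by (rule sums_unique[symmetric])
      also have "W (2 * a * t) = k * ((2 * a) powr p * t powr p - (\<Sum>m. h m t))"
      proof -
        have "(\<Sum>m. h m t) = (2 * a) powr p * t powr p - W (2 * a * t) / k"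
          unfolding powr_mult[symmetric] using sums_unique[OF elim] by (simp only:)
        thus ?thesis using k by simp
      qed
      finally show ?case .
    qed
    show "(\<lambda>t. \<Sum>n. f n t) \<in> borel_measurable M" 
      by (rule borel_measurable_suminf[OF borel_measurable_integrable[OF fint]])
    show "(\<lambda>t. dirichlet_zeta (p + 1) - k * ((2 * a) powr p * t powr p - (\<Sum>m. h m t))) \<in> borel_measurable M"
      by (rule borel_measurable_diff[OF borel_measurable_const borel_measurable_has_bochner_integral[OF WI]])
  qed
  also have "\<dots> = dirichlet_zeta (p + 1) * bessel_moment \<mu> \<nu> 0 - k * ((2 * a) powr p * bessel_moment \<mu> \<nu> p - (- X))"
    using has_bochner_integral_diff[OF has_bochner_integral_cmult[OF m0, of "dirichlet_zeta (p + 1)"] WI]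
    by (simp add: has_bochner_integral_iff)
  finally have "(\<lambda>n. integral\<^sup>L M (f n)) sums (dirichlet_zeta (p + 1) * bessel_moment \<mu> \<nu> 0 - k * ((2 * a) powr p * bessel_moment \<mu> \<nu> p + X))"
    by simp
  moreover have "integral\<^sup>L M (f n) = schlomilch_term \<mu> \<nu> a n * (real n + 1) powr (- (\<mu> + \<nu> + p + 1))" for n
  proof -
    have "integral\<^sup>L M (f n) = (\<integral>t. cos (2 * ((real n + 1) * a) * t) \<partial>M) * (real n + 1) powr (- (p + 1))"
      unfolding f_def by (simp add: mult_ac)
    moreover have "(real n + 1) powr (\<mu> + \<nu>) * (real n + 1) powr (- (\<mu> + \<nu> + p + 1)) = (real n + 1) powr (- (p + 1))"
      by (simp flip: powr_add)
    ultimately show ?thesis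
      using a mu nu by (simp add: schlomilch_term_eq bessel_entire_prod_integral mult_ac)
  qed
  ultimately show "(\<lambda>n. schlomilch_term \<mu> \<nu> a n * (real n + 1) powr (- (\<mu> + \<nu> + p + 1))) sums
           (dirichlet_zeta (p + 1) * bessel_moment \<mu> \<nu> 0 - mellin_const p / Gamma (p + 1) *
             ((2 * a) powr p * bessel_moment \<mu> \<nu> p +
              (\<Sum>m. clausen_coeff p m * (2 * a) ^ (2 * m + 2) * bessel_moment \<mu> \<nu> (real (2 * m + 2)))))"
    by (simp add: k_def X_def)
qed

end

lemma riemann_zeta_of_real_gt_1: "s > 1 \<Longrightarrow> riemann_zeta (of_real s) = of_real (dirichlet_zeta s)"
  by (simp add: riemann_zeta_eq_zeta_series zeta_series_of_real)

text \<open>The functional equation at \<open>w = p + 1 - k\<close> with \<open>k = 2 m + 2\<close>. The binomial coefficient in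
  \<open>clausen_coeff\<close> is \<open>\<Gamma>(k - p) / (\<Gamma>(- p) k!)\<close>, and the reflection formula for \<open>\<Gamma>(- p)\<close> supplies the
  remaining trigonometric factor.\<close>
lemma riemann_zeta_clausen_coeff:
  assumes p: "0 < p" "p < 1 / 2"
  shows "(-1) ^ Suc m / fact (2 * m + 2) * riemann_zeta (of_real (p + 1 - real (2 * m + 2))) =
           complex_of_real (- (mellin_const p / Gamma (p + 1)) * clausen_coeff p m)"
proof -
  define k where "k = 2 * m + 2"
  define w where "w = p + 1 - real k"
  have w0: "w < 0" using p by (simp add: w_def k_def)
  have e: "1 - w = real k - p" by (simp add: w_def)
  have kp: "real k - p > 1" using p by (simp add: k_def)
  have "riemann_zeta (of_real w) = zeta_reflected (of_real w)" using w0 by (intro riemann_zeta_functional_eq) simp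
  also have "\<dots> = of_real (2 * (2 * pi) powr (w - 1) * sin (pi * w / 2) * Gamma (1 - w) * dirichlet_zeta (1 - w))"
  proof -
    have e: "complex_of_real w - 1 = of_real (w - 1)" "1 - complex_of_real w = of_real (1 - w)"
      "complex_of_real pi * of_real w / 2 = of_real (pi * w / 2)" by simp_all
    have "complex_of_real (2 * pi) powr of_real (w - 1) = of_real ((2 * pi) powr (w - 1))"
      by (rule powr_of_real) simp_all
    moreover have "zeta_series (of_real (1 - w)) = of_real (dirichlet_zeta (1 - w))"
      using w0 by (intro zeta_series_of_real) simp
    ultimately show ?thesis unfolding zeta_reflected_def e
      by (simp only: Gamma_complex_of_real sin_of_real of_real_mult of_real_numeral)
  qed
  finally have zeta: "riemann_zeta (of_real w) = of_real (2 * (2 * pi) powr (p - real k) * sin (pi * w / 2) * Gamma (real k - p) * dirichlet_zeta (real k - p))"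
    by (simp add: w_def)
  have sn: "sin (pi * w / 2) = (-1) ^ Suc m * cos (pi * p / 2)"
  proof -
    have "pi * w / 2 = (pi * p / 2 + pi / 2) - real (Suc m) * pi" by (simp add: w_def k_def field_simps)
    also have "sin \<dots> = (-1) ^ Suc m * sin (pi * p / 2 + pi / 2)"
      by (simp add: sin_diff cos_npi sin_npi mult.commute del: of_nat_Suc)
    also have "sin (pi * p / 2 + pi / 2) = cos (pi * p / 2)" by (simp add: sin_add)
    finally show ?thesis .
  qed
  have npi: "- p \<notin> \<int>\<^sub>\<le>\<^sub>0"
  proof
    assume "- p \<in> \<int>\<^sub>\<le>\<^sub>0"
    then obtain n where "- p = - real n" by (auto elim!: nonpos_Ints_cases')
    thus False using p by (cases n) auto
  qed
  have gb: "(p gchoose k) = Gamma (real k - p) / (Gamma (- p) * fact k)"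
    unfolding gbinomial_pochhammer pochhammer_Gamma[OF npi] by (simp add: k_def)
  have refl: "Gamma (- p) * Gamma (p + 1) = - pi / sin (pi * p)"
    using Gamma_reflection_real[of "- p"] by (simp add: add.commute)
  have s2: "sin (pi * p) = 2 * sin (pi * p / 2) * cos (pi * p / 2)"
    using sin_double[of "pi * p / 2"] by simp
  have spos: "sin (pi * p / 2) > 0" using p by (intro sin_gt_zero) (auto simp: field_simps)
  have cpos: "cos (pi * p / 2) > 0" using p by (intro cos_gt_zero) (auto simp: field_simps)
  have G0: "Gamma (- p) \<noteq> 0" "Gamma (p + 1) > 0" using npi p by (auto simp: Gamma_eq_zero_iff Gamma_real_pos)
  have key: "cos (pi * p / 2) = - (mellin_const p / Gamma (p + 1)) / Gamma (- p)"
  proof -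
    have "- (mellin_const p / Gamma (p + 1)) / Gamma (- p) = - mellin_const p / (Gamma (- p) * Gamma (p + 1))"
      by simp
    also have "\<dots> = cos (pi * p / 2)"
      unfolding refl s2 mellin_const_def using spos cpos by (simp add: field_simps)
    finally show ?thesis ..
  qed
  have sgn: "(-1) ^ Suc m * (-1) ^ Suc m = (1::real)" by (simp flip: power_add power_mult_distrib)
  have "(-1) ^ Suc m / fact k * (2 * (2 * pi) powr (p - real k) * sin (pi * w / 2) * Gamma (real k - p) * dirichlet_zeta (real k - p))
     = ((-1) ^ Suc m * (-1) ^ Suc m) * (cos (pi * p / 2) * (Gamma (real k - p) / fact k)) * (2 * (2 * pi) powr (p - real k) * dirichlet_zeta (real k - p))"
    unfolding sn by simp
  also have "cos (pi * p / 2) * (Gamma (real k - p) / fact k) = - (mellin_const p / Gamma (p + 1)) * (p gchoose k)"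
    unfolding key gb by simp
  also have "((-1) ^ Suc m * (-1) ^ Suc m) * (- (mellin_const p / Gamma (p + 1)) * (p gchoose k)) * (2 * (2 * pi) powr (p - real k) * dirichlet_zeta (real k - p))
     = - (mellin_const p / Gamma (p + 1)) * clausen_coeff p m"
    unfolding sgn clausen_coeff_def k_def[symmetric] by simp
  finally have "complex_of_real ((-1) ^ Suc m / fact k * (2 * (2 * pi) powr (p - real k) * sin (pi * w / 2) * Gamma (real k - p) * dirichlet_zeta (real k - p)))
     = of_real (- (mellin_const p / Gamma (p + 1)) * clausen_coeff p m)" by simp
  moreover have "(-1) ^ Suc m / fact k * riemann_zeta (of_real w) =
    complex_of_real ((-1) ^ Suc m / fact k * (2 * (2 * pi) powr (p - real k) * sin (pi * w / 2) * Gamma (real k - p) * dirichlet_zeta (real k - p)))"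
    unfolding zeta by simp
  ultimately show ?thesis by (simp only: k_def w_def)
qed

lemma coeff_A_eq:
  "coeff_A \<alpha> \<mu> \<nu> m = of_real (bessel_prod_coeff \<mu> \<nu> m) * riemann_zeta (of_real (\<alpha> - \<mu> - \<nu> - 2 * real m))"
  unfolding coeff_A_def bessel_prod_coeff_def by simp

text \<open>With \<open>\<theta> = p + 1\<close> the Gamma factors of \<open>Fhat1\<close> are those of the \<open>p\<close>-th moment, except for
  \<open>\<Gamma>(- p / 2)\<close>, which the reflection formula converts into a multiple of
  \<open>mellin_const p / \<Gamma>(1 + p / 2)\<close>.\<close>
lemma Fhat1_eq_moment:
  assumes p: "0 < p" "p < 1 / 2" and a: "a > 0" and mn: "\<mu> \<ge> 0" "\<nu> \<ge> 0"
  shows "Fhat1 (\<mu> + \<nu> + p + 1) \<mu> \<nu> a = - (mellin_const p / Gamma (p + 1)) * ((2 * a) powr p * bessel_moment \<mu> \<nu> p)"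
proof -
  define G where "G = Gamma (- p / 2)"
  define R where "R = rGamma (1 + p / 2)"
  have e: "\<mu> + \<nu> + p + 1 - \<mu> - \<nu> - 1 = p"
    "\<mu> / 2 + \<nu> / 2 + 1 / 2 - (\<mu> + \<nu> + p + 1) / 2 = - p / 2"
    "(\<mu> + \<nu> + p + 1) / 2 + \<mu> / 2 - \<nu> / 2 + 1 / 2 = 1 + \<mu> + p / 2"
    "(\<mu> + \<nu> + p + 1) / 2 + \<mu> / 2 + \<nu> / 2 + 1 / 2 = 1 + \<mu> + \<nu> + p / 2"
    "(\<mu> + \<nu> + p + 1) / 2 + \<nu> / 2 - \<mu> / 2 + 1 / 2 = 1 + \<nu> + p / 2"
    by (simp_all add: field_simps)
  have spos: "sin (pi * p / 2) > 0" using p by (intro sin_gt_zero) (auto simp: field_simps)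
  have "Gamma (1 + p / 2) > 0" using p by (intro Gamma_real_pos) simp
  moreover have "Gamma (- p / 2) * Gamma (1 + p / 2) = - pi / sin (pi * p / 2)"
    using Gamma_reflection_real[of "- p / 2"] by simp
  ultimately have G: "G / 2 = - mellin_const p * R"
    using spos by (simp add: G_def R_def mellin_const_def rGamma_inverse_Gamma field_simps)
  have a4: "(a / 2) powr p = (2 * a) powr p / 4 powr p"
    using a by (simp flip: powr_divide)
  have G1: "Gamma (p + 1) > 0" using p by (simp add: Gamma_real_pos)
  have "Fhat1 (\<mu> + \<nu> + p + 1) \<mu> \<nu> a = (a / 2) powr p * Gamma (1 + \<mu> + \<nu> + p) * (G / 2) *
     rGamma (1 + \<mu> + p / 2) * rGamma (1 + \<mu> + \<nu> + p / 2) * rGamma (1 + \<nu> + p / 2)"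
    unfolding Fhat1_def e G_def by (simp add: add_ac)
  also have "\<dots> = - (mellin_const p / Gamma (p + 1)) * ((2 * a) powr p * bessel_moment \<mu> \<nu> p)"
    unfolding G a4 bessel_moment_def R_def[symmetric] using G1 by (simp add: add.commute[of 1 p])
  finally show ?thesis .
qed

lemma schlomilch_expansion_near_boundary:
  assumes p: "0 < p" "p < 1 / 2" and a: "0 < a" "a \<le> pi" and mn: "\<mu> \<ge> 0" "\<nu> \<ge> 0"
  defines "\<alpha> \<equiv> \<mu> + \<nu> + p + 1"
  shows "(\<Sum>n. complex_of_real (schlomilch_term \<mu> \<nu> a n) * of_nat (Suc n) powr (- of_real \<alpha>)) =
           of_real (Fhat1 \<alpha> \<mu> \<nu> a) + (\<Sum>m. coeff_A \<alpha> \<mu> \<nu> m * of_real ((a / 2) ^ (2 * m)))"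
proof -
  from bessel_moment_measure[OF mn] obtain M where M: "moment_measure M (bessel_moment \<mu> \<nu>)" "AE x in M. x < 1"
    by blast
  interpret bessel_product_measure \<mu> \<nu> M by standard (use M mn in auto)
  define k where "k = mellin_const p / Gamma (p + 1)"
  define X where "X = (\<lambda>m. clausen_coeff p m * (2 * a) ^ (2 * m + 2) * bessel_moment \<mu> \<nu> (real (2 * m + 2)))"
  define A where "A = (\<lambda>m. coeff_A \<alpha> \<mu> \<nu> m * of_real ((a / 2) ^ (2 * m)))"
  have A: "A m = of_real ((2 * a) ^ (2 * m) * bessel_moment \<mu> \<nu> (real (2 * m))) *
      ((-1) ^ m / fact (2 * m) * riemann_zeta (of_real (p + 1 - real (2 * m))))" for m
  proof -
    have "(16::real) ^ m * (a / 2) ^ (2 * m) = (2 * a) ^ (2 * m)" by (rule sixteen_power_half)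
    hence "bessel_prod_coeff \<mu> \<nu> m * (a / 2) ^ (2 * m) =
       (2 * a) ^ (2 * m) * bessel_moment \<mu> \<nu> (real (2 * m)) * ((-1) ^ m / fact (2 * m))"
      unfolding bessel_prod_coeff_eq_moment by simp
    moreover have "A m = of_real (bessel_prod_coeff \<mu> \<nu> m * (a / 2) ^ (2 * m)) * riemann_zeta (of_real (p + 1 - real (2 * m)))"
      unfolding A_def coeff_A_eq \<alpha>_def by simp
    ultimately show ?thesis by simp
  qed
  have A0: "A 0 = of_real (dirichlet_zeta (p + 1) * bessel_moment \<mu> \<nu> 0)"
    unfolding A using riemann_zeta_of_real_gt_1[of "p + 1"] p by simp
  have AS: "A (Suc m) = of_real (- k * X m)" for m
  proof -
    have "2 * Suc m = 2 * m + 2" by simp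
    thus ?thesis unfolding A X_def k_def using riemann_zeta_clausen_coeff[OF p, of m] by (simp only:) simp
  qed
  have "summable X" unfolding X_def by (rule schlomilch_expansion_base(2)[OF p a])
  hence "(\<lambda>m. - k * X m) sums (- k * suminf X)" by (intro sums_mult summable_sums)
  hence "(\<lambda>m. A (Suc m)) sums of_real (- k * suminf X)" unfolding AS by (simp only: sums_of_real_iff)
  hence "A sums (of_real (- k * suminf X) + A 0)" by (rule sums_Suc)
  hence sumA: "suminf A = of_real (- k * suminf X) + A 0" by (rule sums_unique[symmetric])
  have "(\<lambda>n. schlomilch_term \<mu> \<nu> a n * (real n + 1) powr (- \<alpha>)) sums
      (dirichlet_zeta (p + 1) * bessel_moment \<mu> \<nu> 0 - k * ((2 * a) powr p * bessel_moment \<mu> \<nu> p + suminf X))"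
    unfolding \<alpha>_def X_def k_def by (rule schlomilch_expansion_base(1)[OF p a])
  hence "(\<lambda>n. complex_of_real (schlomilch_term \<mu> \<nu> a n * (real n + 1) powr (- \<alpha>))) sums
      of_real (dirichlet_zeta (p + 1) * bessel_moment \<mu> \<nu> 0 - k * ((2 * a) powr p * bessel_moment \<mu> \<nu> p + suminf X))"
    by (simp only: sums_of_real_iff)
  moreover have "complex_of_real (schlomilch_term \<mu> \<nu> a n * (real n + 1) powr (- \<alpha>)) =
     complex_of_real (schlomilch_term \<mu> \<nu> a n) * of_nat (Suc n) powr (- of_real \<alpha>)" for n
    using powr_of_real[of "real n + 1" "- \<alpha>"] by (simp add: add_ac)
  ultimately have "(\<Sum>n. complex_of_real (schlomilch_term \<mu> \<nu> a n) * of_nat (Suc n) powr (- of_real \<alpha>)) =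
     of_real (dirichlet_zeta (p + 1) * bessel_moment \<mu> \<nu> 0 - k * ((2 * a) powr p * bessel_moment \<mu> \<nu> p + suminf X))"
    by (simp only: sums_unique[symmetric])
  also have "\<dots> = of_real (- k * ((2 * a) powr p * bessel_moment \<mu> \<nu> p)) + (of_real (- k * suminf X) + A 0)"
    unfolding A0 by (simp add: algebra_simps)
  also have "- k * ((2 * a) powr p * bessel_moment \<mu> \<nu> p) = Fhat1 \<alpha> \<mu> \<nu> a"
    unfolding \<alpha>_def k_def by (rule Fhat1_eq_moment[OF p a(1) mn, symmetric])
  finally show ?thesis unfolding sumA[symmetric] unfolding A_def .
qed

text \<open>Raabe's test: the quotient of consecutive terms is a rational function of \<open>m\<close>, and the limit that the
  test asks for is \<open>1 + \<delta>\<close>. The terms are of order \<open>m powr (- 1 - \<delta>)\<close>, so that \<open>\<delta> > 0\<close> is essential.\<close>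
lemma summable_coeff_majorant:
  assumes mn: "\<mu> \<ge> 0" "\<nu> \<ge> 0" and \<delta>: "0 < \<delta>" "\<delta> \<le> 1 / 2"
  shows "summable (\<lambda>m. \<bar>bessel_prod_coeff \<mu> \<nu> m\<bar> * Gamma (1 + \<mu> + \<nu> - \<delta> + 2 * real m) / 16 ^ m)"
proof -
  define s where "s = \<mu> + \<nu>"
  have s0: "s \<ge> 0" using mn by (simp add: s_def)
  define f where "f = (\<lambda>m. \<bar>bessel_prod_coeff \<mu> \<nu> m\<bar> * Gamma (1 + s - \<delta> + 2 * real m) / 16 ^ m)"
  have f_eq: "(\<lambda>m. \<bar>bessel_prod_coeff \<mu> \<nu> m\<bar> * Gamma (1 + \<mu> + \<nu> - \<delta> + 2 * real m) / 16 ^ m) = f"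
    by (simp add: f_def s_def add.assoc)
  define u where "u = (\<lambda>m. (1 + s + 2 * m) * (2 + s + 2 * m) * (1 + s - \<delta> + 2 * m) * (2 + s - \<delta> + 2 * m) :: real)"
  define v where "v = (\<lambda>m. 16 * (m + 1) * (1 + \<mu> + m) * (1 + \<nu> + m) * (1 + s + m) :: real)"
  have Gp: "Gamma x > 0" if "x > 0" for x :: real using that by (rule Gamma_real_pos)
  have e: "1 + \<mu> + \<nu> + y = 1 + s + y" for y by (simp add: s_def)
  have abs: "\<bar>bessel_prod_coeff \<mu> \<nu> m\<bar> = Gamma (1 + s + 2 * real m) /
     (fact m * Gamma (1 + \<mu> + real m) * Gamma (1 + \<nu> + real m) * Gamma (1 + s + real m))" for m
  proof -
    have "Gamma (1 + s + 2 * real m) > 0" "Gamma (1 + \<mu> + real m) > 0" "Gamma (1 + \<nu> + real m) > 0" "Gamma (1 + s + real m) > 0"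
      using mn s0 by (auto intro!: Gp)
    thus ?thesis
      unfolding bessel_prod_coeff_def rGamma_inverse_Gamma e by (simp add: abs_mult divide_inverse mult_ac)
  qed
  have fpos: "f m > 0" for m
  proof -
    have "Gamma (1 + s + 2 * real m) > 0" "Gamma (1 + \<mu> + real m) > 0" "Gamma (1 + \<nu> + real m) > 0" "Gamma (1 + s + real m) > 0"
      "Gamma (1 + s - \<delta> + 2 * real m) > 0"
      using mn s0 \<delta> by (auto intro!: Gp)
    thus ?thesis unfolding f_def abs by simp
  qed
  have ratio: "f (Suc m) * v (real m) = f m * u (real m)" for m
  proof -
    have G1: "Gamma (y + 1) = y * Gamma y" if "y > 0" for y :: real
      using that by (intro Gamma_plus1) auto
    have G2: "Gamma (y + 2) = (y + 1) * y * Gamma y" if "y > 0" for y :: real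
    proof -
      have "y + 2 = y + 1 + 1" by simp
      hence "Gamma (y + 2) = Gamma (y + 1 + 1)" by (rule arg_cong)
      thus ?thesis using G1[of y] G1[of "y + 1"] that by simp
    qed
    define A B C D E where "A = Gamma (1 + s + 2 * real m)" "B = Gamma (1 + s - \<delta> + 2 * real m)"
      "C = Gamma (1 + \<mu> + real m)" "D = Gamma (1 + \<nu> + real m)" "E = Gamma (1 + s + real m)"
    have pos: "A > 0" "B > 0" "C > 0" "D > 0" "E > 0"
      unfolding A_B_C_D_E_def using mn s0 \<delta> by (auto intro!: Gp)
    have args: "1 + s + 2 * real (Suc m) = (1 + s + 2 * real m) + 2"
      "1 + s - \<delta> + 2 * real (Suc m) = (1 + s - \<delta> + 2 * real m) + 2"
      "1 + \<mu> + real (Suc m) = (1 + \<mu> + real m) + 1" "1 + \<nu> + real (Suc m) = (1 + \<nu> + real m) + 1"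
      "1 + s + real (Suc m) = (1 + s + real m) + 1" by simp_all
    have "Gamma (1 + s + 2 * real (Suc m)) = (2 + s + 2 * real m) * (1 + s + 2 * real m) * A"
      unfolding args A_B_C_D_E_def using s0 by (subst G2) auto
    moreover have "Gamma (1 + s - \<delta> + 2 * real (Suc m)) = (2 + s - \<delta> + 2 * real m) * (1 + s - \<delta> + 2 * real m) * B"
      unfolding args A_B_C_D_E_def using s0 \<delta> by (subst G2) auto
    moreover have "Gamma (1 + \<mu> + real (Suc m)) = (1 + \<mu> + real m) * C"
      "Gamma (1 + \<nu> + real (Suc m)) = (1 + \<nu> + real m) * D" "Gamma (1 + s + real (Suc m)) = (1 + s + real m) * E"
      unfolding args A_B_C_D_E_def using s0 mn by (subst G1; simp)+
    moreover have "(fact (Suc m) :: real) = (real m + 1) * fact m" by (simp add: algebra_simps)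
    ultimately have fS: "f (Suc m) = ((2 + s + 2 * real m) * (1 + s + 2 * real m) * A) * ((2 + s - \<delta> + 2 * real m) * (1 + s - \<delta> + 2 * real m) * B)
        / (((real m + 1) * fact m) * ((1 + \<mu> + real m) * C) * ((1 + \<nu> + real m) * D) * ((1 + s + real m) * E)) / (16 * 16 ^ m)"
      unfolding f_def abs power_Suc by (simp only: times_divide_eq_left)
    have fm: "f m = A * B / (fact m * C * D * E) / 16 ^ m"
      unfolding f_def abs A_B_C_D_E_def by simp
    have nz: "real m + 1 \<noteq> 0" "1 + \<mu> + real m \<noteq> 0" "1 + \<nu> + real m \<noteq> 0" "1 + s + real m \<noteq> 0"
      using mn s0 by (auto simp: add_eq_0_iff)
    have gen: "((u2 * u1 * A) * (u4 * u3 * B) / ((v1 * F) * (v2 * C) * (v3 * D) * (v4 * E)) / (16 * P)) * (16 * v1 * v2 * v3 * v4)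
        = A * B / (F * C * D * E) / P * (u1 * u2 * u3 * u4)"
      if "v1 \<noteq> 0" "v2 \<noteq> 0" "v3 \<noteq> 0" "v4 \<noteq> 0" for u1 u2 u3 u4 v1 v2 v3 v4 F P :: real
      using that by (simp add: mult_ac)
    show ?thesis unfolding fS fm u_def v_def by (rule gen) (use nz in auto)
  qed
  have upos: "u (real m) > 0" for m unfolding u_def using s0 \<delta> by (intro mult_pos_pos) auto
  have vpos: "v (real m) > 0" for m unfolding v_def using s0 mn by (intro mult_pos_pos) auto
  have "f m / f (Suc m) = v (real m) / u (real m)" for m
    using ratio[of m] fpos[of m] fpos[of "Suc m"] upos[of m]
    by (intro frac_eq_eq[THEN iffD2]) (auto simp: mult.commute)
  moreover have "(\<lambda>m. real m * (v (real m) / u (real m) - 1)) \<longlonglongrightarrow> 1 + \<delta>"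
  proof -
    \<comment> \<open>With \<open>m = 1 / t\<close> the quotient \<open>v m / u m\<close> becomes \<open>V t / Q t\<close>, and the limit becomes its derivative at \<open>0\<close>.\<close>
    define V where "V = (\<lambda>t. 16 * (1 + t) * (1 + (1 + \<mu>) * t) * (1 + (1 + \<nu>) * t) * (1 + (1 + s) * t) :: real)"
    define Q where "Q = (\<lambda>t. ((1 + s) * t + 2) * ((2 + s) * t + 2) * ((1 + s - \<delta>) * t + 2) * ((2 + s - \<delta>) * t + 2) :: real)"
    have dV: "(V has_real_derivative 16 * (4 + 2 * s)) (at 0)"
      unfolding V_def by (auto intro!: derivative_eq_intros simp: s_def algebra_simps)
    have dQ: "(Q has_real_derivative 16 * (3 + 2 * s - \<delta>)) (at 0)"
      unfolding Q_def by (auto intro!: derivative_eq_intros simp: algebra_simps)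
    have VQ0: "V 0 = 16" "Q 0 = 16" by (simp_all add: V_def Q_def)
    have "((\<lambda>t. V t / Q t) has_real_derivative (16 * (4 + 2 * s) * Q 0 - V 0 * (16 * (3 + 2 * s - \<delta>))) / (Q 0 * Q 0)) (at 0)"
      by (rule DERIV_divide[OF dV dQ]) (simp add: VQ0)
    also have "(16 * (4 + 2 * s) * Q 0 - V 0 * (16 * (3 + 2 * s - \<delta>))) / (Q 0 * Q 0) = 1 + \<delta>"
      unfolding VQ0 by simp
    finally have "((\<lambda>t. (V t / Q t - 1) / t) \<longlongrightarrow> 1 + \<delta>) (at 0)"
      by (simp add: has_field_derivative_iff VQ0)
    moreover have "filterlim (\<lambda>m. 1 / real m) (at 0) sequentially"
      unfolding filterlim_at by (intro conjI lim_1_over_n eventually_mono[OF eventually_gt_at_top[of 0]]) auto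
    ultimately have "(\<lambda>m. (V (1 / real m) / Q (1 / real m) - 1) / (1 / real m)) \<longlonglongrightarrow> 1 + \<delta>"
      by (rule filterlim_compose)
    moreover have "\<forall>\<^sub>F m in sequentially. (V (1 / real m) / Q (1 / real m) - 1) / (1 / real m) = real m * (v (real m) / u (real m) - 1)"
      using eventually_gt_at_top[of 0]
    proof eventually_elim
      case (elim m)
      define x where "x = real m"
      have x: "x > 0" using elim by (simp add: x_def)
      have lin: "1 + c * (1 / x) = (c + x) / x" "1 + 1 / x = (x + 1) / x" "c * (1 / x) + 2 = (c + 2 * x) / x" for c
        using x by (simp_all add: field_simps)
      have "V (1 / x) = v x / (x * x * x * x)" unfolding V_def v_def lin by simp
      moreover have "Q (1 / x) = u x / (x * x * x * x)" unfolding Q_def u_def lin by simp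
      ultimately have "V (1 / x) / Q (1 / x) = v x / u x" using x by simp
      thus ?case unfolding x_def[symmetric] by (simp add: mult.commute)
    qed
    ultimately show ?thesis by (rule Lim_transform_eventually)
  qed
  ultimately have "(\<lambda>m. ereal (real m * (f m / f (Suc m) - 1))) \<longlonglongrightarrow> ereal (1 + \<delta>)" by simp
  hence "liminf (\<lambda>m. ereal (real m * (f m / f (Suc m) - 1))) = ereal (1 + \<delta>)"
    by (intro lim_imp_Liminf) auto
  thus ?thesis
    unfolding f_eq using fpos \<delta> by (intro raabes_test_convergence) auto
qed

section \<open>Analytic continuation in the exponent\<close>

text \<open>The half-plane is chosen so that the Dirichlet series on the other side of the functional equation is
  bounded by \<open>\<zeta>(2)\<close>.\<close>
lemma norm_zeta_reflected_le:
  assumes "Re w \<le> -1"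
  shows "norm (zeta_reflected w) \<le> 2 * (2 * pi) powr (Re w - 1) * norm (sin (of_real pi * w / 2)) * Gamma (1 - Re w) * dirichlet_zeta 2"
proof -
  have "norm (complex_of_real (2 * pi) powr (w - 1)) = (2 * pi) powr (Re w - 1)"
    by (subst norm_powr_real_powr) simp_all
  moreover have "norm (Gamma (1 - w)) \<le> Gamma (1 - Re w)"
    using norm_Gamma_le[of "1 - w"] assms by simp
  moreover have "norm (zeta_series (1 - w)) \<le> dirichlet_zeta 2"
    using assms by (intro norm_zeta_series_le) auto
  ultimately show ?thesis
    unfolding zeta_reflected_def norm_mult by (intro mult_mono mult_nonneg_nonneg) (auto intro: order_trans[OF norm_ge_zero])
qed

lemma holomorphic_riemann_zeta_compose [holomorphic_intros]:
  assumes "f holomorphic_on A" "\<And>z. z \<in> A \<Longrightarrow> f z \<noteq> 1"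
  shows "(\<lambda>z. riemann_zeta (f z)) holomorphic_on A"
  by (rule holomorphic_on_compose_gen[OF assms(1) holomorphic_riemann_zeta, unfolded o_def]) (use assms(2) in auto)

locale exponent_continuation =
  fixes \<mu> \<nu> a :: real
  assumes mu: "\<mu> \<ge> 0" and nu: "\<nu> \<ge> 0" and a: "0 < a" "a \<le> pi"
begin

text \<open>At these points \<open>\<Gamma>((1 - \<theta>) / 2)\<close> in \<open>Fhat\<close> and one of the zeta values \<open>\<zeta>(\<theta> - 2 m)\<close> have poles.\<close>
definition poles :: "complex set" where
  "poles = (\<lambda>k::nat. of_real (\<mu> + \<nu> + 1 + 2 * real k)) ` UNIV"

definition region :: "complex set" where
  "region = {z. 0 < Re z} - poles"

lemma closed_poles: "closed poles"
proof -
  have "poles = (\<lambda>z. of_real (\<mu> + \<nu> + 1) + 2 * z) ` (\<nat> :: complex set)"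
    by (auto simp: poles_def Nats_def image_image)
  moreover have "closed ((\<lambda>z. of_real (\<mu> + \<nu> + 1) + z) ` ((\<lambda>z. 2 * z) ` (\<nat> :: complex set)))"
    by (intro closed_translation) (use closed_scaling[OF closed_Nats, of 2] in \<open>simp add: scaleR_conv_of_real\<close>)
  ultimately show ?thesis by (simp add: image_image)
qed

lemma open_region: "open region"
  unfolding region_def by (intro open_Diff open_halfspace_Re_gt closed_poles)

lemma connected_region: "connected region"
  unfolding region_def poles_def
  by (intro connected_open_diff_countable open_halfspace_Re_gt convex_connected convex_halfspace_Re_gt countable_image) auto

lemma region_args:
  assumes "z \<in> region"
  shows "z - of_real (\<mu> + \<nu>) - of_nat (2 * m) \<noteq> 1" and "(1 + of_real (\<mu> + \<nu>) - z) / 2 \<notin> \<int>\<^sub>\<le>\<^sub>0"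
proof -
  have ne: "z \<noteq> of_real (\<mu> + \<nu> + 1 + 2 * real k)" for k
    using assms by (auto simp: region_def poles_def)
  show "z - of_real (\<mu> + \<nu>) - of_nat (2 * m) \<noteq> 1"
  proof
    assume "z - of_real (\<mu> + \<nu>) - of_nat (2 * m) = 1"
    hence "z = 1 + of_nat (2 * m) + of_real (\<mu> + \<nu>)" by (simp only: diff_eq_eq)
    also have "\<dots> = of_real (\<mu> + \<nu> + 1 + 2 * real m)" by simp
    finally show False using ne by blast
  qed
  show "(1 + of_real (\<mu> + \<nu>) - z) / 2 \<notin> \<int>\<^sub>\<le>\<^sub>0"
  proof
    assume "(1 + of_real (\<mu> + \<nu>) - z) / 2 \<in> \<int>\<^sub>\<le>\<^sub>0"
    then obtain k where "(1 + of_real (\<mu> + \<nu>) - z) / 2 = - of_nat k" by (auto elim!: nonpos_Ints_cases')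
    hence "1 + of_real (\<mu> + \<nu>) - z = - of_nat k * 2" by (simp only: divide_eq_eq) simp
    hence "z = of_real (\<mu> + \<nu> + 1 + 2 * real k)" by (simp add: algebra_simps)
    thus False using ne by blast
  qed
qed

definition expansion_coeff :: "nat \<Rightarrow> complex \<Rightarrow> complex" where
  "expansion_coeff m z = of_real (bessel_prod_coeff \<mu> \<nu> m * (a / 2) ^ (2 * m)) *
     riemann_zeta (z - of_real (\<mu> + \<nu>) - of_nat (2 * m))"

definition Fhat :: "complex \<Rightarrow> complex" where
  "Fhat z = of_real (a / 2) powr (z - of_real (\<mu> + \<nu>) - 1) * Gamma z * Gamma ((1 + of_real (\<mu> + \<nu>) - z) / 2) / 2 *
     rGamma ((z + of_real (\<mu> - \<nu> + 1)) / 2) * rGamma ((z + of_real (\<mu> + \<nu> + 1)) / 2) * rGamma ((z + of_real (\<nu> - \<mu> + 1)) / 2)"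

definition S_term :: "nat \<Rightarrow> complex \<Rightarrow> complex" where
  "S_term n z = of_real (schlomilch_term \<mu> \<nu> a n) * of_nat (Suc n) powr (- z)"

lemma holomorphic_Fhat: "Fhat holomorphic_on region"
proof -
  have "z \<notin> \<int>\<^sub>\<le>\<^sub>0" if "z \<in> region" for z
    using that by (auto simp: region_def elim!: nonpos_Ints_cases)
  thus ?thesis unfolding Fhat_def using a region_args(2)
    by (intro holomorphic_intros) auto
qed

lemma holomorphic_expansion_coeff: "expansion_coeff m holomorphic_on region"
  unfolding expansion_coeff_def using region_args(1) by (intro holomorphic_intros) auto

text \<open>Two factors of order \<open>n powr (- 1/2)\<close> each.\<close>
lemma schlomilch_term_bound: "\<exists>C. \<forall>\<^sub>F n in sequentially. \<bar>schlomilch_term \<mu> \<nu> a n\<bar> \<le> C * (real n + 1) powr - 1"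
proof -
  obtain C X where C: "\<And>x. x \<ge> X \<Longrightarrow> \<bar>bessel_J \<mu> x\<bar> \<le> C / sqrt x" using bessel_J_bound[OF mu] by blast
  obtain D Y where D: "\<And>x. x \<ge> Y \<Longrightarrow> \<bar>bessel_J \<nu> x\<bar> \<le> D / sqrt x" using bessel_J_bound[OF nu] by blast
  have "filterlim (\<lambda>n. (real n + 1) * a) at_top sequentially" using a by real_asymp
  hence "\<forall>\<^sub>F n in sequentially. (real n + 1) * a \<ge> max X Y" by (simp only: filterlim_at_top)
  hence "\<forall>\<^sub>F n in sequentially. \<bar>schlomilch_term \<mu> \<nu> a n\<bar> \<le> 2 powr (\<mu> + \<nu>) / a powr (\<mu> + \<nu>) * (C * D) / a * (real n + 1) powr - 1"
  proof eventually_elim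
    case (elim n)
    define x where "x = (real n + 1) * a"
    have x0: "x > 0" using a by (simp add: x_def)
    have x: "x \<ge> X" "x \<ge> Y" using elim by (simp_all add: x_def)
    have "\<bar>bessel_J \<mu> x * bessel_J \<nu> x\<bar> \<le> (C / sqrt x) * (D / sqrt x)"
      unfolding abs_mult using C[OF x(1)] D[OF x(2)] by (intro mult_mono) (auto intro: order_trans[OF abs_ge_zero])
    also have "\<dots> = C * D / x" using x0 by simp
    finally have "2 powr (\<mu> + \<nu>) / a powr (\<mu> + \<nu>) * \<bar>bessel_J \<mu> x * bessel_J \<nu> x\<bar> \<le> 2 powr (\<mu> + \<nu>) / a powr (\<mu> + \<nu>) * (C * D / x)"
      by (intro mult_left_mono) auto
    moreover have "\<bar>schlomilch_term \<mu> \<nu> a n\<bar> = 2 powr (\<mu> + \<nu>) / a powr (\<mu> + \<nu>) * \<bar>bessel_J \<mu> x * bessel_J \<nu> x\<bar>"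
      by (simp add: schlomilch_term_def x_def abs_mult add.commute)
    moreover have "2 powr (\<mu> + \<nu>) / a powr (\<mu> + \<nu>) * (C * D / x) = 2 powr (\<mu> + \<nu>) / a powr (\<mu> + \<nu>) * (C * D) / a * (real n + 1) powr - 1"
      using a by (simp add: x_def powr_minus divide_inverse mult_ac)
    ultimately show ?case by (simp only:)
  qed
  thus ?thesis by blast
qed

lemma
  shows holomorphic_S: "(\<lambda>z. \<Sum>n. S_term n z) holomorphic_on region"
    and summable_S: "z \<in> region \<Longrightarrow> summable (\<lambda>n. S_term n z)"
proof -
  have hol: "S_term n holomorphic_on region" for n
    unfolding S_term_def by (intro holomorphic_intros)
  obtain C where C: "\<forall>\<^sub>F n in sequentially. \<bar>schlomilch_term \<mu> \<nu> a n\<bar> \<le> C * (real n + 1) powr - 1"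
    using schlomilch_term_bound by blast
  have bnd: "\<exists>d>0. \<exists>M. summable M \<and> cball z d \<subseteq> region \<and>
       (\<forall>\<^sub>F n in sequentially. \<forall>w\<in>cball z d. norm (S_term n w) \<le> M n)" if "z \<in> region" for z
  proof -
    from open_region that obtain e where e: "e > 0" "cball z e \<subseteq> region" by (auto simp: open_contains_cball)
    define d where "d = min e (Re z / 2)"
    have d: "d > 0" "d \<le> e" using e that unfolding d_def by (auto simp: region_def)
    have d': "d \<le> Re z / 2" unfolding d_def by (rule min.cobounded2)
    have sub: "cball z d \<subseteq> region" using d e by (meson order_trans subset_cball)
    have Re: "Re w \<ge> Re z / 2" if "w \<in> cball z d" for w
      using abs_Re_le_cmod[of "z - w"] that d' by (simp add: dist_norm field_simps)
    have z0: "Re z > 0" using that by (simp add: region_def)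
    show ?thesis
    proof (intro exI[of _ d] exI[of _ "\<lambda>n. \<bar>C\<bar> * (real n + 1) powr (- 1 - Re z / 2)"] conjI)
      show "summable (\<lambda>n. \<bar>C\<bar> * (real n + 1) powr (- 1 - Re z / 2))"
        using z0 by (intro summable_mult summable_real_powr) auto
      show "\<forall>\<^sub>F n in sequentially. \<forall>w\<in>cball z d. norm (S_term n w) \<le> \<bar>C\<bar> * (real n + 1) powr (- 1 - Re z / 2)"
        using C
      proof (eventually_elim, intro ballI)
        fix n w assume n: "\<bar>schlomilch_term \<mu> \<nu> a n\<bar> \<le> C * (real n + 1) powr - 1" and w: "w \<in> cball z d"
        have "norm (S_term n w) = \<bar>schlomilch_term \<mu> \<nu> a n\<bar> * (real n + 1) powr (- Re w)"
          unfolding S_term_def norm_mult norm_Suc_powr by simp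
        also have "\<dots> \<le> (\<bar>C\<bar> * (real n + 1) powr - 1) * (real n + 1) powr (- (Re z / 2))"
        proof (rule mult_mono)
          have "C * (real n + 1) powr - 1 \<le> \<bar>C\<bar> * (real n + 1) powr - 1" by (intro mult_right_mono) auto
          with n show "\<bar>schlomilch_term \<mu> \<nu> a n\<bar> \<le> \<bar>C\<bar> * (real n + 1) powr - 1" by linarith
          show "(real n + 1) powr (- Re w) \<le> (real n + 1) powr (- (Re z / 2))"
            using Re[OF w] by (intro powr_mono) auto
        qed auto
        also have "\<dots> = \<bar>C\<bar> * (real n + 1) powr (- 1 - Re z / 2)"
          by (simp only: mult.assoc powr_add[symmetric] diff_conv_add_uminus)
        finally show "norm (S_term n w) \<le> \<bar>C\<bar> * (real n + 1) powr (- 1 - Re z / 2)" .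
      qed
    qed (use d sub in auto)
  qed
  show "(\<lambda>z. \<Sum>n. S_term n z) holomorphic_on region" by (rule holomorphic_on_suminf(1)[OF open_region hol bnd])
  show "z \<in> region \<Longrightarrow> summable (\<lambda>n. S_term n z)" by (rule holomorphic_on_suminf(2)[OF open_region hol bnd])
qed

text \<open>The functional equation contributes a power \<open>(2 \<pi>) powr (- 2 m)\<close>, which together with \<open>a / 2 \<le> \<pi> / 2\<close>
  gives the factor \<open>1 / 16\<^sup>m\<close>; the sine changes only by a sign with \<open>m\<close>; and the Gamma value grows if
  \<open>Re w\<close> is replaced by its lower bound \<open>\<delta>\<close>. What still depends on \<open>w\<close> is then bounded on compact sets.\<close>
lemma expansion_coeff_bound:
  assumes \<delta>: "0 < \<delta>" "\<delta> \<le> 1 / 2" and w: "\<delta> \<le> Re w" "Re w - (\<mu> + \<nu>) - 2 * real m \<le> -1"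
  shows "norm (expansion_coeff m w) \<le> 2 * dirichlet_zeta 2 * (2 * pi) powr (Re w - (\<mu> + \<nu>) - 1) *
     norm (sin (of_real pi * (w - of_real (\<mu> + \<nu>)) / 2)) *
     (\<bar>bessel_prod_coeff \<mu> \<nu> m\<bar> * Gamma (1 + \<mu> + \<nu> - \<delta> + 2 * real m) / 16 ^ m)"
proof -
  define s where "s = \<mu> + \<nu>"
  define w' where "w' = w - of_real s - of_nat (2 * m)"
  have Rew': "Re w' = Re w - s - 2 * real m" by (simp add: w'_def)
  have w'1: "Re w' \<le> -1" using w by (simp add: Rew' s_def)
  have "norm (riemann_zeta w') = norm (zeta_reflected w')"
    using w'1 by (subst riemann_zeta_functional_eq) auto
  also have "\<dots> \<le> 2 * (2 * pi) powr (Re w' - 1) * norm (sin (of_real pi * w' / 2)) * Gamma (1 - Re w') * dirichlet_zeta 2"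
    by (rule norm_zeta_reflected_le[OF w'1])
  also have "norm (sin (of_real pi * w' / 2)) = norm (sin (of_real pi * (w - of_real s) / 2))"
  proof -
    have "of_real pi * w' / 2 = of_real pi * (w - of_real s) / 2 - of_real (real m * pi)"
      by (simp add: w'_def algebra_simps diff_divide_distrib)
    hence "sin (of_real pi * w' / 2) = sin (of_real pi * (w - of_real s) / 2) * of_real (cos (real m * pi))
        - cos (of_real pi * (w - of_real s) / 2) * of_real (sin (real m * pi))"
      by (simp only: sin_diff sin_of_real cos_of_real)
    also have "\<dots> = sin (of_real pi * (w - of_real s) / 2) * (-1) ^ m"
      by (simp add: cos_npi sin_npi)
    finally show ?thesis by (simp add: norm_mult norm_power)
  qed
  also have "(2 * pi) powr (Re w' - 1) = (2 * pi) powr (Re w - s - 1) / (4 * pi\<^sup>2) ^ m"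
  proof -
    have "Re w' - 1 = (Re w - s - 1) - real (2 * m)" by (simp add: Rew')
    hence "(2 * pi) powr (Re w' - 1) = (2 * pi) powr (Re w - s - 1) / (2 * pi) ^ (2 * m)"
      by (simp only: powr_diff) (subst powr_realpow, simp_all)
    thus ?thesis by (simp add: power_mult power_mult_distrib)
  qed
  finally have Z: "norm (riemann_zeta w') \<le> 2 * ((2 * pi) powr (Re w - s - 1) / (4 * pi\<^sup>2) ^ m) *
     norm (sin (of_real pi * (w - of_real s) / 2)) * Gamma (1 - Re w') * dirichlet_zeta 2" .
  have G: "Gamma (1 - Re w') \<le> Gamma (1 + s - \<delta> + 2 * real m)"
  proof (cases "Re w = \<delta>")
    case True
    thus ?thesis by (simp add: Rew' add_ac diff_diff_eq2 algebra_simps)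
  next
    case False
    with w have "1 - Re w' < 1 + s - \<delta> + 2 * real m" by (simp add: Rew')
    moreover have "1 - Re w' \<ge> 3 / 2" using w'1 by simp
    ultimately show ?thesis by (intro less_imp_le[OF Gamma_real_strict_mono])
  qed
  have pa: "(a / 2) ^ (2 * m) / (4 * pi\<^sup>2) ^ m \<le> 1 / 16 ^ m"
  proof -
    have "(a / 2)\<^sup>2 / (4 * pi\<^sup>2) \<le> 1 / 16"
      using power_mono[OF a(2), of 2] a(1) by (simp add: power_divide field_simps)
    hence "((a / 2)\<^sup>2 / (4 * pi\<^sup>2)) ^ m \<le> (1 / 16) ^ m" by (intro power_mono) auto
    also have "((a / 2)\<^sup>2 / (4 * pi\<^sup>2)) ^ m = (a / 2) ^ (2 * m) / (4 * pi\<^sup>2) ^ m"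
      by (simp only: power_divide[of "(a / 2)\<^sup>2"] power_mult)
    also have "(1 / 16 :: real) ^ m = 1 / 16 ^ m" by (rule power_one_over)
    finally show ?thesis .
  qed
  define T where "T = 2 * dirichlet_zeta 2 * (2 * pi) powr (Re w - s - 1) * norm (sin (of_real pi * (w - of_real s) / 2))"
  define g where "g = Gamma (1 + s - \<delta> + 2 * real m)"
  have T0: "T \<ge> 0" unfolding T_def using dirichlet_zeta_nonneg[of 2] by simp
  have g0: "Gamma (1 - Re w') \<ge> 0" using w'1 by (intro less_imp_le Gamma_real_pos) simp
  have "norm (expansion_coeff m w) = \<bar>bessel_prod_coeff \<mu> \<nu> m\<bar> * (a / 2) ^ (2 * m) * norm (riemann_zeta w')"
    unfolding expansion_coeff_def norm_mult w'_def s_def norm_of_real abs_mult using a by simp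
  also have "\<dots> \<le> \<bar>bessel_prod_coeff \<mu> \<nu> m\<bar> * (a / 2) ^ (2 * m) * (2 * ((2 * pi) powr (Re w - s - 1) / (4 * pi\<^sup>2) ^ m) *
     norm (sin (of_real pi * (w - of_real s) / 2)) * Gamma (1 - Re w') * dirichlet_zeta 2)"
    using Z by (intro mult_left_mono) auto
  also have "\<dots> = T * (\<bar>bessel_prod_coeff \<mu> \<nu> m\<bar> * Gamma (1 - Re w') * ((a / 2) ^ (2 * m) / (4 * pi\<^sup>2) ^ m))"
    unfolding T_def by simp
  also have "\<dots> \<le> T * (\<bar>bessel_prod_coeff \<mu> \<nu> m\<bar> * g * (1 / 16 ^ m))"
    using pa G g0 T0 unfolding g_def by (intro mult_left_mono mult_mono mult_nonneg_nonneg) auto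
  also have "\<dots> = T * (\<bar>bessel_prod_coeff \<mu> \<nu> m\<bar> * g / 16 ^ m)" by simp
  also have "g = Gamma (1 + \<mu> + \<nu> - \<delta> + 2 * real m)" unfolding g_def s_def by (simp add: add_ac)
  finally show ?thesis unfolding T_def s_def .
qed

lemma
  shows holomorphic_expansion_sum: "(\<lambda>z. \<Sum>m. expansion_coeff m z) holomorphic_on region"
    and summable_expansion_coeff: "z \<in> region \<Longrightarrow> summable (\<lambda>m. expansion_coeff m z)"
proof -
  have bnd: "\<exists>d>0. \<exists>M. summable M \<and> cball z d \<subseteq> region \<and>
       (\<forall>\<^sub>F m in sequentially. \<forall>w\<in>cball z d. norm (expansion_coeff m w) \<le> M m)" if "z \<in> region" for z
  proof -
    from open_region that obtain e where e: "e > 0" "cball z e \<subseteq> region" by (auto simp: open_contains_cball)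
    define d where "d = min e (Re z / 2)"
    have d: "d > 0" "d \<le> e" using e that unfolding d_def by (auto simp: region_def)
    have d': "d \<le> Re z / 2" unfolding d_def by (rule min.cobounded2)
    have sub: "cball z d \<subseteq> region" using d e by (meson order_trans subset_cball)
    have z0: "Re z > 0" using that by (simp add: region_def)
    define \<delta> where "\<delta> = min (1 / 2) (Re z / 2)"
    have \<delta>: "0 < \<delta>" "\<delta> \<le> 1 / 2" using z0 by (auto simp: \<delta>_def)
    have \<delta>z: "\<delta> \<le> Re z / 2" unfolding \<delta>_def by (rule min.cobounded2)
    have Re: "Re w \<ge> \<delta>" "Re w \<le> 2 * Re z" if "w \<in> cball z d" for w
      using abs_Re_le_cmod[of "z - w"] that d' \<delta>z z0 by (simp_all add: dist_norm)
    define T where "T = (\<lambda>w. 2 * dirichlet_zeta 2 * (2 * pi) powr (Re w - (\<mu> + \<nu>) - 1) *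
       norm (sin (of_real pi * (w - of_real (\<mu> + \<nu>)) / 2)))"
    have "continuous_on (cball z d) T" unfolding T_def by (intro continuous_intros) auto
    hence "compact (T ` cball z d)" by (intro compact_continuous_image) auto
    hence "bounded (T ` cball z d)" by (rule compact_imp_bounded)
    then obtain B where B: "\<And>w. w \<in> cball z d \<Longrightarrow> norm (T w) \<le> B" unfolding bounded_iff by blast
    define b where "b = (\<lambda>m. \<bar>bessel_prod_coeff \<mu> \<nu> m\<bar> * Gamma (1 + \<mu> + \<nu> - \<delta> + 2 * real m) / 16 ^ m)"
    have b0: "b m \<ge> 0" for m
    proof -
      have "Gamma (1 + \<mu> + \<nu> - \<delta> + 2 * real m) > 0" using mu nu \<delta> by (intro Gamma_real_pos) auto
      thus ?thesis by (simp add: b_def)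
    qed
    show ?thesis
    proof (intro exI[of _ d] exI[of _ "\<lambda>m. B * b m"] conjI)
      show "summable (\<lambda>m. B * b m)"
        unfolding b_def by (intro summable_mult summable_coeff_majorant mu nu \<delta>)
      have "filterlim (\<lambda>m. 2 * real m) at_top sequentially" by real_asymp
      hence "\<forall>\<^sub>F m in sequentially. 2 * real m \<ge> 2 * Re z + 1" unfolding filterlim_at_top by blast
      thus "\<forall>\<^sub>F m in sequentially. \<forall>w\<in>cball z d. norm (expansion_coeff m w) \<le> B * b m"
      proof (eventually_elim, intro ballI)
        fix m w assume m: "2 * real m \<ge> 2 * Re z + 1" and w: "w \<in> cball z d"
        have "norm (expansion_coeff m w) \<le> T w * b m"
          unfolding T_def b_def using Re[OF w] m mu nu by (intro expansion_coeff_bound \<delta>) auto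
        also have "\<dots> \<le> B * b m" using B[OF w] b0 by (intro mult_right_mono) auto
        finally show "norm (expansion_coeff m w) \<le> B * b m" .
      qed
    qed (use d sub in auto)
  qed
  show "(\<lambda>z. \<Sum>m. expansion_coeff m z) holomorphic_on region" by (rule holomorphic_on_suminf(1)[OF open_region holomorphic_expansion_coeff bnd])
  show "z \<in> region \<Longrightarrow> summable (\<lambda>m. expansion_coeff m z)" by (rule holomorphic_on_suminf(2)[OF open_region holomorphic_expansion_coeff bnd])
qed

lemma expansion_coeff_of_real: "expansion_coeff m (of_real \<alpha>) = coeff_A \<alpha> \<mu> \<nu> m * of_real ((a / 2) ^ (2 * m))"
proof -
  have "complex_of_real \<alpha> - of_real (\<mu> + \<nu>) - of_nat (2 * m) = of_real (\<alpha> - \<mu> - \<nu> - 2 * real m)" by simp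
  thus ?thesis unfolding expansion_coeff_def coeff_A_eq by (simp only: of_real_mult mult_ac)
qed

lemma Fhat_of_real: "Fhat (of_real \<alpha>) = of_real (Fhat1 \<alpha> \<mu> \<nu> a)"
proof -
  have e: "complex_of_real \<alpha> - of_real (\<mu> + \<nu>) - 1 = of_real (\<alpha> - \<mu> - \<nu> - 1)"
    "(1 + complex_of_real (\<mu> + \<nu>) - of_real \<alpha>) / 2 = of_real (\<mu> / 2 + \<nu> / 2 + 1 / 2 - \<alpha> / 2)"
    "(complex_of_real \<alpha> + of_real (\<mu> - \<nu> + 1)) / 2 = of_real (\<alpha> / 2 + \<mu> / 2 - \<nu> / 2 + 1 / 2)"
    "(complex_of_real \<alpha> + of_real (\<mu> + \<nu> + 1)) / 2 = of_real (\<alpha> / 2 + \<mu> / 2 + \<nu> / 2 + 1 / 2)"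
    "(complex_of_real \<alpha> + of_real (\<nu> - \<mu> + 1)) / 2 = of_real (\<alpha> / 2 + \<nu> / 2 - \<mu> / 2 + 1 / 2)"
    by (simp_all add: complex_eq_iff add_divide_distrib diff_divide_distrib)
  have "complex_of_real (a / 2) powr of_real (\<alpha> - \<mu> - \<nu> - 1) = of_real ((a / 2) powr (\<alpha> - \<mu> - \<nu> - 1))"
    using a by (intro powr_of_real) auto
  thus ?thesis unfolding Fhat_def Fhat1_def e Gamma_complex_of_real rGamma_complex_of_real by simp
qed

lemma S_term_of_real: "S_term n (of_real \<alpha>) =
  of_real (2 powr (\<mu> + \<nu>) / a powr (\<mu> + \<nu>) *
    (bessel_J \<mu> (real (Suc n) * a) * bessel_J \<nu> (real (Suc n) * a) / real (Suc n) powr \<alpha>))"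
proof -
  have "of_nat (Suc n) powr (- complex_of_real \<alpha>) = of_real (real (Suc n) powr (- \<alpha>))"
    using powr_of_real[of "real (Suc n)" "- \<alpha>"] by simp
  thus ?thesis unfolding S_term_def schlomilch_term_def powr_minus_divide by simp
qed

text \<open>Both sides are holomorphic on a connected region and agree at the real points \<open>s + 1 + p\<close> with
  \<open>0 < p < 1/2\<close>, which accumulate at the interior point with \<open>p = 1/4\<close>.\<close>
lemma expansion_on_region:
  assumes "z \<in> region"
  shows "(\<Sum>n. S_term n z) = Fhat z + (\<Sum>m. expansion_coeff m z)"
proof -
  define U where "U = (\<lambda>p. complex_of_real (\<mu> + \<nu> + p + 1)) ` {0<..<1/2}"
  define \<xi> where "\<xi> = complex_of_real (\<mu> + \<nu> + 1 / 4 + 1)"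
  have U: "U \<subseteq> region"
  proof
    fix z assume "z \<in> U"
    then obtain p where p: "0 < p" "p < 1 / 2" "z = of_real (\<mu> + \<nu> + p + 1)" by (auto simp: U_def)
    have "\<mu> + \<nu> + p + 1 \<noteq> \<mu> + \<nu> + 1 + 2 * real k" for k using p by (cases k) auto
    hence "z \<notin> poles" unfolding poles_def p(3) by (auto simp only: of_real_eq_iff)
    moreover have "Re z > 0" using p mu nu by simp
    ultimately show "z \<in> region" by (simp add: region_def)
  qed
  have "(\<Sum>n. S_term n z) - (Fhat z + (\<Sum>m. expansion_coeff m z)) = 0"
  proof (rule analytic_continuation[of "\<lambda>z. (\<Sum>n. S_term n z) - (Fhat z + (\<Sum>m. expansion_coeff m z))" region U \<xi>])
    show "(\<lambda>z. (\<Sum>n. S_term n z) - (Fhat z + (\<Sum>m. expansion_coeff m z))) holomorphic_on region"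
      by (intro holomorphic_on_diff holomorphic_on_add holomorphic_S holomorphic_Fhat holomorphic_expansion_sum)
    have "\<xi> \<in> U" unfolding U_def \<xi>_def by (intro imageI) simp
    thus "\<xi> \<in> region" using U by blast
    show "\<xi> islimpt U"
      unfolding islimpt_sequential
    proof (intro exI[of _ "\<lambda>n. complex_of_real (\<mu> + \<nu> + (1 / 4 + 1 / (real n + 8)) + 1)"] conjI allI)
      fix n
      have "1 / (real n + 8) > 0" "1 / (real n + 8) < 1 / 4" by (simp_all add: field_simps)
      hence "1 / 4 + 1 / (real n + 8) \<in> {0<..<1/2}" "\<mu> + \<nu> + (1 / 4 + 1 / (real n + 8)) + 1 \<noteq> \<mu> + \<nu> + 1 / 4 + 1"
        unfolding greaterThanLessThan_iff by linarith+
      thus "complex_of_real (\<mu> + \<nu> + (1 / 4 + 1 / (real n + 8)) + 1) \<in> U - {\<xi>}"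
        unfolding U_def \<xi>_def by (simp only: Diff_iff singleton_iff of_real_eq_iff) blast
    next
      have "(\<lambda>n. 1 / (real n + 8)) \<longlonglongrightarrow> 0" by real_asymp
      hence "(\<lambda>n. \<mu> + \<nu> + (1 / 4 + 1 / (real n + 8)) + 1) \<longlonglongrightarrow> \<mu> + \<nu> + (1 / 4 + 0) + 1"
        by (intro tendsto_add tendsto_const)
      thus "(\<lambda>n. complex_of_real (\<mu> + \<nu> + (1 / 4 + 1 / (real n + 8)) + 1)) \<longlonglongrightarrow> \<xi>"
        unfolding \<xi>_def by (intro tendsto_of_real) simp
    qed
    show "(\<Sum>n. S_term n z) - (Fhat z + (\<Sum>m. expansion_coeff m z)) = 0" if "z \<in> U" for z
    proof -
      from that obtain p where p: "0 < p" "p < 1 / 2" and z: "z = of_real (\<mu> + \<nu> + p + 1)" by (auto simp: U_def)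
      from schlomilch_expansion_near_boundary[OF p a mu nu] show ?thesis
        unfolding z Fhat_of_real expansion_coeff_of_real S_term_def by simp
    qed
  qed (use U open_region connected_region assms in auto)
  thus ?thesis by simp
qed

end

theorem theorem1:
  fixes \<mu> \<nu> \<alpha> a :: real
  assumes "\<mu> \<ge> 0" and "\<nu> \<ge> 0" and "\<alpha> > 0"
    and "\<forall>k::nat. \<alpha> - \<mu> - \<nu> \<noteq> real k"
    and "0 < a" and "a \<le> pi"
  shows "summable (\<lambda>m. coeff_A \<alpha> \<mu> \<nu> m * of_real ((a / 2) ^ (2 * m))) \<and>
         complex_of_real (schlomilch_S \<alpha> \<mu> \<nu> a) =
           of_real (Fhat1 \<alpha> \<mu> \<nu> a) + (\<Sum>m. coeff_A \<alpha> \<mu> \<nu> m * of_real ((a / 2) ^ (2 * m)))"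
proof -
  interpret exponent_continuation \<mu> \<nu> a by standard (use assms in auto)
  have "complex_of_real \<alpha> \<notin> poles"
  proof
    assume "complex_of_real \<alpha> \<in> poles"
    then obtain k :: nat where "\<alpha> = \<mu> + \<nu> + 1 + 2 * real k" unfolding poles_def by (auto simp only: of_real_eq_iff)
    hence "\<alpha> - \<mu> - \<nu> = real (2 * k + 1)" by simp
    thus False using assms(4) by blast
  qed
  hence region: "complex_of_real \<alpha> \<in> region" using assms(3) by (simp add: region_def)
  define c where "c = 2 powr (\<mu> + \<nu>) / a powr (\<mu> + \<nu>)"
  define t where "t = (\<lambda>n. bessel_J \<mu> (real (Suc n) * a) * bessel_J \<nu> (real (Suc n) * a) / real (Suc n) powr \<alpha>)"
  have c0: "c \<noteq> 0" using assms by (simp add: c_def)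
  have "summable (\<lambda>n. complex_of_real (c * t n))"
    using summable_S[OF region] unfolding S_term_of_real c_def t_def .
  hence s1: "summable (\<lambda>n. c * t n)" by (simp only: summable_complex_of_real)
  hence "summable t" using c0 by (simp add: summable_cmult_iff)
  hence "schlomilch_S \<alpha> \<mu> \<nu> a = (\<Sum>n. c * t n)"
    unfolding schlomilch_S_def c_def[symmetric] t_def[symmetric] by (rule suminf_mult[symmetric])
  also have "complex_of_real (\<Sum>n. c * t n) = (\<Sum>n. S_term n (of_real \<alpha>))"
    unfolding S_term_of_real c_def[symmetric] t_def by (rule suminf_of_real[OF s1[unfolded t_def]])
  finally have "complex_of_real (schlomilch_S \<alpha> \<mu> \<nu> a) =
      of_real (Fhat1 \<alpha> \<mu> \<nu> a) + (\<Sum>m. coeff_A \<alpha> \<mu> \<nu> m * of_real ((a / 2) ^ (2 * m)))"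
    unfolding expansion_on_region[OF region] Fhat_of_real expansion_coeff_of_real .
  moreover have "summable (\<lambda>m. coeff_A \<alpha> \<mu> \<nu> m * of_real ((a / 2) ^ (2 * m)))"
    using summable_expansion_coeff[OF region] unfolding expansion_coeff_of_real .
  ultimately show ?thesis by blast
qed

end
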